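(* Let $n\ge2$, let $f_{n-1}$ be an even function on $\mathbb R^n$ that is locally integrable on each hyperplane $\xi^\perp$, $\xi\in S^{n-1}$, and let $K$ be an origin-symmetric star-shaped body in $\mathbb R^n$. Then $$\mu_{n-1}(K\cap\xi^\perp)=\frac1\pi\left(|x|^{-n+1}\int_0^{|x|/\|x\|_K}t^{n-2}f_{n-1}\left(\frac{tx}{|x|}\right)dt\right)^{\wedge}(\xi)$$ for $\xi\in S^{n-1}$.
   Context: $\xi^\perp$ is the hyperplane through the origin orthogonal to $\xi$, and $\mu_{n-1}(B)=\int_B f_{n-1}(x)\,dx$ for bounded Borel $B\subset\xi^\perp$, where $dx$ is $(n-1)$-dimensional Lebesgue measure on $\xi^\perp$. $|x|$ is the Euclidean norm. A star-shaped body is a compact set with non-empty interior that is star-shaped with respect to the origin. Its Minkowski functional is $\|x\|_K=\min\{a>0: x\in aK\}$. The symbol $^\wedge$ denotes the Fourier transform in the sense of distributions, taken in the variable $x$: $\langle\hat f,\phi\rangle=\langle f,\hat\phi\rangle$ for Schwartz functions $\phi$, with $\hat\phi(\xi)=\int\phi(x)e^{-i(x,\xi)}dx$. The function in parentheses is even and homogeneous of degree $-n+1$, so its Fourier transform is homogeneous of degree $-1$.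
   Formalization: The function in parentheses is additionally assumed locally integrable on R^n (not implied, needed for its transform to exist); the value at ξ is that of a degree −1 homogeneous function representing the transform, continuous off 0 when the function in parentheses is. *)

theory Defs
  imports "HOL-Analysis.Analysis"
begin

text \<open>Lebesgue measure on a linear subspace \<open>S\<close>, carried by the ambient space and concentrated
  on \<open>S\<close>: the image of the product measure under the coordinates of an orthonormal basis, exactly
  as \<^const>\<open>lborel\<close> is built from \<^const>\<open>Basis\<close>. By rotation invariance the choice of the basis
  is immaterial.\<close>

definition orthonormal_basis_of :: "'a::euclidean_space set \<Rightarrow> 'a set \<Rightarrow> bool" where
  "orthonormal_basis_of B S \<longleftrightarrow>
     pairwise orthogonal B \<and> (\<forall>b\<in>B. norm b = 1) \<and> span B = S"

definition subspace_lborel :: "'a::euclidean_space set \<Rightarrow> 'a measure" where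
  "subspace_lborel S =
     (let B = (SOME B. orthonormal_basis_of B S)
      in distr (\<Pi>\<^sub>M b\<in>B. (lborel :: real measure)) borel (\<lambda>c. \<Sum>b\<in>B. c b *\<^sub>R b))"

definition subspace_lebesgue :: "'a::euclidean_space set \<Rightarrow> 'a measure" where
  "subspace_lebesgue S = completion (subspace_lborel S)"

definition locally_integrable ::
    "'a::euclidean_space measure \<Rightarrow> ('a \<Rightarrow> 'b::{banach, second_countable_topology}) \<Rightarrow> bool" where
  "locally_integrable M f \<longleftrightarrow> (\<forall>C. compact C \<longrightarrow> set_integrable M C f)"

definition hyperplane_measure ::
    "('a::euclidean_space \<Rightarrow> real) \<Rightarrow> 'a \<Rightarrow> 'a set \<Rightarrow> real" where
  "hyperplane_measure f \<xi> B = (LINT x:B|subspace_lebesgue ({\<xi>}\<^sup>\<bottom>). f x)"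

definition star_body :: "'a::euclidean_space set \<Rightarrow> bool" where
  "star_body K \<longleftrightarrow>
     compact K \<and> interior K \<noteq> {} \<and> (\<forall>x\<in>K. closed_segment 0 x \<subseteq> K)"

text \<open>The origin need not be an interior point of a star-shaped body, so that \<open>x\<close> may lie in no
  dilate of \<open>K\<close>; the infimum is taken in \<^typ>\<open>ennreal\<close>, and its value is then \<open>\<infinity>\<close>. Otherwise it
  is a minimum for \<open>x \<noteq> 0\<close>, by compactness.\<close>

definition minkowski_functional :: "'a::euclidean_space set \<Rightarrow> 'a \<Rightarrow> ennreal" where
  "minkowski_functional K x = (INF a\<in>{a. 0 < a \<and> x \<in> (*\<^sub>R) a ` K}. ennreal a)"

text \<open>The function \<open>|x|\<^bsup>-n+1\<^esup> \<integral>\<^sub>0\<^bsup>|x|/\<parallel>x\<parallel>\<^esup> t\<^bsup>n-2\<^esup> f(tx/|x|) dt\<close>.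
  Division in \<^typ>\<open>ennreal\<close> makes the upper limit \<open>0\<close> if the Minkowski functional is infinite.\<close>

definition radial_integral ::
    "(real^'n \<Rightarrow> real) \<Rightarrow> (real^'n) set \<Rightarrow> real^'n \<Rightarrow> real" where
  "radial_integral f K x =
     norm x powi (1 - int CARD('n)) *
     (LINT t:{0..enn2real (ennreal (norm x) / minkowski_functional K x)}|lebesgue.
        t ^ (CARD('n) - 2) * f ((t / norm x) *\<^sub>R x))"

fun iterated_partial ::
    "'a::euclidean_space list \<Rightarrow> ('a \<Rightarrow> complex) \<Rightarrow> 'a \<Rightarrow> complex" where
  "iterated_partial [] \<phi> = \<phi>"
| "iterated_partial (b # bs) \<phi> = (\<lambda>x. frechet_derivative (iterated_partial bs \<phi>) (at x) b)"

definition schwartz :: "('a::euclidean_space \<Rightarrow> complex) \<Rightarrow> bool" where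
  "schwartz \<phi> \<longleftrightarrow>
     (\<forall>bs\<in>lists Basis.
        (\<forall>x. iterated_partial bs \<phi> differentiable (at x)) \<and>
        (\<forall>k. \<exists>C. \<forall>x. norm x ^ k * norm (iterated_partial bs \<phi> x) \<le> C))"

definition fourier :: "('a::euclidean_space \<Rightarrow> complex) \<Rightarrow> 'a \<Rightarrow> complex" where
  "fourier \<phi> \<xi> = (LINT x|lborel. \<phi> x * exp (- \<i> * of_real (x \<bullet> \<xi>)))"

text \<open>The tempered distribution given by the locally integrable function \<open>g\<close> has as its Fourier
  transform the distribution given by the locally integrable function \<open>h\<close>.\<close>

definition has_distributional_fourier ::
    "('a::euclidean_space \<Rightarrow> complex) \<Rightarrow> ('a \<Rightarrow> complex) \<Rightarrow> bool" where
  "has_distributional_fourier g h \<longleftrightarrow>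
     locally_integrable lebesgue g \<and> locally_integrable lebesgue h \<and>
     (\<forall>\<phi>. schwartz \<phi> \<longrightarrow>
        integrable lebesgue (\<lambda>x. g x * fourier \<phi> x) \<and>
        integrable lebesgue (\<lambda>x. h x * \<phi> x) \<and>
        (LINT x|lebesgue. h x * \<phi> x) = (LINT x|lebesgue. g x * fourier \<phi> x))"

definition homogeneous :: "int \<Rightarrow> ('a::euclidean_space \<Rightarrow> complex) \<Rightarrow> bool" where
  "homogeneous d h \<longleftrightarrow>
     (\<forall>c x. 0 < c \<longrightarrow> x \<noteq> 0 \<longrightarrow> h (c *\<^sub>R x) = of_real (c powi d) * h x)"

end

theory Submission
  imports Defs "HOL-Probability.Sinc_Integral" "HOL-Probability.Characteristic_Functions"
    "HOL-Real_Asymp.Real_Asymp"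
begin

text \<open>Let \<open>g\<close> be the radial integral, which is even and homogeneous of degree \<open>1 - n\<close>, and let \<open>v\<close> be a
  bump on \<open>[1, 2]\<close> with \<open>\<integral> v(r) / r dr = 1\<close>. By homogeneity the polar coordinate formula takes the
  form \<open>\<integral>\<^bsub>E\<^esub> \<Phi> = \<integral>\<^bsub>E\<^esub> v(|x|) \<integral>\<^sub>0\<^bsup>\<infinity>\<^esup> s\<^bsup>dim E - 1\<^esup> \<Phi>(s x) ds dx\<close> on every subspace \<open>E\<close>,
  which needs no measure on the sphere. On \<open>E = \<xi>\<^sup>\<bottom>\<close> it gives
  \<open>\<mu>(K \<inter> \<xi>\<^sup>\<bottom>) = \<integral>\<^bsub>\<xi>\<^sup>\<bottom>\<^esub> g(x) v(|x|) dx\<close>. On the whole space it gives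
  \<open>\<integral> g \<phi>\<^sup>^ = 1/2 \<integral> g(y) v(|y|) \<integral>\<^bsub>\<real>\<^esub> \<phi>\<^sup>^(s y) ds dy\<close>, and one-dimensional Fourier inversion identifies the
  inner integral with \<open>2\<pi> / |y| \<integral>\<^bsub>y\<^sup>\<bottom>\<^esub> \<phi>\<close>. The measure \<open>dx\<^bsub>y\<^sup>\<bottom>\<^esub> dy / |y|\<close> on the pairs with
  \<open>x \<bullet> y = 0\<close> is symmetric in \<open>x\<close> and \<open>y\<close>, so \<open>\<integral> g \<phi>\<^sup>^ = \<integral> \<phi>(x) \<pi> / |x| \<integral>\<^bsub>x\<^sup>\<bottom>\<^esub> g(y) v(|y|) dy dx\<close>.\<close>

section \<open>Lebesgue measure on hyperplanes\<close>

text \<open>The obstacle is that \<open>f\<close> is controlled only on single hyperplanes and only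
  up to completed measures, while the measure on a hyperplane comes from a chosen basis and does not
  visibly depend measurably on the normal. Integrals over the hyperplane orthogonal to
  \<open>\<xi>\<close> are therefore rewritten as slab integrals over the whole space: a point
  \<open>z\<close> is projected along \<open>\<xi>\<close> and weighted by a unit-mass
  \<open>bump\<close> of its height \<open>z \<bullet> \<xi>\<close>. The measure is then fixed and
  \<open>\<xi>\<close> occurs only in the integrand. The symmetry of the incidence measure has a
  second use: a null set of the space is null on almost every hyperplane, so a Borel version of
  \<open>g\<close> may replace \<open>g\<close> in almost every hyperplane integral. The cut-off
  \<open>v\<close> vanishes for radii below 1, which keeps \<open>y\<close> away from the
  singularity of \<open>1 / |y|\<close> at the origin. The factor 1/2 comes from evenness: the
  integral over a ray is averaged with that over the opposite ray. With the 2 pi of Fourier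
  inversion it leaves the pi that 1/pi cancels.\<close>

lemma nn_integral_lborel_translate:
  fixes c :: "'a::euclidean_space"
  assumes [measurable]: "f \<in> borel_measurable borel"
  shows "(\<integral>\<^sup>+x. f (x + c) \<partial>lborel) = (\<integral>\<^sup>+x. f x \<partial>lborel)"
proof -
  have "(\<integral>\<^sup>+x. f x \<partial>lborel) = (\<integral>\<^sup>+x. f x \<partial>distr lborel borel ((+) c))"
    by (simp add: lborel_distr_plus)
  also have "\<dots> = (\<integral>\<^sup>+x. f (x + c) \<partial>lborel)"
    by (subst nn_integral_distr) (simp_all add: add.commute)
  finally show ?thesis by simp
qed

text \<open>The Haar measure argument: both sides are translation invariant, hence proportional, and
  they agree on the unit ball.\<close>

lemma distr_lborel_orthogonal_transformation:
  fixes U :: "'a::euclidean_space \<Rightarrow> 'a"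
  assumes U: "orthogonal_transformation U"
  shows "distr lborel borel U = lborel"
proof (rule measure_eqI)
  have lin: "linear U" using U by (rule orthogonal_transformation_linear)
  then have [measurable]: "U \<in> borel_measurable borel"
    by (intro borel_measurable_continuous_onI linear_continuous_on linear_conv_bounded_linear[THEN iffD1])
  fix A assume "A \<in> sets (distr lborel borel U)"
  then have [measurable]: "A \<in> sets borel" by simp
  define f g where "f = (indicator (ball 0 1) :: 'a \<Rightarrow> ennreal)" and "g = (indicator A :: 'a \<Rightarrow> ennreal)"
  have [measurable]: "f \<in> borel_measurable borel" "g \<in> borel_measurable borel"
    unfolding f_def g_def by (auto intro!: borel_measurable_indicator)
  have inv: "(\<integral>\<^sup>+y. k (U y + x) \<partial>lborel) = (\<integral>\<^sup>+y. k (U y) \<partial>lborel)"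
    if [measurable]: "k \<in> borel_measurable borel" for k :: "'a \<Rightarrow> ennreal" and x
  proof -
    obtain z where "x = U z" using orthogonal_transformation_surj[OF U] by (metis surjD)
    then show ?thesis
      using nn_integral_lborel_translate[of "\<lambda>y. k (U y)" z] by (simp add: linear_add[OF lin])
  qed
  have f_neg: "f (- x) = f x" and fU: "f (U x) = f x" for x
    using U by (auto simp: f_def indicator_def orthogonal_transformation)
  have "(\<integral>\<^sup>+x. f x \<partial>lborel) * (\<integral>\<^sup>+y. g (U y) \<partial>lborel) = (\<integral>\<^sup>+x. f x * (\<integral>\<^sup>+y. g (U y) \<partial>lborel) \<partial>lborel)"
    by (simp add: nn_integral_multc)
  also have "\<dots> = (\<integral>\<^sup>+x. \<integral>\<^sup>+y. f x * g (U y + x) \<partial>lborel \<partial>lborel)"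
    by (simp add: nn_integral_cmult inv)
  also have "\<dots> = (\<integral>\<^sup>+y. \<integral>\<^sup>+x. f x * g (U y + x) \<partial>lborel \<partial>lborel)"
    by (rule lborel_pair.Fubini') measurable
  also have "\<dots> = (\<integral>\<^sup>+y. \<integral>\<^sup>+x. f (x - U y) * g x \<partial>lborel \<partial>lborel)"
  proof (rule nn_integral_cong)
    fix y
    show "(\<integral>\<^sup>+x. f x * g (U y + x) \<partial>lborel) = (\<integral>\<^sup>+x. f (x - U y) * g x \<partial>lborel)"
      using nn_integral_lborel_translate[of "\<lambda>x. f (x - U y) * g x" "U y"]
      by (simp add: add.commute)
  qed
  also have "\<dots> = (\<integral>\<^sup>+x. \<integral>\<^sup>+y. f (x - U y) * g x \<partial>lborel \<partial>lborel)"
    by (rule lborel_pair.Fubini') measurable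
  also have "\<dots> = (\<integral>\<^sup>+x. (\<integral>\<^sup>+y. f (U y - x) \<partial>lborel) * g x \<partial>lborel)"
  proof -
    have "f (x - U y) = f (U y - x)" for x y using f_neg[of "x - U y"] by simp
    then show ?thesis by (simp add: nn_integral_multc)
  qed
  also have "\<dots> = (\<integral>\<^sup>+x. f x \<partial>lborel) * (\<integral>\<^sup>+x. g x \<partial>lborel)"
  proof -
    have "(\<integral>\<^sup>+y. f (U y - x) \<partial>lborel) = (\<integral>\<^sup>+y. f y \<partial>lborel)" for x
      using inv[of f "- x"] by (simp add: fU)
    then show ?thesis by (simp add: nn_integral_cmult)
  qed
  finally have *: "(\<integral>\<^sup>+x. f x \<partial>lborel) * (\<integral>\<^sup>+y. g (U y) \<partial>lborel) = (\<integral>\<^sup>+x. f x \<partial>lborel) * (\<integral>\<^sup>+x. g x \<partial>lborel)" .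
  have "(\<integral>\<^sup>+x. f x \<partial>lborel) = emeasure lborel (ball (0::'a) 1)"
    by (simp add: f_def)
  moreover have "emeasure lborel (ball (0::'a) 1) \<noteq> 0"
    using content_ball_pos[of 1 "0::'a"] by (auto simp: measure_def)
  moreover have "emeasure lborel (ball (0::'a) 1) \<noteq> top"
    using emeasure_lborel_ball_finite[of "0::'a" 1] by simp
  ultimately have "(\<integral>\<^sup>+y. g (U y) \<partial>lborel) = (\<integral>\<^sup>+x. g x \<partial>lborel)"
    using * by (simp add: ennreal_mult_cancel_left)
  moreover have "(\<integral>\<^sup>+y. g (U y) \<partial>lborel) = (\<integral>\<^sup>+y. g y \<partial>distr lborel borel U)"
    by (simp add: nn_integral_distr)
  ultimately show "emeasure (distr lborel borel U) A = emeasure lborel A"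
    by (simp add: g_def)
qed simp

text \<open>On boxes both measures are products of the measures of the sides, and \<open>p\<close>
  only reindexes that product; boxes determine a finite product measure.\<close>

lemma distr_PiM_bij_betw:
  assumes p: "bij_betw p I J" and "finite I"
  shows "distr (\<Pi>\<^sub>M j\<in>J. (lborel :: real measure)) (\<Pi>\<^sub>M i\<in>I. lborel) (\<lambda>c. \<lambda>i\<in>I. c (p i)) = (\<Pi>\<^sub>M i\<in>I. lborel)"
proof -
  interpret product_sigma_finite "\<lambda>_. lborel :: real measure"
    by standard
  have J: "J = p ` I" and inj: "inj_on p I" using p by (auto simp: bij_betw_def)
  have fJ: "finite J" using J assms by simp
  have m[measurable]: "(\<lambda>c. \<lambda>i\<in>I. c (p i)) \<in> (\<Pi>\<^sub>M j\<in>J. (lborel :: real measure)) \<rightarrow>\<^sub>M (\<Pi>\<^sub>M i\<in>I. lborel)"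
    by (rule measurable_restrict) (auto simp: J intro!: measurable_component_singleton)
  show ?thesis
  proof (rule PiM_eqI)
    fix A :: "_ \<Rightarrow> real set" assume A: "\<And>i. i \<in> I \<Longrightarrow> A i \<in> sets lborel"
    define A' where "A' j = A (the_inv_into I p j)" for j
    have A'p: "A' (p i) = A i" if "i \<in> I" for i
      using that inj by (simp add: A'_def the_inv_into_f_f)
    have "(\<lambda>c. \<lambda>i\<in>I. c (p i)) -` (Pi\<^sub>E I A) \<inter> space (\<Pi>\<^sub>M j\<in>J. (lborel :: real measure)) = Pi\<^sub>E J A'"
      by (auto simp: space_PiM J A'p PiE_def Pi_def)
    then have "emeasure (distr (\<Pi>\<^sub>M j\<in>J. (lborel :: real measure)) (\<Pi>\<^sub>M i\<in>I. lborel) (\<lambda>c. \<lambda>i\<in>I. c (p i))) (Pi\<^sub>E I A)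
       = emeasure (\<Pi>\<^sub>M j\<in>J. (lborel :: real measure)) (Pi\<^sub>E J A')"
      using A \<open>finite I\<close> by (subst emeasure_distr) (auto intro!: sets_PiM_I_finite)
    also have "\<dots> = (\<Prod>j\<in>J. emeasure lborel (A' j))"
      using fJ A A'p by (intro emeasure_PiM) (auto simp: J)
    also have "\<dots> = (\<Prod>i\<in>I. emeasure lborel (A i))"
      by (simp add: J prod.reindex[OF inj] A'p)
    finally show "emeasure (distr (\<Pi>\<^sub>M j\<in>J. (lborel :: real measure)) (\<Pi>\<^sub>M i\<in>I. lborel) (\<lambda>c. \<lambda>i\<in>I. c (p i))) (Pi\<^sub>E I A)
       = (\<Prod>i\<in>I. emeasure lborel (A i))" .
  qed (use assms in auto)
qed

lemma orthonormal_basis_of_inner: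
  assumes "orthonormal_basis_of B S" "x \<in> B" "y \<in> B"
  shows "x \<bullet> y = (if x = y then 1 else 0)"
  using assms by (auto simp: orthonormal_basis_of_def pairwise_def orthogonal_def norm_eq_1)

lemma orthonormal_basis_of_independent:
  assumes "orthonormal_basis_of B S"
  shows "independent B"
  using assms by (intro pairwise_orthogonal_independent) (auto simp: orthonormal_basis_of_def)

lemma orthonormal_basis_of_finite:
  assumes "orthonormal_basis_of B S"
  shows "finite B"
  using orthonormal_basis_of_independent[OF assms] by (rule independent_imp_finite)

text \<open>The linear map that carries the standard basis to \<open>C\<close> is an isometry, hence
  preserves \<open>lborel\<close>, and \<open>lborel\<close> is itself built as the image of the
  product measure over \<open>Basis\<close>.\<close>

lemma distr_orthonormal_basis_of_UNIV:
  assumes C: "orthonormal_basis_of C (UNIV :: 'a::euclidean_space set)"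
  shows "distr (\<Pi>\<^sub>M b\<in>C. (lborel :: real measure)) borel (\<lambda>c. \<Sum>b\<in>C. c b *\<^sub>R b) = lborel"
proof -
  have finC: "finite C" using C by (rule orthonormal_basis_of_finite)
  have "card C = dim (UNIV :: 'a set)"
    using orthonormal_basis_of_independent[OF C] C
    by (metis dim_span_eq_card_independent orthonormal_basis_of_def)
  then have "card (Basis :: 'a set) = card C" by simp
  then obtain p where p: "bij_betw p (Basis :: 'a set) C"
    using finC finite_Basis by (metis finite_same_card_bij)
  define U where "U x = (\<Sum>b\<in>Basis. (x \<bullet> b) *\<^sub>R p b)" for x :: 'a
  have linU: "linear U"
    by (auto simp: U_def linear_iff inner_add_left scaleR_add_left sum.distrib scaleR_sum_right)
  have "U x \<bullet> U y = x \<bullet> y" for x y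
  proof -
    have pb: "p b \<bullet> p b' = (if b = b' then 1 else 0)" if "b \<in> Basis" "b' \<in> Basis" for b b'
      using orthonormal_basis_of_inner[OF C, of "p b" "p b'"] p that
      by (auto simp: bij_betw_def inj_on_def)
    have "U x \<bullet> U y = (\<Sum>b\<in>Basis. \<Sum>b'\<in>Basis. (x \<bullet> b) * (y \<bullet> b') * (p b \<bullet> p b'))"
      by (simp add: U_def inner_sum_left inner_sum_right sum_distrib_left mult_ac, subst sum.swap, rule refl)
    also have "\<dots> = (\<Sum>b\<in>Basis. (x \<bullet> b) * (y \<bullet> b))"
      by (intro sum.cong refl) (simp add: pb if_distrib cong: if_cong)
    finally show ?thesis by (simp add: euclidean_inner[of x y])
  qed
  then have U: "orthogonal_transformation U"
    using linU by (simp add: orthogonal_transformation_def)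
  have [measurable]: "U \<in> borel_measurable borel"
    unfolding U_def by measurable
  have [measurable]: "(\<lambda>c. \<lambda>i\<in>Basis. c (p i)) \<in> (\<Pi>\<^sub>M j\<in>C. (lborel :: real measure)) \<rightarrow>\<^sub>M (\<Pi>\<^sub>M i\<in>Basis. lborel)"
    using p by (intro measurable_restrict) (auto simp: bij_betw_def intro!: measurable_component_singleton)
  have "lborel = distr (lborel :: 'a measure) borel U"
    using distr_lborel_orthogonal_transformation[OF U] by simp
  also have "\<dots> = distr (distr (\<Pi>\<^sub>M b\<in>Basis. (lborel :: real measure)) borel (\<lambda>f. \<Sum>b\<in>Basis. f b *\<^sub>R b)) borel U"
    by (subst lborel_eq) simp
  also have "\<dots> = distr (\<Pi>\<^sub>M b\<in>Basis. (lborel :: real measure)) borel (\<lambda>f. \<Sum>b\<in>Basis. f b *\<^sub>R p b)"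
    by (subst distr_distr) (auto simp: o_def U_def intro!: distr_cong)
  also have "\<dots> = distr (\<Pi>\<^sub>M b\<in>C. (lborel :: real measure)) borel (\<lambda>c. \<Sum>b\<in>Basis. c (p b) *\<^sub>R p b)"
    by (subst distr_PiM_bij_betw[OF p finite_Basis, symmetric], subst distr_distr)
       (auto simp: o_def intro!: distr_cong)
  also have "(\<lambda>c. \<Sum>b\<in>Basis. c (p b) *\<^sub>R p b) = (\<lambda>c. \<Sum>b\<in>C. c b *\<^sub>R b)"
    by (rule ext) (rule sum.reindex_bij_betw[OF p])
  finally show ?thesis by simp
qed

abbreviation hyp_lborel :: "'a::euclidean_space \<Rightarrow> 'a measure" where
  "hyp_lborel \<xi> \<equiv> subspace_lborel ({\<xi>}\<^sup>\<bottom>)"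

lemma mem_orthogonal_comp_singleton: "x \<in> {\<xi>}\<^sup>\<bottom> \<longleftrightarrow> x \<bullet> \<xi> = 0"
  by (simp add: orthogonal_comp_def orthogonal_def inner_commute)

lemma orthogonal_comp_singleton_scaleR:
  "c \<noteq> 0 \<Longrightarrow> {c *\<^sub>R \<xi>}\<^sup>\<bottom> = {\<xi>}\<^sup>\<bottom>"
  by (auto simp: mem_orthogonal_comp_singleton)

lemma subspace_lborel_basis:
  fixes S :: "'a::euclidean_space set"
  assumes "subspace S"
  obtains B where "orthonormal_basis_of B S"
    "subspace_lborel S = distr (\<Pi>\<^sub>M b\<in>B. (lborel :: real measure)) borel (\<lambda>c. \<Sum>b\<in>B. c b *\<^sub>R b)"
proof -
  obtain B where "orthonormal_basis_of B S"
    using orthonormal_basis_subspace[OF assms] unfolding orthonormal_basis_of_def by metis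
  then have "orthonormal_basis_of (SOME B. orthonormal_basis_of B S) S" by (rule someI)
  then show ?thesis by (rule that) (simp only: subspace_lborel_def Let_def)
qed

lemma sets_subspace_lborel [simp, measurable_cong]: "sets (subspace_lborel S) = sets borel"
  by (simp add: subspace_lborel_def Let_def)

lemma space_subspace_lborel [simp]: "space (subspace_lborel S) = UNIV"
  by (simp add: subspace_lborel_def Let_def)

lemma borel_measurable_subspace_lborel [simp]:
  "borel_measurable (subspace_lborel S) = borel_measurable borel"
  by (rule measurable_cong_sets) simp_all

lemma measurable_orthonormal_sum [measurable]:
  fixes B :: "'a::euclidean_space set"
  shows "(\<lambda>c. \<Sum>b\<in>B. c b *\<^sub>R b) \<in> borel_measurable (\<Pi>\<^sub>M b\<in>B. (lborel :: real measure))"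
  by measurable

lemma sigma_finite_subspace_lborel:
  fixes S :: "'a::euclidean_space set"
  assumes "subspace S"
  shows "sigma_finite_measure (subspace_lborel S)"
proof -
  obtain B where B: "orthonormal_basis_of B S"
    and eq: "subspace_lborel S = distr (\<Pi>\<^sub>M b\<in>B. (lborel :: real measure)) borel (\<lambda>c. \<Sum>b\<in>B. c b *\<^sub>R b)"
    using subspace_lborel_basis[OF assms] .
  have finB: "finite B" using B by (rule orthonormal_basis_of_finite)
  interpret product_sigma_finite "\<lambda>_. lborel :: real measure" by standard
  have fin: "emeasure (subspace_lborel S) (ball 0 (real k)) \<noteq> \<infinity>" for k
  proof -
    let ?P = "\<Pi>\<^sub>M b\<in>B. (lborel :: real measure)"
    \<comment> \<open>Each coordinate with respect to an orthonormal basis is bounded by the norm,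
      so the preimage of a ball lies in a box of finite measure.\<close>
    have sub: "(\<lambda>c. \<Sum>b\<in>B. c b *\<^sub>R b) -` ball 0 (real k) \<inter> space ?P \<subseteq> (\<Pi>\<^sub>E b\<in>B. {- real k..real k})"
    proof
      fix c assume c: "c \<in> (\<lambda>c. \<Sum>b\<in>B. c b *\<^sub>R b) -` ball 0 (real k) \<inter> space ?P"
      have "\<bar>c b\<bar> \<le> real k" if "b \<in> B" for b
      proof -
        have "(\<Sum>b\<in>B. c b *\<^sub>R b) \<bullet> b = (\<Sum>b'\<in>B. c b' * (b' \<bullet> b))"
          by (simp add: inner_sum_left)
        also have "\<dots> = (\<Sum>b'\<in>B. if b' = b then c b' else 0)"
          using that by (intro sum.cong refl) (simp add: orthonormal_basis_of_inner[OF B])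
        also have "\<dots> = c b" using that finB by simp
        finally have "\<bar>c b\<bar> \<le> norm (\<Sum>b\<in>B. c b *\<^sub>R b) * norm b"
          by (metis Cauchy_Schwarz_ineq2)
        also have "norm b = 1" using that B by (simp add: orthonormal_basis_of_def)
        finally show ?thesis using c by simp
      qed
      then show "c \<in> (\<Pi>\<^sub>E b\<in>B. {- real k..real k})"
        using c by (auto simp: space_PiM PiE_def Pi_def abs_le_iff) (smt (verit))
    qed
    have "emeasure (subspace_lborel S) (ball 0 (real k)) \<le> emeasure ?P (\<Pi>\<^sub>E b\<in>B. {- real k..real k})"
      unfolding eq using finB sub by (subst emeasure_distr) (auto intro!: emeasure_mono sets_PiM_I_finite)
    also have "\<dots> = (\<Prod>b\<in>B. emeasure lborel {- real k..real k})"
      using finB by (intro emeasure_PiM) auto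
    also have "\<dots> < \<infinity>"
      by (simp add: prod_constant power_less_top_ennreal ennreal_mult_less_top)
    finally show ?thesis by simp
  qed
  have "(\<Union>i. ball (0::'a) (real i)) = UNIV"
    using reals_Archimedean2 by auto
  then show ?thesis
    by (intro sigma_finite_measure.intro exI[of _ "range (\<lambda>k. ball 0 (real k))"]) (use fin in auto)
qed

lemma sigma_finite_hyp_lborel: "sigma_finite_measure (hyp_lborel \<xi>)"
  by (rule sigma_finite_subspace_lborel) (rule subspace_orthogonal_comp)

lemma AE_hyp_lborel: "AE x in hyp_lborel \<xi>. x \<bullet> \<xi> = 0"
proof -
  obtain B where B: "orthonormal_basis_of B ({\<xi>}\<^sup>\<bottom>)"
    and eq: "hyp_lborel \<xi> = distr (\<Pi>\<^sub>M b\<in>B. (lborel :: real measure)) borel (\<lambda>c. \<Sum>b\<in>B. c b *\<^sub>R b)"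
    using subspace_lborel_basis[OF subspace_orthogonal_comp] .
  have "b \<bullet> \<xi> = 0" if "b \<in> B" for b
    using B that span_base[of b B] by (auto simp: orthonormal_basis_of_def mem_orthogonal_comp_singleton)
  then show ?thesis unfolding eq
    by (subst AE_distr_iff) (auto simp: inner_sum_left)
qed

text \<open>Adjoining \<open>\<xi>\<close> to an orthonormal basis of its orthogonal complement
  gives one of the whole space; the rest is Fubini in the added coordinate.\<close>

lemma nn_integral_lborel_slices:
  fixes \<xi> :: "'a::euclidean_space"
  assumes \<xi>: "norm \<xi> = 1" and [measurable]: "\<Phi> \<in> borel_measurable borel"
  shows "(\<integral>\<^sup>+x. \<Phi> x \<partial>lborel) = (\<integral>\<^sup>+y. \<integral>\<^sup>+t. \<Phi> (y + t *\<^sub>R \<xi>) \<partial>lborel \<partial>hyp_lborel \<xi>)"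
proof -
  obtain B where B: "orthonormal_basis_of B ({\<xi>}\<^sup>\<bottom>)"
    and eq: "hyp_lborel \<xi> = distr (\<Pi>\<^sub>M b\<in>B. (lborel :: real measure)) borel (\<lambda>c. \<Sum>b\<in>B. c b *\<^sub>R b)"
    using subspace_lborel_basis[OF subspace_orthogonal_comp] .
  have finB: "finite B" using B by (rule orthonormal_basis_of_finite)
  interpret product_sigma_finite "\<lambda>_. lborel :: real measure" by standard
  have orth: "b \<bullet> \<xi> = 0" if "b \<in> B" for b
    using B that span_base[of b B] by (auto simp: orthonormal_basis_of_def mem_orthogonal_comp_singleton)
  then have \<xi>B: "\<xi> \<notin> B" using \<xi> by (auto simp: norm_eq_1)
  have "x \<in> span (insert \<xi> B)" for x
    unfolding span_insert using \<xi> B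
    by (auto simp: orthonormal_basis_of_def mem_orthogonal_comp_singleton norm_eq_1 inner_diff_left
        intro!: exI[of _ "x \<bullet> \<xi>"])
  then have C: "orthonormal_basis_of (insert \<xi> B) UNIV"
    using B \<xi> orth by (auto simp: orthonormal_basis_of_def pairwise_insert orthogonal_def inner_commute)
  have "(\<integral>\<^sup>+x. \<Phi> x \<partial>lborel) = (\<integral>\<^sup>+c. \<Phi> (\<Sum>b\<in>insert \<xi> B. c b *\<^sub>R b) \<partial>(\<Pi>\<^sub>M b\<in>insert \<xi> B. (lborel :: real measure)))"
    by (subst distr_orthonormal_basis_of_UNIV[OF C, symmetric], subst nn_integral_distr) measurable
  also have "\<dots> = (\<integral>\<^sup>+c. \<integral>\<^sup>+t. \<Phi> (\<Sum>b\<in>insert \<xi> B. (c(\<xi> := t)) b *\<^sub>R b) \<partial>lborel \<partial>(\<Pi>\<^sub>M b\<in>B. (lborel :: real measure)))"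
    by (rule product_nn_integral_insert[OF finB \<xi>B]) measurable
  also have "\<dots> = (\<integral>\<^sup>+c. \<integral>\<^sup>+t. \<Phi> ((\<Sum>b\<in>B. c b *\<^sub>R b) + t *\<^sub>R \<xi>) \<partial>lborel \<partial>(\<Pi>\<^sub>M b\<in>B. (lborel :: real measure)))"
  proof -
    have "(\<Sum>b\<in>B. (if b = \<xi> then t else c b) *\<^sub>R b) = (\<Sum>b\<in>B. c b *\<^sub>R b)" for c t
      using \<xi>B by (intro sum.cong) auto
    then show ?thesis using finB \<xi>B by (simp add: add.commute)
  qed
  also have "\<dots> = (\<integral>\<^sup>+y. \<integral>\<^sup>+t. \<Phi> (y + t *\<^sub>R \<xi>) \<partial>lborel \<partial>hyp_lborel \<xi>)"
    unfolding eq by (subst nn_integral_distr) auto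
  finally show ?thesis .
qed

lemma measurable_nn_integral_hyp [measurable (raw)]:
  assumes [measurable]: "case_prod f \<in> borel_measurable (N \<Otimes>\<^sub>M borel)"
  shows "(\<lambda>x. \<integral>\<^sup>+y. f x y \<partial>hyp_lborel \<xi>) \<in> borel_measurable N"
proof -
  interpret sigma_finite_measure "hyp_lborel \<xi>" by (rule sigma_finite_hyp_lborel)
  show ?thesis by (rule borel_measurable_nn_integral) measurable
qed

section \<open>Hyperplane integrals as slab integrals over the whole space\<close>

lemma nn_integral_hyp_slab:
  fixes \<xi> :: "'a::euclidean_space"
  assumes \<xi>: "norm \<xi> = 1" and [measurable]: "\<Phi> \<in> borel_measurable borel" "\<psi> \<in> borel_measurable borel"
  shows "(\<integral>\<^sup>+z. \<Phi> (z - (z \<bullet> \<xi>) *\<^sub>R \<xi>) * \<psi> (z \<bullet> \<xi>) \<partial>lborel) =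
    (\<integral>\<^sup>+y. \<Phi> y \<partial>hyp_lborel \<xi>) * (\<integral>\<^sup>+t. \<psi> t \<partial>lborel)"
proof -
  have "(\<integral>\<^sup>+z. \<Phi> (z - (z \<bullet> \<xi>) *\<^sub>R \<xi>) * \<psi> (z \<bullet> \<xi>) \<partial>lborel) =
    (\<integral>\<^sup>+y. \<integral>\<^sup>+t. \<Phi> (y + t *\<^sub>R \<xi> - ((y + t *\<^sub>R \<xi>) \<bullet> \<xi>) *\<^sub>R \<xi>) * \<psi> ((y + t *\<^sub>R \<xi>) \<bullet> \<xi>) \<partial>lborel \<partial>hyp_lborel \<xi>)"
    by (rule nn_integral_lborel_slices[OF \<xi>]) measurable
  also have "\<dots> = (\<integral>\<^sup>+y. \<integral>\<^sup>+t. \<Phi> y * \<psi> t \<partial>lborel \<partial>hyp_lborel \<xi>)"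
    using AE_hyp_lborel[of \<xi>] \<xi>
    by (intro nn_integral_cong_AE) (auto simp: inner_add_left norm_eq_1)
  also have "\<dots> = (\<integral>\<^sup>+y. \<Phi> y \<partial>hyp_lborel \<xi>) * (\<integral>\<^sup>+t. \<psi> t \<partial>lborel)"
    by (simp add: nn_integral_cmult nn_integral_multc)
  finally show ?thesis .
qed

text \<open>The factor 6 normalises the mass, as \<open>t * (1 - t)\<close> has integral 1/6 over
  the unit interval.\<close>

definition bump :: "real \<Rightarrow> real" where
  "bump t = 6 * max 0 (t * (1 - t))"

lemma bump_nonneg [simp]: "0 \<le> bump t"
  by (simp add: bump_def)

lemma bump_le: "bump t \<le> 2"
proof -
  have "0 \<le> (t - 1/2)\<^sup>2" by simp
  then have "t * (1 - t) \<le> 1/4" by (simp add: power2_eq_square algebra_simps)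
  then show ?thesis by (simp add: bump_def)
qed

lemma bump_eq_0: "t \<le> 0 \<or> 1 \<le> t \<Longrightarrow> bump t = 0"
  by (auto simp: bump_def max_def mult_le_0_iff zero_le_mult_iff intro: antisym)

lemma continuous_on_bump [continuous_intros]:
  "continuous_on S f \<Longrightarrow> continuous_on S (\<lambda>x. bump (f x))"
  unfolding bump_def by (intro continuous_intros)

lemma borel_measurable_bump [measurable]: "bump \<in> borel_measurable borel"
  unfolding bump_def by measurable

lemma nn_integral_bump: "(\<integral>\<^sup>+t. ennreal (bump t) \<partial>lborel) = 1"
proof -
  have "(\<integral>\<^sup>+t. ennreal (bump t) \<partial>lborel) = (\<integral>\<^sup>+t. ennreal (6 * (t * (1 - t))) * indicator {0..1} t \<partial>lborel)"
    using bump_eq_0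
    by (intro nn_integral_cong) (auto simp: bump_def indicator_def max_def zero_le_mult_iff)
  also have "\<dots> = ennreal ((3 * 1\<^sup>2 - 2 * 1 ^ 3) - (3 * 0\<^sup>2 - 2 * 0 ^ 3))"
    by (rule nn_integral_FTC_Icc[where F="\<lambda>t. 3 * t\<^sup>2 - 2 * t ^ 3"])
       (auto intro!: derivative_eq_intros simp: algebra_simps power2_eq_square power3_eq_cube
         mult_left_le_one_le)
  finally show ?thesis by simp
qed

text \<open>This is the slab formula for a profile of mass one. Measurability and continuity in the
  normal are later derived from this form.\<close>

lemma nn_integral_hyp_bump:
  fixes \<xi> :: "'a::euclidean_space"
  assumes \<xi>: "norm \<xi> = 1" and [measurable]: "\<Phi> \<in> borel_measurable borel"
  shows "(\<integral>\<^sup>+y. \<Phi> y \<partial>hyp_lborel \<xi>) =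
    (\<integral>\<^sup>+z. \<Phi> (z - (z \<bullet> \<xi>) *\<^sub>R \<xi>) * ennreal (bump (z \<bullet> \<xi>)) \<partial>lborel)"
  by (subst nn_integral_hyp_slab[OF \<xi>]) (simp_all add: nn_integral_bump)

text \<open>A shift by a vector orthogonal to \<open>\<xi>\<close> leaves the height
  \<open>z \<bullet> \<xi>\<close> unchanged and shifts the projection by the same vector, so the
  translation invariance of \<open>lborel\<close> descends to the hyperplane.\<close>

lemma nn_integral_hyp_translate:
  fixes \<xi> :: "'a::euclidean_space"
  assumes \<xi>: "norm \<xi> = 1" and w: "w \<bullet> \<xi> = 0" and [measurable]: "\<Phi> \<in> borel_measurable borel"
  shows "(\<integral>\<^sup>+y. \<Phi> (y + w) \<partial>hyp_lborel \<xi>) = (\<integral>\<^sup>+y. \<Phi> y \<partial>hyp_lborel \<xi>)"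
  using nn_integral_lborel_translate[of "\<lambda>z. \<Phi> (z - (z \<bullet> \<xi>) *\<^sub>R \<xi>) * ennreal (bump (z \<bullet> \<xi>))" w] w
  by (simp add: nn_integral_hyp_bump[OF \<xi>] inner_add_left algebra_simps)

lemma nn_integral_lborel_scale:
  fixes \<Phi> :: "'a::euclidean_space \<Rightarrow> ennreal"
  assumes s: "s > 0" and [measurable]: "\<Phi> \<in> borel_measurable borel"
  shows "ennreal (s ^ DIM('a)) * (\<integral>\<^sup>+x. \<Phi> (s *\<^sub>R x) \<partial>lborel) = (\<integral>\<^sup>+x. \<Phi> x \<partial>lborel)"
proof -
  have "(\<integral>\<^sup>+x. \<Phi> x \<partial>lborel) =
     (\<integral>\<^sup>+x. \<Phi> x \<partial>density (distr lborel borel (\<lambda>x. 0 + s *\<^sub>R x)) (\<lambda>_. \<bar>s\<bar> ^ DIM('a)))"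
    using lborel_affine[of s "0::'a"] s by simp
  also have "\<dots> = ennreal (s ^ DIM('a)) * (\<integral>\<^sup>+x. \<Phi> (s *\<^sub>R x) \<partial>lborel)"
    using s by (simp add: nn_integral_density nn_integral_distr nn_integral_cmult)
  finally show ?thesis by simp
qed

lemma nn_integral_hyp_scale:
  fixes \<xi> :: "'a::euclidean_space"
  assumes \<xi>: "norm \<xi> = 1" and s: "s > 0" and [measurable]: "\<Phi> \<in> borel_measurable borel"
  shows "ennreal (s ^ (DIM('a) - 1)) * (\<integral>\<^sup>+y. \<Phi> (s *\<^sub>R y) \<partial>hyp_lborel \<xi>) = (\<integral>\<^sup>+y. \<Phi> y \<partial>hyp_lborel \<xi>)"
proof -
  \<comment> \<open>One extra factor \<open>s\<close> completes the power to the ambient dimension.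
    Dilating the slab stretches the bump to mass \<open>s\<close>, and the factor cancels at the
    end.\<close>
  have "ennreal s * (ennreal (s ^ (DIM('a) - 1)) * (\<integral>\<^sup>+y. \<Phi> (s *\<^sub>R y) \<partial>hyp_lborel \<xi>)) =
      ennreal (s ^ DIM('a)) * (\<integral>\<^sup>+y. \<Phi> (s *\<^sub>R y) \<partial>hyp_lborel \<xi>)"
    using s by (simp add: mult.assoc[symmetric] ennreal_mult[symmetric] flip: power_Suc)
  also have "\<dots> = ennreal (s ^ DIM('a)) *
      (\<integral>\<^sup>+z. \<Phi> (s *\<^sub>R z - (s *\<^sub>R z \<bullet> \<xi>) *\<^sub>R \<xi>) * ennreal (bump ((s *\<^sub>R z \<bullet> \<xi>) / s)) \<partial>lborel)"
    using s by (simp add: nn_integral_hyp_bump[OF \<xi>] algebra_simps)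
  also have "\<dots> = (\<integral>\<^sup>+z. \<Phi> (z - (z \<bullet> \<xi>) *\<^sub>R \<xi>) * ennreal (bump ((z \<bullet> \<xi>) / s)) \<partial>lborel)"
    by (rule nn_integral_lborel_scale[OF s, where \<Phi>="\<lambda>z. \<Phi> (z - (z \<bullet> \<xi>) *\<^sub>R \<xi>) * ennreal (bump ((z \<bullet> \<xi>) / s))"])
       measurable
  also have "\<dots> = (\<integral>\<^sup>+y. \<Phi> y \<partial>hyp_lborel \<xi>) * (\<integral>\<^sup>+t. ennreal (bump (t / s)) \<partial>lborel)"
    by (rule nn_integral_hyp_slab[OF \<xi>, where \<psi>="\<lambda>t. ennreal (bump (t / s))"]) measurable
  also have "(\<integral>\<^sup>+t. ennreal (bump (t / s)) \<partial>lborel) = ennreal s"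
    using s by (subst nn_integral_real_affine[where c=s and t=0]) (simp_all add: nn_integral_bump)
  finally show ?thesis
    using s by (simp add: mult.commute[of _ "ennreal s"] ennreal_mult_cancel_left)
qed

lemma hyp_lborel_scaleR: "c \<noteq> 0 \<Longrightarrow> hyp_lborel (c *\<^sub>R \<xi>) = hyp_lborel \<xi>"
  by (simp add: orthogonal_comp_singleton_scaleR)

lemma hyp_lborel_sgn: "hyp_lborel (sgn y) = hyp_lborel y"
  by (cases "y = 0") (simp_all add: sgn_div_norm hyp_lborel_scaleR)

text \<open>Both sides are evaluated on the slab between two translates of the hyperplane: the oblique
  projection along \<open>e\<close> differs from the orthogonal one by a translation in the hyperplane.\<close>

lemma nn_integral_hyp_graph_unit:
  fixes \<xi> e :: "'a::euclidean_space"
  assumes \<xi>: "norm \<xi> = 1" and e: "norm e = 1" and \<xi>e: "\<xi> \<bullet> e \<noteq> 0"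
    and [measurable]: "\<Phi> \<in> borel_measurable borel"
  shows "ennreal \<bar>\<xi> \<bullet> e\<bar> * (\<integral>\<^sup>+y. \<Phi> y \<partial>hyp_lborel \<xi>) =
    (\<integral>\<^sup>+x. \<Phi> (x - ((x \<bullet> \<xi>) / (\<xi> \<bullet> e)) *\<^sub>R e) \<partial>hyp_lborel e)"
proof -
  define Q where "Q x = x - ((x \<bullet> \<xi>) / (\<xi> \<bullet> e)) *\<^sub>R e" for x
  have [measurable]: "Q \<in> borel_measurable borel" unfolding Q_def by measurable
  interpret X: sigma_finite_measure "hyp_lborel \<xi>" by (rule sigma_finite_hyp_lborel)
  interpret X: pair_sigma_finite "hyp_lborel \<xi>" "lborel :: real measure" ..
  have "(\<integral>\<^sup>+x. \<Phi> (Q x) * ennreal (bump (x \<bullet> \<xi>)) \<partial>lborel) =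
    (\<integral>\<^sup>+y. \<integral>\<^sup>+t. \<Phi> (Q (y + t *\<^sub>R \<xi>)) * ennreal (bump ((y + t *\<^sub>R \<xi>) \<bullet> \<xi>)) \<partial>lborel \<partial>hyp_lborel \<xi>)"
    by (rule nn_integral_lborel_slices[OF \<xi>]) measurable
  also have "\<dots> = (\<integral>\<^sup>+y. \<integral>\<^sup>+t. \<Phi> (y + t *\<^sub>R (\<xi> - e /\<^sub>R (\<xi> \<bullet> e))) * ennreal (bump t) \<partial>lborel \<partial>hyp_lborel \<xi>)"
    using AE_hyp_lborel[of \<xi>] \<xi>
    by (intro nn_integral_cong_AE)
       (auto simp: Q_def inner_add_left norm_eq_1 algebra_simps divide_inverse)
  also have "\<dots> = (\<integral>\<^sup>+t. \<integral>\<^sup>+y. \<Phi> (y + t *\<^sub>R (\<xi> - e /\<^sub>R (\<xi> \<bullet> e))) * ennreal (bump t) \<partial>hyp_lborel \<xi> \<partial>lborel)"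
    by (rule X.Fubini'[symmetric]) measurable
  also have "\<dots> = (\<integral>\<^sup>+t. (\<integral>\<^sup>+y. \<Phi> y \<partial>hyp_lborel \<xi>) * ennreal (bump t) \<partial>lborel)"
  proof -
    have "(\<integral>\<^sup>+y. \<Phi> (y + t *\<^sub>R (\<xi> - e /\<^sub>R (\<xi> \<bullet> e))) \<partial>hyp_lborel \<xi>) = (\<integral>\<^sup>+y. \<Phi> y \<partial>hyp_lborel \<xi>)" for t
      using \<xi> \<xi>e by (intro nn_integral_hyp_translate[OF \<xi>]) (auto simp: inner_diff_left norm_eq_1 inner_commute[of e])
    then show ?thesis by (simp add: nn_integral_multc)
  qed
  also have "\<dots> = (\<integral>\<^sup>+y. \<Phi> y \<partial>hyp_lborel \<xi>)"
    by (simp add: nn_integral_cmult nn_integral_bump)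
  finally have 1: "(\<integral>\<^sup>+x. \<Phi> (Q x) * ennreal (bump (x \<bullet> \<xi>)) \<partial>lborel) = (\<integral>\<^sup>+y. \<Phi> y \<partial>hyp_lborel \<xi>)" .
  have "(\<integral>\<^sup>+x. \<Phi> (Q x) * ennreal (bump (x \<bullet> \<xi>)) \<partial>lborel) =
    (\<integral>\<^sup>+x. \<integral>\<^sup>+s. \<Phi> (Q (x + s *\<^sub>R e)) * ennreal (bump ((x + s *\<^sub>R e) \<bullet> \<xi>)) \<partial>lborel \<partial>hyp_lborel e)"
    by (rule nn_integral_lborel_slices[OF e]) measurable
  also have "\<dots> = (\<integral>\<^sup>+x. \<integral>\<^sup>+s. \<Phi> (Q x) * ennreal (bump (x \<bullet> \<xi> + (\<xi> \<bullet> e) * s)) \<partial>lborel \<partial>hyp_lborel e)"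
    using \<xi>e by (simp add: Q_def inner_add_left inner_commute algebra_simps add_divide_distrib)
  also have "\<dots> = (\<integral>\<^sup>+x. \<Phi> (Q x) * (\<integral>\<^sup>+s. ennreal (bump (x \<bullet> \<xi> + (\<xi> \<bullet> e) * s)) \<partial>lborel) \<partial>hyp_lborel e)"
    by (simp add: nn_integral_cmult)
  finally have 2: "(\<integral>\<^sup>+x. \<Phi> (Q x) * ennreal (bump (x \<bullet> \<xi>)) \<partial>lborel) = \<dots>" .
  have 3: "ennreal \<bar>\<xi> \<bullet> e\<bar> * (\<integral>\<^sup>+s. ennreal (bump (a + (\<xi> \<bullet> e) * s)) \<partial>lborel) = 1" for a
    using nn_integral_real_affine[of "\<lambda>t. ennreal (bump t)" "\<xi> \<bullet> e" a] \<xi>e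
    by (simp add: nn_integral_bump)
  have "ennreal \<bar>\<xi> \<bullet> e\<bar> * (\<integral>\<^sup>+y. \<Phi> y \<partial>hyp_lborel \<xi>) =
    (\<integral>\<^sup>+x. \<Phi> (Q x) * (ennreal \<bar>\<xi> \<bullet> e\<bar> * (\<integral>\<^sup>+s. ennreal (bump (x \<bullet> \<xi> + (\<xi> \<bullet> e) * s)) \<partial>lborel)) \<partial>hyp_lborel e)"
    unfolding 1[symmetric] 2 by (subst nn_integral_cmult[symmetric]) (simp_all add: mult_ac)
  then show ?thesis by (simp add: 3 Q_def)
qed

text \<open>As a graph over the hyperplane orthogonal to \<open>e\<close>, the hyperplane orthogonal
  to \<open>y\<close> has area factor \<open>norm y / \<bar>y \<bullet> e\<bar>\<close>. The weight
  \<open>1 / norm y\<close> cancels the norm and leaves a density that depends on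
  \<open>y \<bullet> e\<close> alone.\<close>

lemma nn_integral_hyp_graph:
  fixes y e :: "'a::euclidean_space"
  assumes e: "norm e = 1" and ye: "y \<bullet> e \<noteq> 0" and [measurable]: "\<Phi> \<in> borel_measurable borel"
  shows "ennreal (1 / norm y) * (\<integral>\<^sup>+x. \<Phi> x \<partial>hyp_lborel y) =
    ennreal (1 / \<bar>y \<bullet> e\<bar>) * (\<integral>\<^sup>+x. \<Phi> (x - ((x \<bullet> y) / (y \<bullet> e)) *\<^sub>R e) \<partial>hyp_lborel e)"
proof -
  have y: "y \<noteq> 0" using ye by auto
  have "ennreal \<bar>sgn y \<bullet> e\<bar> * (\<integral>\<^sup>+x. \<Phi> x \<partial>hyp_lborel (sgn y)) =
    (\<integral>\<^sup>+x. \<Phi> (x - ((x \<bullet> sgn y) / (sgn y \<bullet> e)) *\<^sub>R e) \<partial>hyp_lborel e)"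
    using y ye by (intro nn_integral_hyp_graph_unit) (auto simp: e norm_sgn sgn_div_norm)
  then have *: "ennreal (\<bar>y \<bullet> e\<bar> / norm y) * (\<integral>\<^sup>+x. \<Phi> x \<partial>hyp_lborel y) =
    (\<integral>\<^sup>+x. \<Phi> (x - ((x \<bullet> y) / (y \<bullet> e)) *\<^sub>R e) \<partial>hyp_lborel e)"
    using y by (simp add: hyp_lborel_sgn) (simp add: sgn_div_norm abs_mult field_simps)
  show ?thesis
    unfolding *[symmetric] mult.assoc[symmetric] using ye y by (simp add: ennreal_mult[symmetric])
qed

section \<open>The multiplicative Haar measure dt/|t| on the nonzero reals\<close>

lemma haar_scale:
  fixes f :: "real \<Rightarrow> ennreal"
  assumes a: "a \<noteq> 0" and [measurable]: "f \<in> borel_measurable borel"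
  shows "(\<integral>\<^sup>+t. f (a * t) * ennreal (1 / \<bar>t\<bar>) \<partial>lborel) = (\<integral>\<^sup>+t. f t * ennreal (1 / \<bar>t\<bar>) \<partial>lborel)"
proof -
  have "(\<integral>\<^sup>+t. f t * ennreal (1 / \<bar>t\<bar>) \<partial>lborel) = (\<integral>\<^sup>+t. ennreal \<bar>a\<bar> * (f (a * t) * ennreal (1 / \<bar>a * t\<bar>)) \<partial>lborel)"
    using a by (subst nn_integral_real_affine[where c=a and t=0]) (simp_all add: nn_integral_cmult)
  also have "(\<lambda>t. ennreal \<bar>a\<bar> * (f (a * t) * ennreal (1 / \<bar>a * t\<bar>))) = (\<lambda>t. f (a * t) * ennreal (1 / \<bar>t\<bar>))"
  proof
    fix t
    have "ennreal \<bar>a\<bar> * ennreal (1 / \<bar>a * t\<bar>) = ennreal (1 / \<bar>t\<bar>)"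
      using a by (simp add: ennreal_mult[symmetric] abs_mult)
    then show "ennreal \<bar>a\<bar> * (f (a * t) * ennreal (1 / \<bar>a * t\<bar>)) = f (a * t) * ennreal (1 / \<bar>t\<bar>)"
      by (metis mult.left_commute)
  qed
  finally show ?thesis by simp
qed

text \<open>This is the cut-off \<open>v\<close> of the overview. Dividing it by \<open>r\<close>
  leaves the translate \<open>bump (r - 1)\<close>, which has mass one.\<close>

definition shell :: "real \<Rightarrow> real" where
  "shell r = \<bar>r\<bar> * bump (r - 1)"

lemma shell_nonneg [simp]: "0 \<le> shell r"
  by (simp add: shell_def)

lemma shell_eq_0: "r \<le> 1 \<or> 2 \<le> r \<Longrightarrow> shell r = 0"
  by (auto simp: shell_def bump_eq_0)

lemma shell_le: "shell r \<le> 4"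
proof (cases "1 \<le> r \<and> r \<le> 2")
  case True
  then have "shell r \<le> 2 * 2" unfolding shell_def by (intro mult_mono bump_le) auto
  then show ?thesis by simp
qed (auto simp: shell_eq_0)

lemma continuous_on_shell [continuous_intros]:
  "continuous_on S f \<Longrightarrow> continuous_on S (\<lambda>x. shell (f x))"
  unfolding shell_def by (intro continuous_intros)

lemma borel_measurable_shell [measurable]: "shell \<in> borel_measurable borel"
  unfolding shell_def by measurable

lemma haar_shell: "(\<integral>\<^sup>+t. ennreal (shell t) * ennreal (1 / \<bar>t\<bar>) \<partial>lborel) = 1"
proof -
  have "ennreal (shell t) * ennreal (1 / \<bar>t\<bar>) = ennreal (bump (t - 1))" for t
    by (cases "t = 0") (simp_all add: shell_def bump_eq_0 ennreal_mult[symmetric])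
  then show ?thesis
    using nn_integral_real_affine[of "\<lambda>t. ennreal (bump t)" 1 "-1"] by (simp add: nn_integral_bump)
qed

text \<open>The argument is the one for uniqueness of Haar measures: a factor of mass one, written
  as an integral of \<open>v (t * s)\<close> in \<open>s\<close>, couples two variables. Scaling
  first \<open>t\<close> by \<open>s\<close> and then \<open>s\<close> by \<open>c / t\<close>
  removes the inversion.\<close>

lemma haar_inverse:
  fixes f :: "real \<Rightarrow> ennreal"
  assumes c: "c \<noteq> 0" and [measurable]: "f \<in> borel_measurable borel"
  shows "(\<integral>\<^sup>+t. f (c / t) * ennreal (1 / \<bar>t\<bar>) \<partial>lborel) = (\<integral>\<^sup>+t. f t * ennreal (1 / \<bar>t\<bar>) \<partial>lborel)"
proof -
  define v where "v s = ennreal (shell s)" for s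
  define d where "d s = ennreal (1 / \<bar>s\<bar>)" for s :: real
  have [measurable]: "v \<in> borel_measurable borel" "d \<in> borel_measurable borel"
    unfolding v_def d_def by measurable
  have d0: "d 0 = 0" by (simp add: d_def)
  have vd: "(\<integral>\<^sup>+s. v s * d s \<partial>lborel) = 1" unfolding v_def d_def by (rule haar_shell)
  have sc: "(\<integral>\<^sup>+t. k (a * t) * d t \<partial>lborel) = (\<integral>\<^sup>+t. k t * d t \<partial>lborel)"
    if "a \<noteq> 0" "k \<in> borel_measurable borel" for a k
    unfolding d_def using that by (rule haar_scale)
  have "(\<integral>\<^sup>+t. f (c / t) * d t \<partial>lborel) = (\<integral>\<^sup>+t. f (c / t) * d t * (\<integral>\<^sup>+s. v s * d s \<partial>lborel) \<partial>lborel)"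
    by (simp add: vd)
  also have "\<dots> = (\<integral>\<^sup>+t. f (c / t) * d t * (\<integral>\<^sup>+s. v (t * s) * d s \<partial>lborel) \<partial>lborel)"
  proof (intro nn_integral_cong)
    fix t show "f (c / t) * d t * (\<integral>\<^sup>+s. v s * d s \<partial>lborel) = f (c / t) * d t * (\<integral>\<^sup>+s. v (t * s) * d s \<partial>lborel)"
      by (cases "t = 0") (simp_all add: d0 sc)
  qed
  also have "\<dots> = (\<integral>\<^sup>+t. \<integral>\<^sup>+s. (f (c / t) * v (t * s)) * d t * d s \<partial>lborel \<partial>lborel)"
    by (subst nn_integral_cmult[symmetric]) (simp_all add: mult_ac)
  also have "\<dots> = (\<integral>\<^sup>+s. \<integral>\<^sup>+t. (f (c / t) * v (t * s)) * d t * d s \<partial>lborel \<partial>lborel)"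
    by (rule lborel_pair.Fubini') measurable
  also have "\<dots> = (\<integral>\<^sup>+s. (\<integral>\<^sup>+t. (f (c / t) * v (t * s)) * d t \<partial>lborel) * d s \<partial>lborel)"
    by (simp add: nn_integral_multc)
  also have "\<dots> = (\<integral>\<^sup>+s. (\<integral>\<^sup>+t. (f (c * s / t) * v t) * d t \<partial>lborel) * d s \<partial>lborel)"
  proof (intro nn_integral_cong)
    fix s
    show "(\<integral>\<^sup>+t. (f (c / t) * v (t * s)) * d t \<partial>lborel) * d s = (\<integral>\<^sup>+t. (f (c * s / t) * v t) * d t \<partial>lborel) * d s"
    proof (cases "s = 0")
      case False
      then show ?thesis using sc[of s "\<lambda>t. f (c * s / t) * v t"] by (simp add: mult.commute)
    qed (simp add: d0)
  qed
  also have "\<dots> = (\<integral>\<^sup>+s. \<integral>\<^sup>+t. f (c * s / t) * v t * d t * d s \<partial>lborel \<partial>lborel)"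
    by (simp add: nn_integral_multc)
  also have "\<dots> = (\<integral>\<^sup>+t. \<integral>\<^sup>+s. f (c * s / t) * v t * d t * d s \<partial>lborel \<partial>lborel)"
    by (rule lborel_pair.Fubini') measurable
  also have "\<dots> = (\<integral>\<^sup>+t. (v t * d t) * (\<integral>\<^sup>+s. f (c * s / t) * d s \<partial>lborel) \<partial>lborel)"
    by (subst nn_integral_cmult[symmetric]) (simp_all add: mult_ac)
  also have "\<dots> = (\<integral>\<^sup>+t. (v t * d t) * (\<integral>\<^sup>+s. f s * d s \<partial>lborel) \<partial>lborel)"
  proof (intro nn_integral_cong)
    fix t
    show "(v t * d t) * (\<integral>\<^sup>+s. f (c * s / t) * d s \<partial>lborel) = (v t * d t) * (\<integral>\<^sup>+s. f s * d s \<partial>lborel)"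
      using sc[of "c / t" f] c by (cases "t = 0") (simp_all add: d0)
  qed
  also have "\<dots> = (\<integral>\<^sup>+s. f s * d s \<partial>lborel)"
    by (simp add: nn_integral_multc vd)
  finally show ?thesis by (simp add: d_def)
qed

section \<open>The incidence measure on pairs of orthogonal vectors and its symmetry\<close>

lemma AE_lborel_inner_neq_0:
  fixes w :: "'a::euclidean_space"
  assumes "w \<noteq> 0"
  shows "AE z in lborel. z \<bullet> w \<noteq> 0"
proof -
  have "negligible {z. w \<bullet> z = 0}" using assms by (intro negligible_hyperplane) simp
  then have "AE z in lebesgue. \<not> w \<bullet> z = 0"
    by (simp add: negligible_iff_null_sets completion.null_sets_iff_AE)
  then show ?thesis by (simp add: AE_completion_iff inner_commute)
qed

lemma AE_hyp_inner_neq_0: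
  fixes w e :: "'a::euclidean_space"
  assumes e: "norm e = 1" and w: "w \<noteq> 0" "w \<bullet> e = 0"
  shows "AE x in hyp_lborel e. x \<bullet> w \<noteq> 0"
proof -
  have "(\<integral>\<^sup>+x. indicator {x. x \<bullet> w = 0} x \<partial>hyp_lborel e) =
    (\<integral>\<^sup>+z. indicator {x. x \<bullet> w = 0} (z - (z \<bullet> e) *\<^sub>R e) * ennreal (bump (z \<bullet> e)) \<partial>lborel)"
    by (rule nn_integral_hyp_bump[OF e]) measurable
  also have "\<dots> = (\<integral>\<^sup>+z. 0 \<partial>(lborel :: 'a measure))"
    using AE_lborel_inner_neq_0[OF w(1)] w(2)
    by (intro nn_integral_cong_AE) (auto simp: indicator_def inner_diff_left inner_commute[of e])
  finally have "emeasure (hyp_lborel e) {x. x \<bullet> w = 0} = 0" by simp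
  then show ?thesis
    by (intro AE_I[of _ _ "{x. x \<bullet> w = 0}"]) auto
qed

text \<open>In dimension one the hyperplane is the origin carrying a point mass. From dimension two
  on there is a nonzero \<open>w\<close> orthogonal to \<open>e\<close>, and the origin lies in the
  null set where \<open>x \<bullet> w = 0\<close>.\<close>

lemma AE_hyp_neq_0:
  fixes e :: "'a::euclidean_space"
  assumes e: "norm e = 1" and dim: "DIM('a) \<ge> 2"
  shows "AE x in hyp_lborel e. x \<noteq> 0"
proof -
  obtain w :: 'a where "w \<noteq> 0" "orthogonal e w"
    using orthogonal_to_vector_exists[of e] dim by auto
  then show ?thesis
    using AE_hyp_inner_neq_0[OF e, of w] by (auto simp: orthogonal_def inner_commute)
qed

text \<open>A pair of orthogonal vectors is parametrised by the components \<open>x\<close> and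
  \<open>y\<close> of the two vectors orthogonal to \<open>e\<close> and by the height
  \<open>t\<close> of the second along \<open>e\<close>: orthogonality forces the height of the
  first to be \<open>- (x \<bullet> y) / t\<close>. Slicing the second variable along
  \<open>e\<close> and writing its hyperplane as a graph leaves the density
  \<open>1 / \<bar>t\<bar>\<close>.\<close>

lemma nn_integral_incidence_graph:
  fixes e :: "'a::euclidean_space"
  assumes e: "norm e = 1" and [measurable]: "F \<in> borel_measurable (borel \<Otimes>\<^sub>M borel)"
  shows "(\<integral>\<^sup>+y. ennreal (1 / norm y) * (\<integral>\<^sup>+x. F (x, y) \<partial>hyp_lborel y) \<partial>lborel) =
    (\<integral>\<^sup>+y. \<integral>\<^sup>+x. \<integral>\<^sup>+t. F (x - ((x \<bullet> y) / t) *\<^sub>R e, y + t *\<^sub>R e) * ennreal (1 / \<bar>t\<bar>) \<partial>lborel \<partial>hyp_lborel e \<partial>hyp_lborel e)"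
proof -
  interpret E: sigma_finite_measure "hyp_lborel e" by (rule sigma_finite_hyp_lborel)
  interpret E: pair_sigma_finite "lborel :: real measure" "hyp_lborel e" ..
  have e0: "e \<noteq> 0" using e by auto
  have "(\<integral>\<^sup>+y. ennreal (1 / norm y) * (\<integral>\<^sup>+x. F (x, y) \<partial>hyp_lborel y) \<partial>lborel) =
    (\<integral>\<^sup>+y. ennreal (1 / \<bar>y \<bullet> e\<bar>) * (\<integral>\<^sup>+x. F (x - ((x \<bullet> y) / (y \<bullet> e)) *\<^sub>R e, y) \<partial>hyp_lborel e) \<partial>lborel)"
    using AE_lborel_inner_neq_0[OF e0]
    by (intro nn_integral_cong_AE) (auto intro!: nn_integral_hyp_graph[OF e, where \<Phi>="\<lambda>x. F (x, _)"])
  also have "\<dots> = (\<integral>\<^sup>+y. \<integral>\<^sup>+t. ennreal (1 / \<bar>(y + t *\<^sub>R e) \<bullet> e\<bar>) *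
     (\<integral>\<^sup>+x. F (x - ((x \<bullet> (y + t *\<^sub>R e)) / ((y + t *\<^sub>R e) \<bullet> e)) *\<^sub>R e, y + t *\<^sub>R e) \<partial>hyp_lborel e) \<partial>lborel \<partial>hyp_lborel e)"
    by (rule nn_integral_lborel_slices[OF e]) measurable
  also have "\<dots> = (\<integral>\<^sup>+y. \<integral>\<^sup>+t. ennreal (1 / \<bar>t\<bar>) *
     (\<integral>\<^sup>+x. F (x - ((x \<bullet> (y + t *\<^sub>R e)) / t) *\<^sub>R e, y + t *\<^sub>R e) \<partial>hyp_lborel e) \<partial>lborel \<partial>hyp_lborel e)"
    using AE_hyp_lborel[of e] e by (intro nn_integral_cong_AE) (auto simp: inner_add_left norm_eq_1)
  also have "\<dots> = (\<integral>\<^sup>+y. \<integral>\<^sup>+t. ennreal (1 / \<bar>t\<bar>) *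
     (\<integral>\<^sup>+x. F (x - ((x \<bullet> y) / t) *\<^sub>R e, y + t *\<^sub>R e) \<partial>hyp_lborel e) \<partial>lborel \<partial>hyp_lborel e)"
    using AE_hyp_lborel[of e]
    by (intro nn_integral_cong arg_cong2[where f="(*)"] refl nn_integral_cong_AE)
       (auto simp: inner_add_right)
  also have "\<dots> = (\<integral>\<^sup>+y. \<integral>\<^sup>+t. \<integral>\<^sup>+x. F (x - ((x \<bullet> y) / t) *\<^sub>R e, y + t *\<^sub>R e) * ennreal (1 / \<bar>t\<bar>) \<partial>hyp_lborel e \<partial>lborel \<partial>hyp_lborel e)"
    by (subst nn_integral_cmult[symmetric]) (simp_all add: mult.commute)
  also have "\<dots> = (\<integral>\<^sup>+y. \<integral>\<^sup>+x. \<integral>\<^sup>+t. F (x - ((x \<bullet> y) / t) *\<^sub>R e, y + t *\<^sub>R e) * ennreal (1 / \<bar>t\<bar>) \<partial>lborel \<partial>hyp_lborel e \<partial>hyp_lborel e)"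
    by (intro nn_integral_cong E.Fubini'[symmetric]) measurable
  finally show ?thesis .
qed

text \<open>In the graph coordinates \<open>x\<^sub>n = -(x'\<bullet>y') / y\<^sub>n\<close> the symmetry of the incidence relation is the
  invariance of \<open>dt / |t|\<close> under \<open>t \<mapsto> - (x'\<bullet>y') / t\<close>.\<close>

lemma nn_integral_incidence_swap:
  fixes F :: "'a::euclidean_space \<times> 'a \<Rightarrow> ennreal"
  assumes dim: "DIM('a) \<ge> 2" and [measurable]: "F \<in> borel_measurable (borel \<Otimes>\<^sub>M borel)"
  shows "(\<integral>\<^sup>+y. ennreal (1 / norm y) * (\<integral>\<^sup>+x. F (x, y) \<partial>hyp_lborel y) \<partial>lborel) =
    (\<integral>\<^sup>+x. ennreal (1 / norm x) * (\<integral>\<^sup>+y. F (x, y) \<partial>hyp_lborel x) \<partial>lborel)"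
proof -
  obtain e :: 'a where e: "norm e = 1" using vector_choose_size[of 1] by auto
  interpret E: sigma_finite_measure "hyp_lborel e" by (rule sigma_finite_hyp_lborel)
  interpret E: pair_sigma_finite "hyp_lborel e" "hyp_lborel e" ..
  have "(\<integral>\<^sup>+x. ennreal (1 / norm x) * (\<integral>\<^sup>+y. F (x, y) \<partial>hyp_lborel x) \<partial>lborel) =
    (\<integral>\<^sup>+x. \<integral>\<^sup>+y. \<integral>\<^sup>+t. F (x + t *\<^sub>R e, y - ((y \<bullet> x) / t) *\<^sub>R e) * ennreal (1 / \<bar>t\<bar>) \<partial>lborel \<partial>hyp_lborel e \<partial>hyp_lborel e)"
    using nn_integral_incidence_graph[OF e, of "\<lambda>(x, y). F (y, x)"] by simp
  also have "\<dots> = (\<integral>\<^sup>+y. \<integral>\<^sup>+x. \<integral>\<^sup>+t. F (x + t *\<^sub>R e, y - ((y \<bullet> x) / t) *\<^sub>R e) * ennreal (1 / \<bar>t\<bar>) \<partial>lborel \<partial>hyp_lborel e \<partial>hyp_lborel e)"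
    by (rule E.Fubini') measurable
  also have "\<dots> = (\<integral>\<^sup>+y. \<integral>\<^sup>+x. \<integral>\<^sup>+t. F (x - ((x \<bullet> y) / t) *\<^sub>R e, y + t *\<^sub>R e) * ennreal (1 / \<bar>t\<bar>) \<partial>lborel \<partial>hyp_lborel e \<partial>hyp_lborel e)"
  proof (rule nn_integral_cong_AE)
    \<comment> \<open>The inversion requires \<open>x \<bullet> y \<noteq> 0\<close>. For
      \<open>y \<noteq> 0\<close> this fails only on a null set of the hyperplane, and
      \<open>y \<noteq> 0\<close> holds almost everywhere by the dimension bound.\<close>
    have *: "(\<integral>\<^sup>+t. F (x + t *\<^sub>R e, y - ((y \<bullet> x) / t) *\<^sub>R e) * ennreal (1 / \<bar>t\<bar>) \<partial>lborel) =
      (\<integral>\<^sup>+t. F (x - ((x \<bullet> y) / t) *\<^sub>R e, y + t *\<^sub>R e) * ennreal (1 / \<bar>t\<bar>) \<partial>lborel)" if "x \<bullet> y \<noteq> 0" for x y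
      using haar_inverse[of "- (x \<bullet> y)" "\<lambda>t. F (x + t *\<^sub>R e, y - ((y \<bullet> x) / t) *\<^sub>R e)"] that
      by (simp add: inner_commute)
    show "AE y in hyp_lborel e.
      (\<integral>\<^sup>+x. \<integral>\<^sup>+t. F (x + t *\<^sub>R e, y - ((y \<bullet> x) / t) *\<^sub>R e) * ennreal (1 / \<bar>t\<bar>) \<partial>lborel \<partial>hyp_lborel e) =
      (\<integral>\<^sup>+x. \<integral>\<^sup>+t. F (x - ((x \<bullet> y) / t) *\<^sub>R e, y + t *\<^sub>R e) * ennreal (1 / \<bar>t\<bar>) \<partial>lborel \<partial>hyp_lborel e)"
      using AE_hyp_lborel[of e] AE_hyp_neq_0[OF e dim]
    proof eventually_elim
      case (elim y)
      then show ?case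
        using AE_hyp_inner_neq_0[OF e elim(2,1)] by (intro nn_integral_cong_AE) (auto simp: *)
    qed
  qed
  finally show ?thesis
    using nn_integral_incidence_graph[OF e, of F] by simp
qed

section \<open>Transfer of the identities for nonnegative functions to Bochner integrals\<close>

lemma
  fixes f :: "'b \<Rightarrow> 'c::{banach, second_countable_topology}" and w :: "'a \<Rightarrow> real"
  assumes X[measurable]: "X \<in> N \<rightarrow>\<^sub>M L" and w[measurable]: "w \<in> borel_measurable N" "\<And>z. 0 \<le> w z"
    and f: "f \<in> borel_measurable L" and sets: "sets M = sets L"
    and eq: "\<And>\<Phi>. \<Phi> \<in> borel_measurable L \<Longrightarrow> (\<integral>\<^sup>+z. \<Phi> (X z) * ennreal (w z) \<partial>N) = (\<integral>\<^sup>+x. \<Phi> x \<partial>M)"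
  shows integrable_nn_integral_transfer: "integrable M f \<longleftrightarrow> integrable N (\<lambda>z. w z *\<^sub>R f (X z))"
    and integral_nn_integral_transfer: "(\<integral>x. f x \<partial>M) = (\<integral>z. w z *\<^sub>R f (X z) \<partial>N)"
proof -
  \<comment> \<open>Applied to indicators, \<open>eq\<close> already says that \<open>M\<close> is
    the image under \<open>X\<close> of \<open>N\<close> with density \<open>w\<close>; both claims
    then follow from the rules for images and densities.\<close>
  have M: "M = distr (density N w) L X"
  proof (rule measure_eqI)
    fix A assume "A \<in> sets M"
    then have A[measurable]: "A \<in> sets L" using sets by simp
    have "emeasure M A = (\<integral>\<^sup>+x. indicator A x \<partial>M)" using \<open>A \<in> sets M\<close> by simp
    also have "\<dots> = (\<integral>\<^sup>+z. indicator A (X z) * ennreal (w z) \<partial>N)"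
      by (rule eq[symmetric]) measurable
    also have "\<dots> = (\<integral>\<^sup>+x. indicator A x \<partial>distr (density N w) L X)"
      by (subst nn_integral_distr) (simp_all add: nn_integral_density mult.commute)
    also have "\<dots> = emeasure (distr (density N w) L X) A"
      by (rule nn_integral_indicator) simp
    finally show "emeasure M A = emeasure (distr (density N w) L X) A" .
  qed (simp add: sets)
  have [measurable]: "f \<in> borel_measurable L" by (rule f)
  have fX: "(\<lambda>z. f (X z)) \<in> borel_measurable N" by measurable
  show "integrable M f \<longleftrightarrow> integrable N (\<lambda>z. w z *\<^sub>R f (X z))"
    unfolding M by (subst integrable_distr_eq) (auto simp: integrable_density[OF fX] w)
  show "(\<integral>x. f x \<partial>M) = (\<integral>z. w z *\<^sub>R f (X z) \<partial>N)"
    unfolding M by (subst integral_distr) (auto simp: integral_density[OF fX] w)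
qed

lemma
  fixes \<xi> :: "'a::euclidean_space" and f :: "'a \<Rightarrow> 'c::{banach, second_countable_topology}"
  assumes \<xi>: "norm \<xi> = 1" and f: "f \<in> borel_measurable borel"
  shows integrable_lborel_slices: "integrable lborel f \<longleftrightarrow> integrable (hyp_lborel \<xi> \<Otimes>\<^sub>M lborel) (\<lambda>p. f (fst p + snd p *\<^sub>R \<xi>))"
    and integral_lborel_slices: "(\<integral>x. f x \<partial>lborel) = (\<integral>p. f (fst p + snd p *\<^sub>R \<xi>) \<partial>(hyp_lborel \<xi> \<Otimes>\<^sub>M lborel))"
proof -
  have "(\<integral>\<^sup>+p. \<Phi> (fst p + snd p *\<^sub>R \<xi>) * ennreal 1 \<partial>(hyp_lborel \<xi> \<Otimes>\<^sub>M lborel)) = (\<integral>\<^sup>+x. \<Phi> x \<partial>lborel)"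
    if [measurable]: "\<Phi> \<in> borel_measurable borel" for \<Phi> :: "'a \<Rightarrow> ennreal"
    by (simp add: nn_integral_lborel_slices[OF \<xi> that] flip: lborel.nn_integral_fst)
  note * = integrable_nn_integral_transfer[OF _ _ _ f _ this] integral_nn_integral_transfer[OF _ _ _ f _ this]
  show "integrable lborel f \<longleftrightarrow> integrable (hyp_lborel \<xi> \<Otimes>\<^sub>M lborel) (\<lambda>p. f (fst p + snd p *\<^sub>R \<xi>))"
    by (subst *(1)) simp_all
  show "(\<integral>x. f x \<partial>lborel) = (\<integral>p. f (fst p + snd p *\<^sub>R \<xi>) \<partial>(hyp_lborel \<xi> \<Otimes>\<^sub>M lborel))"
    by (subst *(2)) simp_all
qed

lemma
  fixes \<xi> :: "'a::euclidean_space" and f :: "'a \<Rightarrow> 'c::{banach, second_countable_topology}"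
  assumes \<xi>: "norm \<xi> = 1" and f: "f \<in> borel_measurable borel"
  shows integrable_hyp_bump:
      "integrable (hyp_lborel \<xi>) f \<longleftrightarrow> integrable lborel (\<lambda>z. bump (z \<bullet> \<xi>) *\<^sub>R f (z - (z \<bullet> \<xi>) *\<^sub>R \<xi>))"
    and integral_hyp_bump:
      "(\<integral>x. f x \<partial>hyp_lborel \<xi>) = (\<integral>z. bump (z \<bullet> \<xi>) *\<^sub>R f (z - (z \<bullet> \<xi>) *\<^sub>R \<xi>) \<partial>lborel)"
proof -
  have eq: "(\<integral>\<^sup>+z. \<Phi> (z - (z \<bullet> \<xi>) *\<^sub>R \<xi>) * ennreal (bump (z \<bullet> \<xi>)) \<partial>lborel) = (\<integral>\<^sup>+x. \<Phi> x \<partial>hyp_lborel \<xi>)"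
    if "\<Phi> \<in> borel_measurable borel" for \<Phi>
    using nn_integral_hyp_bump[OF \<xi> that] by simp
  show "integrable (hyp_lborel \<xi>) f \<longleftrightarrow> integrable lborel (\<lambda>z. bump (z \<bullet> \<xi>) *\<^sub>R f (z - (z \<bullet> \<xi>) *\<^sub>R \<xi>))"
    by (rule integrable_nn_integral_transfer[OF _ _ _ f _ eq]) simp_all
  show "(\<integral>x. f x \<partial>hyp_lborel \<xi>) = (\<integral>z. bump (z \<bullet> \<xi>) *\<^sub>R f (z - (z \<bullet> \<xi>) *\<^sub>R \<xi>) \<partial>lborel)"
    by (rule integral_nn_integral_transfer[OF _ _ _ f _ eq]) simp_all
qed

text \<open>The inner integral of the incidence measure: a Funk transform extended to be homogeneous
  of degree -1, with value 0 at the origin because \<open>1 / 0 = 0\<close>.\<close>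

definition radon :: "('a::euclidean_space \<Rightarrow> 'c::{banach, second_countable_topology}) \<Rightarrow> 'a \<Rightarrow> 'c" where
  "radon f y = (1 / norm y) *\<^sub>R (\<integral>x. f x \<partial>hyp_lborel y)"

lemma radon_bump:
  fixes f :: "'a::euclidean_space \<Rightarrow> 'c::{banach, second_countable_topology}"
  assumes [measurable]: "f \<in> borel_measurable borel"
  shows "radon f y = (\<integral>z. (bump (z \<bullet> sgn y) / norm y) *\<^sub>R f (z - (z \<bullet> sgn y) *\<^sub>R sgn y) \<partial>lborel)"
proof (cases "y = 0")
  case False
  then have "(\<integral>x. f x \<partial>hyp_lborel y) = (\<integral>z. bump (z \<bullet> sgn y) *\<^sub>R f (z - (z \<bullet> sgn y) *\<^sub>R sgn y) \<partial>lborel)"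
    using integral_hyp_bump[of "sgn y" f] by (simp add: norm_sgn hyp_lborel_sgn)
  then show ?thesis
    by (simp add: radon_def flip: integral_scaleR_right)
qed (simp add: radon_def)

lemma borel_measurable_sgn_euclidean [measurable (raw)]:
  fixes f :: "'b \<Rightarrow> 'a::euclidean_space"
  assumes [measurable]: "f \<in> borel_measurable M"
  shows "(\<lambda>x. sgn (f x)) \<in> borel_measurable M"
  unfolding sgn_div_norm by measurable

lemma borel_measurable_radon [measurable]:
  fixes f :: "'a::euclidean_space \<Rightarrow> 'c::{banach, second_countable_topology}"
  assumes [measurable]: "f \<in> borel_measurable borel"
  shows "radon f \<in> borel_measurable borel"
proof -
  have "radon f = (\<lambda>y. \<integral>z. (bump (z \<bullet> sgn y) / norm y) *\<^sub>R f (z - (z \<bullet> sgn y) *\<^sub>R sgn y) \<partial>lborel)"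
    by (rule ext) (simp add: radon_bump)
  also have "\<dots> \<in> borel_measurable borel" by measurable
  finally show ?thesis .
qed

text \<open>This realises the incidence measure as the image of a weighted Lebesgue measure on all
  pairs, the form that the transfer to Bochner integrals requires: \<open>fst p\<close> is the
  normal and \<open>snd p\<close> is projected to its hyperplane.\<close>

lemma nn_integral_incidence_bump:
  fixes F :: "'a::euclidean_space \<times> 'a \<Rightarrow> ennreal"
  assumes [measurable]: "F \<in> borel_measurable (borel \<Otimes>\<^sub>M borel)"
  shows "(\<integral>\<^sup>+p. F (snd p - (snd p \<bullet> sgn (fst p)) *\<^sub>R sgn (fst p), fst p) * ennreal (bump (snd p \<bullet> sgn (fst p)) / norm (fst p)) \<partial>(lborel \<Otimes>\<^sub>M lborel)) =
    (\<integral>\<^sup>+y. ennreal (1 / norm y) * (\<integral>\<^sup>+x. F (x, y) \<partial>hyp_lborel y) \<partial>lborel)"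
proof -
  have "ennreal (1 / norm y) * (\<integral>\<^sup>+x. F (x, y) \<partial>hyp_lborel y) =
    (\<integral>\<^sup>+z. F (z - (z \<bullet> sgn y) *\<^sub>R sgn y, y) * ennreal (bump (z \<bullet> sgn y) / norm y) \<partial>lborel)" for y
  proof (cases "y = 0")
    case False
    have *: "a * ennreal (b / norm y) = ennreal (1 / norm y) * (a * ennreal b)" if "b \<ge> 0" for a b
    proof -
      have "ennreal (b / norm y) = ennreal (1 / norm y) * ennreal b"
        using that by (simp flip: ennreal_mult)
      then show ?thesis by (simp add: mult_ac)
    qed
    have "ennreal (1 / norm y) * (\<integral>\<^sup>+x. F (x, y) \<partial>hyp_lborel y) =
      ennreal (1 / norm y) * (\<integral>\<^sup>+z. F (z - (z \<bullet> sgn y) *\<^sub>R sgn y, y) * ennreal (bump (z \<bullet> sgn y)) \<partial>lborel)"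
      using False nn_integral_hyp_bump[of "sgn y" "\<lambda>x. F (x, y)"] by (simp add: norm_sgn hyp_lborel_sgn)
    also have "\<dots> = (\<integral>\<^sup>+z. ennreal (1 / norm y) * (F (z - (z \<bullet> sgn y) *\<^sub>R sgn y, y) * ennreal (bump (z \<bullet> sgn y))) \<partial>lborel)"
      by (rule nn_integral_cmult[symmetric]) measurable
    finally show ?thesis by (simp only: *[OF bump_nonneg])
  qed simp
  then show ?thesis
    by (subst lborel.nn_integral_fst[symmetric]) simp_all
qed

lemma integral_incidence:
  fixes F :: "'a::euclidean_space \<times> 'a \<Rightarrow> 'c::{banach, second_countable_topology}"
  assumes [measurable]: "F \<in> borel_measurable (borel \<Otimes>\<^sub>M borel)"
    and fin: "(\<integral>\<^sup>+y. ennreal (1 / norm y) * (\<integral>\<^sup>+x. ennreal (norm (F (x, y))) \<partial>hyp_lborel y) \<partial>lborel) < \<infinity>"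
  defines "w \<equiv> \<lambda>p. bump (snd p \<bullet> sgn (fst p)) / norm (fst p)"
    and "X \<equiv> \<lambda>p. (snd p - (snd p \<bullet> sgn (fst p)) *\<^sub>R sgn (fst p), fst p)"
  shows "integrable lborel (\<lambda>y. radon (\<lambda>x. F (x, y)) y)"
    and "(\<integral>p. w p *\<^sub>R F (X p) \<partial>(lborel \<Otimes>\<^sub>M lborel)) = (\<integral>y. radon (\<lambda>x. F (x, y)) y \<partial>lborel)"
proof -
  have w0: "0 \<le> w p" for p by (simp add: w_def)
  have int: "integrable (lborel \<Otimes>\<^sub>M lborel) (\<lambda>p. w p *\<^sub>R F (X p))"
  proof (rule integrableI_bounded)
    show "(\<lambda>p. w p *\<^sub>R F (X p)) \<in> borel_measurable (lborel \<Otimes>\<^sub>M lborel)"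
      unfolding w_def X_def by measurable
    have "(\<integral>\<^sup>+p. ennreal (norm (w p *\<^sub>R F (X p))) \<partial>(lborel \<Otimes>\<^sub>M lborel)) =
      (\<integral>\<^sup>+p. (\<lambda>q. ennreal (norm (F q))) (X p) * ennreal (w p) \<partial>(lborel \<Otimes>\<^sub>M lborel))"
      using w0 by (simp add: ennreal_mult mult.commute)
    also have "\<dots> < \<infinity>"
      unfolding w_def X_def by (subst nn_integral_incidence_bump) (use fin in auto)
    finally show "(\<integral>\<^sup>+p. ennreal (norm (w p *\<^sub>R F (X p))) \<partial>(lborel \<Otimes>\<^sub>M lborel)) < \<infinity>" .
  qed
  have eq: "(\<integral>z. w (y, z) *\<^sub>R F (X (y, z)) \<partial>lborel) = radon (\<lambda>x. F (x, y)) y" for y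
    by (subst radon_bump) (simp_all add: w_def X_def)
  show "integrable lborel (\<lambda>y. radon (\<lambda>x. F (x, y)) y)"
    using lborel_pair.integrable_fst'[OF int] by (simp add: eq)
  show "(\<integral>p. w p *\<^sub>R F (X p) \<partial>(lborel \<Otimes>\<^sub>M lborel)) = (\<integral>y. radon (\<lambda>x. F (x, y)) y \<partial>lborel)"
    using lborel_pair.integral_fst'[OF int] by (simp add: eq)
qed

lemma integral_incidence_swap:
  fixes F :: "'a::euclidean_space \<times> 'a \<Rightarrow> 'c::{banach, second_countable_topology}"
  assumes dim: "DIM('a) \<ge> 2" and F[measurable]: "F \<in> borel_measurable (borel \<Otimes>\<^sub>M borel)"
    and fin: "(\<integral>\<^sup>+y. ennreal (1 / norm y) * (\<integral>\<^sup>+x. ennreal (norm (F (x, y))) \<partial>hyp_lborel y) \<partial>lborel) < \<infinity>"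
  shows "integrable lborel (\<lambda>y. radon (\<lambda>x. F (x, y)) y)"
    and "integrable lborel (\<lambda>x. radon (\<lambda>y. F (x, y)) x)"
    and "(\<integral>y. radon (\<lambda>x. F (x, y)) y \<partial>lborel) = (\<integral>x. radon (\<lambda>y. F (x, y)) x \<partial>lborel)"
proof -
  let ?N = "lborel \<Otimes>\<^sub>M lborel :: ('a \<times> 'a) measure"
  define w :: "'a \<times> 'a \<Rightarrow> real" where "w = (\<lambda>p. bump (snd p \<bullet> sgn (fst p)) / norm (fst p))"
  define X :: "'a \<times> 'a \<Rightarrow> 'a \<times> 'a" where "X = (\<lambda>p. (snd p - (snd p \<bullet> sgn (fst p)) *\<^sub>R sgn (fst p), fst p))"
  have [measurable]: "w \<in> borel_measurable ?N" "X \<in> ?N \<rightarrow>\<^sub>M borel \<Otimes>\<^sub>M borel"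
    unfolding w_def X_def by measurable
  have w0: "0 \<le> w p" for p by (simp add: w_def)
  \<comment> \<open>\<open>M\<close> is the incidence measure itself. By its symmetry it is the
    image of the weighted \<open>?N\<close> both under \<open>X\<close> and under \<open>X\<close>
    followed by \<open>prod.swap\<close>; evaluating one integral in these two ways exchanges the
    variables.\<close>
  define M where "M = distr (density ?N w) (borel \<Otimes>\<^sub>M borel) X"
  have M: "(\<integral>\<^sup>+q. \<Phi> q \<partial>M) = (\<integral>\<^sup>+p. \<Phi> (X p) * ennreal (w p) \<partial>?N)"
    if [measurable]: "\<Phi> \<in> borel_measurable (borel \<Otimes>\<^sub>M borel)" for \<Phi>
    unfolding M_def by (simp add: nn_integral_distr nn_integral_density mult.commute)
  have swap: "(\<integral>\<^sup>+p. \<Phi> (prod.swap (X p)) * ennreal (w p) \<partial>?N) = (\<integral>\<^sup>+q. \<Phi> q \<partial>M)"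
    if [measurable]: "\<Phi> \<in> borel_measurable (borel \<Otimes>\<^sub>M borel)" for \<Phi>
  proof -
    have [measurable]: "(\<lambda>q. \<Phi> (prod.swap q)) \<in> borel_measurable (borel \<Otimes>\<^sub>M borel)"
      unfolding prod.swap_def by measurable
    show ?thesis
      unfolding M[OF that] w_def X_def
      using nn_integral_incidence_bump[of "\<lambda>q. \<Phi> (prod.swap q)"] nn_integral_incidence_bump[of \<Phi>]
        nn_integral_incidence_swap[OF dim, of \<Phi>]
      by simp
  qed
  have setsM: "sets M = sets (borel \<Otimes>\<^sub>M borel)" by (simp add: M_def)
  have sX: "(\<lambda>p. prod.swap (X p)) \<in> ?N \<rightarrow>\<^sub>M borel \<Otimes>\<^sub>M borel"
    unfolding prod.swap_def by measurable
  have *: "(\<integral>q. F q \<partial>M) = (\<integral>p. w p *\<^sub>R F (X p) \<partial>?N)"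
    by (rule integral_nn_integral_transfer[OF _ _ w0 F setsM M[symmetric]]) simp_all
  have **: "(\<integral>q. F q \<partial>M) = (\<integral>p. w p *\<^sub>R F (prod.swap (X p)) \<partial>?N)"
    by (rule integral_nn_integral_transfer[OF sX _ w0 F setsM swap]) simp_all
  have fin': "(\<integral>\<^sup>+y. ennreal (1 / norm y) * (\<integral>\<^sup>+x. ennreal (norm (F (prod.swap (x, y)))) \<partial>hyp_lborel y) \<partial>lborel) < \<infinity>"
    using fin nn_integral_incidence_swap[OF dim, of "\<lambda>q. ennreal (norm (F q))"] by simp
  have Fs: "(\<lambda>q. F (prod.swap q)) \<in> borel_measurable (borel \<Otimes>\<^sub>M borel)"
    unfolding prod.swap_def by measurable
  note A = integral_incidence[OF F fin, folded w_def X_def]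
  note B = integral_incidence[OF Fs fin', folded w_def X_def, simplified prod.swap_def fst_conv snd_conv]
  show "integrable lborel (\<lambda>y. radon (\<lambda>x. F (x, y)) y)" by (rule A)
  show "integrable lborel (\<lambda>x. radon (\<lambda>y. F (x, y)) x)" by (rule B)
  show "(\<integral>y. radon (\<lambda>x. F (x, y)) y \<partial>lborel) = (\<integral>x. radon (\<lambda>y. F (x, y)) x \<partial>lborel)"
    using A(2) B(2) * ** by (simp add: prod.swap_def w_def X_def)
qed

section \<open>Polar coordinates for homogeneous measures\<close>

locale homogeneous_measure = sigma_finite_measure \<tau>
  for \<tau> :: "'a::euclidean_space measure" +
  fixes m :: nat
  assumes sets_eq_borel [measurable_cong, simp]: "sets \<tau> = sets borel"
    and m: "m \<ge> 1"
    and AE_neq_0: "AE x in \<tau>. x \<noteq> 0"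
    and nn_integral_scale:
      "\<And>s \<Phi>. s > 0 \<Longrightarrow> \<Phi> \<in> borel_measurable borel \<Longrightarrow>
         ennreal (s ^ m) * (\<integral>\<^sup>+x. \<Phi> (s *\<^sub>R x) \<partial>\<tau>) = (\<integral>\<^sup>+x. \<Phi> x \<partial>\<tau>)"
begin

sublocale pair_sigma_finite \<tau> "lborel :: real measure" ..

lemma borel_measurable_homogeneous [simp]: "borel_measurable \<tau> = borel_measurable borel"
  by (rule measurable_cong_sets) simp_all

definition polar_weight :: "'a \<times> real \<Rightarrow> real" where
  "polar_weight p = indicator {0<..} (snd p) * snd p ^ (m - 1) * shell (norm (fst p))"

lemma polar_weight_nonneg [simp]: "0 \<le> polar_weight p"
  by (auto simp: polar_weight_def indicator_def)

lemma borel_measurable_polar_weight [measurable]: "polar_weight \<in> borel_measurable (borel \<Otimes>\<^sub>M borel)"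
  unfolding polar_weight_def by measurable

text \<open>For fixed \<open>s\<close> the dilation by \<open>s\<close> turns the weight into
  \<open>shell (norm x / s) / s\<close>. For fixed \<open>x \<noteq> 0\<close> this has mass one in
  \<open>s\<close>, by the invariance of the Haar measure under inversion, so the auxiliary variable
  integrates out.\<close>

lemma nn_integral_polar:
  assumes [measurable]: "\<Phi> \<in> borel_measurable borel"
  shows "(\<integral>\<^sup>+p. \<Phi> (snd p *\<^sub>R fst p) * ennreal (polar_weight p) \<partial>(\<tau> \<Otimes>\<^sub>M lborel)) = (\<integral>\<^sup>+x. \<Phi> x \<partial>\<tau>)"
proof -
  have "(\<integral>\<^sup>+p. \<Phi> (snd p *\<^sub>R fst p) * ennreal (polar_weight p) \<partial>(\<tau> \<Otimes>\<^sub>M lborel)) =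
      (\<integral>\<^sup>+s. \<integral>\<^sup>+x. \<Phi> (s *\<^sub>R x) * ennreal (polar_weight (x, s)) \<partial>\<tau> \<partial>lborel)"
    by (subst nn_integral_snd[symmetric]) simp_all
  also have "\<dots> = (\<integral>\<^sup>+s. \<integral>\<^sup>+x. \<Phi> x * (ennreal (shell (norm x / s)) * ennreal (1 / \<bar>s\<bar>)) \<partial>\<tau> \<partial>lborel)"
  proof (rule nn_integral_cong)
    fix s :: real
    show "(\<integral>\<^sup>+x. \<Phi> (s *\<^sub>R x) * ennreal (polar_weight (x, s)) \<partial>\<tau>) =
      (\<integral>\<^sup>+x. \<Phi> x * (ennreal (shell (norm x / s)) * ennreal (1 / \<bar>s\<bar>)) \<partial>\<tau>)"
    proof (cases "s > 0")
      \<comment> \<open>For \<open>s \<le> 0\<close> the quotient \<open>norm x / s\<close> is at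
        most 0, also by division by zero, so \<open>shell\<close> vanishes and both sides are
        0.\<close>
      case False
      then have "shell (norm x / s) = 0" for x :: 'a
        by (intro shell_eq_0) (auto simp: divide_nonneg_nonpos intro: order_trans[of _ 0])
      then show ?thesis using False by (simp add: polar_weight_def)
    next
      case s: True
      have "ennreal (s ^ m) * ennreal (1 / \<bar>s\<bar>) = ennreal (s ^ (m - 1))"
        using s m by (simp add: ennreal_mult[symmetric] power_diff)
      from this[symmetric] have *: "\<Phi> (s *\<^sub>R x) * ennreal (polar_weight (x, s)) =
          ennreal (s ^ m) * (\<Phi> (s *\<^sub>R x) * (ennreal (shell (norm (s *\<^sub>R x) / s)) * ennreal (1 / \<bar>s\<bar>)))" for x
        using s by (simp add: polar_weight_def ennreal_mult) (simp add: mult_ac)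
      show ?thesis unfolding *
        using nn_integral_scale[OF s, of "\<lambda>x. \<Phi> x * (ennreal (shell (norm x / s)) * ennreal (1 / \<bar>s\<bar>))"]
        by (subst nn_integral_cmult) simp_all
    qed
  qed
  also have "\<dots> = (\<integral>\<^sup>+x. \<integral>\<^sup>+s. \<Phi> x * (ennreal (shell (norm x / s)) * ennreal (1 / \<bar>s\<bar>)) \<partial>lborel \<partial>\<tau>)"
    by (rule Fubini') measurable
  also have "\<dots> = (\<integral>\<^sup>+x. \<Phi> x * 1 \<partial>\<tau>)"
    using AE_neq_0
  proof (intro nn_integral_cong_AE, eventually_elim)
    fix x :: 'a assume "x \<noteq> 0"
    then show "(\<integral>\<^sup>+s. \<Phi> x * (ennreal (shell (norm x / s)) * ennreal (1 / \<bar>s\<bar>)) \<partial>lborel) = \<Phi> x * 1"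
      using haar_inverse[of "norm x" "\<lambda>t. ennreal (shell t)"]
      by (simp add: nn_integral_cmult haar_shell)
  qed
  finally show ?thesis by simp
qed

lemma
  fixes f :: "'a \<Rightarrow> 'c::{banach, second_countable_topology}"
  assumes [measurable]: "f \<in> borel_measurable borel"
  shows integrable_polar: "integrable \<tau> f \<longleftrightarrow> integrable (\<tau> \<Otimes>\<^sub>M lborel) (\<lambda>p. polar_weight p *\<^sub>R f (snd p *\<^sub>R fst p))"
    and integral_polar: "(\<integral>x. f x \<partial>\<tau>) = (\<integral>p. polar_weight p *\<^sub>R f (snd p *\<^sub>R fst p) \<partial>(\<tau> \<Otimes>\<^sub>M lborel))"
proof -
  show "integrable \<tau> f \<longleftrightarrow> integrable (\<tau> \<Otimes>\<^sub>M lborel) (\<lambda>p. polar_weight p *\<^sub>R f (snd p *\<^sub>R fst p))"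
    by (rule integrable_nn_integral_transfer[OF _ _ _ assms _ nn_integral_polar]) simp_all
  show "(\<integral>x. f x \<partial>\<tau>) = (\<integral>p. polar_weight p *\<^sub>R f (snd p *\<^sub>R fst p) \<partial>(\<tau> \<Otimes>\<^sub>M lborel))"
    by (rule integral_nn_integral_transfer[OF _ _ _ assms _ nn_integral_polar]) simp_all
qed

end

lemma homogeneous_measure_lborel: "homogeneous_measure (lborel :: 'a::euclidean_space measure) DIM('a)"
proof
  fix s :: real and \<Phi> :: "'a \<Rightarrow> ennreal"
  assume "s > 0" "\<Phi> \<in> borel_measurable borel"
  then show "ennreal (s ^ DIM('a)) * (\<integral>\<^sup>+x. \<Phi> (s *\<^sub>R x) \<partial>lborel) = (\<integral>\<^sup>+x. \<Phi> x \<partial>lborel)"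
    by (rule nn_integral_lborel_scale)
qed (auto simp: AE_lborel_singleton DIM_positive Suc_le_eq)

lemma homogeneous_measure_hyp_lborel:
  fixes \<xi> :: "'a::euclidean_space"
  assumes "norm \<xi> = 1" "DIM('a) \<ge> 2"
  shows "homogeneous_measure (hyp_lborel \<xi>) (DIM('a) - 1)"
proof -
  interpret sigma_finite_measure "hyp_lborel \<xi>" by (rule sigma_finite_hyp_lborel)
  show ?thesis
  proof
    fix s :: real and \<Phi> :: "'a \<Rightarrow> ennreal"
    assume "s > 0" "\<Phi> \<in> borel_measurable borel"
    with assms(1) show "ennreal (s ^ (DIM('a) - 1)) * (\<integral>\<^sup>+x. \<Phi> (s *\<^sub>R x) \<partial>hyp_lborel \<xi>) = (\<integral>\<^sup>+x. \<Phi> x \<partial>hyp_lborel \<xi>)"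
      by (rule nn_integral_hyp_scale)
  qed (use assms AE_hyp_neq_0[OF assms] in auto)
qed

section \<open>A weight integrable over the space and uniformly over all hyperplanes through the
  origin\<close>

definition decay_weight :: "'a::euclidean_space \<Rightarrow> real" where
  "decay_weight x = inverse ((1 + (norm x)\<^sup>2) ^ DIM('a))"

lemma decay_weight_pos [simp]: "0 < decay_weight x"
  by (simp add: decay_weight_def add_pos_nonneg)

lemma decay_weight_nonneg [simp]: "0 \<le> decay_weight x"
  by (rule less_imp_le) simp

lemma continuous_on_decay_weight: "continuous_on S (decay_weight :: 'a::euclidean_space \<Rightarrow> real)"
  unfolding decay_weight_def by (intro continuous_intros) (metis add_pos_nonneg less_irrefl power_eq_0_iff zero_le_power2 zero_less_one)

lemma borel_measurable_decay_weight [measurable]: "decay_weight \<in> borel_measurable borel"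
  unfolding decay_weight_def by measurable

lemma integrable_inverse_1_plus_square_lborel: "integrable lborel (\<lambda>s::real. inverse (1 + s\<^sup>2))"
  using integrable_inverse_1_plus_square by (simp add: set_integrable_def)

lemma (in pair_sigma_finite) integrable_fst_mult_snd:
  fixes f :: "'a \<Rightarrow> real" and g :: "'b \<Rightarrow> real"
  assumes f: "integrable M1 f" and g: "integrable M2 g"
  shows "integrable (M1 \<Otimes>\<^sub>M M2) (\<lambda>p. f (fst p) * g (snd p))"
proof (rule Fubini_integrable)
  have [measurable]: "f \<in> borel_measurable M1" "g \<in> borel_measurable M2"
    using f g by auto
  show "(\<lambda>p. f (fst p) * g (snd p)) \<in> borel_measurable (M1 \<Otimes>\<^sub>M M2)" by measurable
  show "integrable M1 (\<lambda>x. \<integral>y. norm (f (fst (x, y)) * g (snd (x, y))) \<partial>M2)"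
    using f by (simp add: abs_mult)
  show "AE x in M1. integrable M2 (\<lambda>y. f (fst (x, y)) * g (snd (x, y)))"
    using g by simp
qed

lemma integrable_indicator_cball: "integrable lborel (indicator (cball (c::'a::euclidean_space) r) :: 'a \<Rightarrow> real)"
  using emeasure_lborel_cball_finite[of c r] by (simp add: integrable_indicator_iff)

text \<open>In polar form only \<open>1 < norm x < 2\<close> contributes. There
  \<open>s ^ (DIM('a) - 1)\<close> uses up all but one of the \<open>DIM('a)\<close> factors
  \<open>1 + s\<^sup>2\<close> that the weight provides, and the remaining inverse is integrable on
  the line. The 4 bounds \<open>shell\<close>.\<close>

lemma integrable_decay_weight: "integrable lborel (decay_weight :: 'a::euclidean_space \<Rightarrow> real)"
proof -
  interpret homogeneous_measure "lborel :: 'a measure" "DIM('a)"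
    by (rule homogeneous_measure_lborel)
  have "integrable (lborel \<Otimes>\<^sub>M lborel) (\<lambda>p. (4 * indicator (cball (0::'a) 2) (fst p)) * inverse (1 + (snd p)\<^sup>2) :: real)"
    by (rule lborel_pair.integrable_fst_mult_snd)
      (auto intro: integrable_inverse_1_plus_square_lborel integrable_indicator_cball)
  then have "integrable (lborel \<Otimes>\<^sub>M lborel) (\<lambda>p. polar_weight p *\<^sub>R decay_weight (snd p *\<^sub>R fst p))"
  proof (rule Bochner_Integration.integrable_bound)
    show "(\<lambda>p. polar_weight p *\<^sub>R decay_weight (snd p *\<^sub>R fst p)) \<in> borel_measurable (lborel \<Otimes>\<^sub>M lborel)"
      by measurable
    have "norm (polar_weight (x, s) *\<^sub>R decay_weight (s *\<^sub>R x)) \<le>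
       norm ((4 * indicator (cball (0::'a) 2) x) * inverse (1 + s\<^sup>2))" for x :: 'a and s
    proof (cases "s > 0 \<and> 1 < norm x \<and> norm x < 2")
      case False
      then have "polar_weight (x, s) = 0" by (auto simp: polar_weight_def shell_eq_0 not_less)
      then show ?thesis by simp
    next
      case True
      let ?q = "1 + s\<^sup>2"
      have q: "?q > 0" by (simp add: add_pos_nonneg)
      have "s \<le> ?q"
        using sum_squares_bound[of s 1] True by (simp add: power2_eq_square)
      then have 1: "s ^ (DIM('a) - 1) \<le> ?q ^ (DIM('a) - 1)" using True by (intro power_mono) auto
      have "s\<^sup>2 * 1 \<le> s\<^sup>2 * (norm x)\<^sup>2" using True by (intro mult_left_mono) (auto simp: one_le_power)
      then have "?q \<le> 1 + (norm (s *\<^sub>R x))\<^sup>2" by (simp add: power_mult_distrib)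
      then have "decay_weight (s *\<^sub>R x) \<le> inverse (?q ^ DIM('a))"
        unfolding decay_weight_def using q by (intro le_imp_inverse_le power_mono) auto
      then have "s ^ (DIM('a) - 1) * shell (norm x) * decay_weight (s *\<^sub>R x) \<le> ?q ^ (DIM('a) - 1) * 4 * inverse (?q ^ DIM('a))"
        using 1 True q by (intro mult_mono shell_le) auto
      also have "\<dots> = 4 * inverse ?q"
      proof -
        have "?q ^ DIM('a) = ?q ^ (DIM('a) - 1) * ?q" by (simp flip: power_Suc2)
        then show ?thesis using q by (simp add: nonzero_inverse_mult_distrib)
      qed
      finally show ?thesis using True by (simp add: polar_weight_def)
    qed
    then show "AE p in lborel \<Otimes>\<^sub>M lborel. norm (polar_weight p *\<^sub>R decay_weight (snd p *\<^sub>R fst p)) \<le>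
       norm ((4 * indicator (cball (0::'a) 2) (fst p)) * inverse (1 + (snd p)\<^sup>2))"
      by (intro AE_I2) (metis prod.collapse)
  qed
  then show ?thesis by (subst integrable_polar) simp_all
qed

text \<open>Where the bump is nonzero, projection lowers the squared norm by at most 1, so
  \<open>1 + (norm z)\<^sup>2\<close> is at most twice the same expression at the projection. This
  gives \<open>2 ^ DIM('a)\<close>, and the last 2 bounds \<open>bump\<close>. One constant for all
  normals is what allows integration over the normals afterwards.\<close>

lemma nn_integral_hyp_decay_weight_bounded:
  obtains C where "0 \<le> C" "\<And>\<xi> :: 'a::euclidean_space. norm \<xi> = 1 \<Longrightarrow>
    (\<integral>\<^sup>+x. ennreal (decay_weight x) \<partial>hyp_lborel \<xi>) \<le> ennreal C"
proof (rule that[of "2 ^ DIM('a) * 2 * (\<integral>x. decay_weight (x::'a) \<partial>lborel)"])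
  show "0 \<le> 2 ^ DIM('a) * 2 * (\<integral>x. decay_weight (x::'a) \<partial>lborel)"
    by (simp add: integral_nonneg_AE)
  fix \<xi> :: 'a assume \<xi>: "norm \<xi> = 1"
  have aux: "1 + a \<le> 2 * (1 + p)" if "a = p + c" "c \<le> 1" "0 \<le> p" for a p c :: real
    using that by simp
  have le: "decay_weight (z - (z \<bullet> \<xi>) *\<^sub>R \<xi>) * bump (z \<bullet> \<xi>) \<le> (2 ^ DIM('a) * decay_weight z) * 2" for z
  proof (cases "0 < z \<bullet> \<xi> \<and> z \<bullet> \<xi> < 1")
    case True
    let ?p = "z - (z \<bullet> \<xi>) *\<^sub>R \<xi>"
    have "(norm z)\<^sup>2 = (norm ?p)\<^sup>2 + (z \<bullet> \<xi>)\<^sup>2"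
      using \<xi> unfolding power2_norm_eq_inner
      by (simp add: norm_eq_1 inner_diff_left inner_diff_right inner_commute power2_eq_square)
    moreover have "(z \<bullet> \<xi>)\<^sup>2 \<le> 1" using True by (simp add: power_le_one)
    moreover have "0 \<le> (norm ?p)\<^sup>2" by simp
    ultimately have "1 + (norm z)\<^sup>2 \<le> 2 * (1 + (norm ?p)\<^sup>2)"
      by (rule aux)
    then have "(1 + (norm z)\<^sup>2) ^ DIM('a) \<le> 2 ^ DIM('a) * (1 + (norm ?p)\<^sup>2) ^ DIM('a)"
      unfolding power_mult_distrib[symmetric] by (intro power_mono) auto
    then have "decay_weight ?p \<le> 2 ^ DIM('a) * decay_weight z"
      unfolding decay_weight_def by (simp add: field_simps add_pos_nonneg)
    then show ?thesis by (intro mult_mono bump_le) auto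
  next
    case False
    then have "bump (z \<bullet> \<xi>) = 0" by (intro bump_eq_0) auto
    then show ?thesis by simp
  qed
  have "(\<integral>\<^sup>+x. ennreal (decay_weight x) \<partial>hyp_lborel \<xi>) =
      (\<integral>\<^sup>+z. ennreal (decay_weight (z - (z \<bullet> \<xi>) *\<^sub>R \<xi>) * bump (z \<bullet> \<xi>)) \<partial>lborel)"
    by (subst nn_integral_hyp_bump[OF \<xi>]) (simp_all add: ennreal_mult)
  also have "\<dots> \<le> (\<integral>\<^sup>+z. ennreal ((2 ^ DIM('a) * decay_weight (z::'a)) * 2) \<partial>lborel)"
    by (intro nn_integral_mono ennreal_leI le)
  also have "\<dots> = ennreal (\<integral>z. (2 ^ DIM('a) * decay_weight z) * 2 \<partial>(lborel :: 'a measure))"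
    by (rule nn_integral_eq_integral) (auto intro: integrable_decay_weight)
  finally show "(\<integral>\<^sup>+x. ennreal (decay_weight x) \<partial>hyp_lborel \<xi>) \<le> ennreal (2 ^ DIM('a) * 2 * (\<integral>x. decay_weight (x::'a) \<partial>lborel))"
    by (simp add: mult_ac)
qed

section \<open>Fourier transforms of Schwartz functions\<close>

lemma schwartz_differentiable:
  assumes "schwartz \<phi>" "bs \<in> lists Basis"
  shows "iterated_partial bs \<phi> differentiable (at x)"
  using assms unfolding schwartz_def by blast

lemma schwartz_continuous:
  assumes "schwartz \<phi>" "bs \<in> lists Basis"
  shows "continuous_on UNIV (iterated_partial bs \<phi>)"
  by (intro continuous_at_imp_continuous_on ballI differentiable_imp_continuous_within schwartz_differentiable[OF assms])

text \<open>Two seminorms suffice, those with exponents \<open>0\<close> and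
  \<open>2 * DIM('a)\<close>, because
  \<open>(1 + r\<^sup>2) ^ n \<le> 2 ^ n * (1 + r ^ (2 * n))\<close>, which is checked separately
  for \<open>r \<le> 1\<close> and \<open>r > 1\<close>.\<close>

lemma schwartz_decay:
  fixes \<phi> :: "'a::euclidean_space \<Rightarrow> complex"
  assumes "schwartz \<phi>" "bs \<in> lists Basis"
  obtains C where "0 \<le> C" "\<And>x. norm (iterated_partial bs \<phi> x) \<le> C * decay_weight x"
proof -
  let ?\<psi> = "iterated_partial bs \<phi>" and ?n = "DIM('a)"
  obtain C0 C1 where C: "\<And>x. norm x ^ 0 * norm (?\<psi> x) \<le> C0" "\<And>x. norm x ^ (2 * ?n) * norm (?\<psi> x) \<le> C1"
    using assms unfolding schwartz_def by meson
  have "norm (?\<psi> x) \<le> (2 ^ ?n * (C0 + C1)) * decay_weight x" for x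
  proof -
    have "(1 + (norm x)\<^sup>2) ^ ?n \<le> 2 ^ ?n * (1 + norm x ^ (2 * ?n))"
    proof (cases "norm x \<le> 1")
      case True
      then have "(norm x)\<^sup>2 \<le> 1" by (simp add: power_le_one)
      then have "(1 + (norm x)\<^sup>2) ^ ?n \<le> 2 ^ ?n" by (intro power_mono) auto
      also have "\<dots> \<le> 2 ^ ?n * (1 + norm x ^ (2 * ?n))" by simp
      finally show ?thesis .
    next
      case False
      then have "1 + (norm x)\<^sup>2 \<le> 2 * (norm x)\<^sup>2" by (simp add: one_le_power)
      then have "(1 + (norm x)\<^sup>2) ^ ?n \<le> (2 * (norm x)\<^sup>2) ^ ?n" by (intro power_mono) auto
      also have "\<dots> \<le> 2 ^ ?n * (1 + norm x ^ (2 * ?n))"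
        by (simp add: power_mult_distrib power_mult)
      finally show ?thesis .
    qed
    then have "norm (?\<psi> x) * (1 + (norm x)\<^sup>2) ^ ?n \<le> norm (?\<psi> x) * (2 ^ ?n * (1 + norm x ^ (2 * ?n)))"
      by (intro mult_left_mono) auto
    also have "\<dots> = 2 ^ ?n * (norm x ^ 0 * norm (?\<psi> x) + norm x ^ (2 * ?n) * norm (?\<psi> x))"
      by (simp add: algebra_simps)
    also have "\<dots> \<le> 2 ^ ?n * (C0 + C1)"
      using C[of x] by (intro mult_left_mono add_mono) auto
    finally show ?thesis
      by (simp add: decay_weight_def field_simps add_pos_nonneg)
  qed
  moreover have "0 \<le> 2 ^ ?n * (C0 + C1)"
  proof -
    have "0 \<le> C0" "0 \<le> C1"
      by (rule order_trans[OF _ C(1)[of 0]], simp) (rule order_trans[OF _ C(2)[of 0]], simp)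
    then show ?thesis by simp
  qed
  ultimately show ?thesis using that by blast
qed

lemma integrable_decay_bound:
  fixes u :: "'a::euclidean_space \<Rightarrow> 'c::{banach, second_countable_topology}"
  assumes "u \<in> borel_measurable borel" "\<And>x. norm (u x) \<le> C * decay_weight x"
  shows "integrable lborel u"
proof (rule Bochner_Integration.integrable_bound)
  show "integrable lborel (\<lambda>x. C * decay_weight x :: real)"
    by (intro integrable_mult_right integrable_decay_weight)
  show "AE x in lborel. norm (u x) \<le> norm (C * decay_weight x)"
    using assms(2) by (intro AE_I2) (metis abs_ge_self order_trans real_norm_def)
qed (use assms in simp)

lemma norm_exp_i [simp]: "norm (exp (- (\<i> * complex_of_real t))) = 1"
  using norm_exp_i_times[of "- t"] by simp

lemma borel_measurable_fourier:
  fixes \<phi> :: "'a::euclidean_space \<Rightarrow> complex"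
  assumes [measurable]: "\<phi> \<in> borel_measurable borel"
  shows "fourier \<phi> \<in> borel_measurable borel"
  unfolding fourier_def[abs_def] by measurable

lemma norm_fourier_le: "norm (fourier \<phi> \<xi>) \<le> (\<integral>x. norm (\<phi> x) \<partial>lborel)"
proof -
  have "norm (fourier \<phi> \<xi>) \<le> (\<integral>x. norm (\<phi> x * exp (- \<i> * of_real (x \<bullet> \<xi>))) \<partial>lborel)"
    unfolding fourier_def by (rule integral_norm_bound)
  then show ?thesis by (simp add: norm_mult)
qed

lemma decay_weight_le_inverse: "decay_weight (x::'a::euclidean_space) \<le> inverse (1 + (norm x)\<^sup>2)"
proof -
  have "(1 + (norm x)\<^sup>2) ^ 1 \<le> (1 + (norm x)\<^sup>2) ^ DIM('a)"
    by (rule power_increasing) (auto simp: Suc_le_eq)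
  then show ?thesis unfolding decay_weight_def
    by (intro le_imp_inverse_le) (auto simp: add_pos_nonneg)
qed

lemma integral_deriv_eq_0:
  fixes q q' :: "real \<Rightarrow> complex"
  assumes q: "\<And>t. (q has_vector_derivative q' t) (at t)" and q': "continuous_on UNIV q'" "integrable lborel q'"
    and bound: "\<And>t. norm (q t) \<le> C * inverse (1 + t\<^sup>2)"
  shows "(\<integral>t. q' t \<partial>lborel) = 0"
proof -
  have "((\<lambda>t::real. C * inverse (1 + t\<^sup>2)) \<longlongrightarrow> 0) at_top" "((\<lambda>t::real. C * inverse (1 + t\<^sup>2)) \<longlongrightarrow> 0) at_bot"
    by real_asymp+
  then have "(q \<longlongrightarrow> 0) at_top" "(q \<longlongrightarrow> 0) at_bot"
    using bound by (auto intro: Lim_null_comparison[where g="\<lambda>t. C * inverse (1 + t\<^sup>2)"])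
  then have lim: "((q \<circ> real_of_ereal) \<longlongrightarrow> 0) (at_left \<infinity>)" "((q \<circ> real_of_ereal) \<longlongrightarrow> 0) (at_right (-\<infinity>))"
    by (simp_all add: ereal_tendsto_simps)
  have "(LBINT t=-\<infinity>..\<infinity>. q' t) = 0 - 0"
    by (rule interval_integral_FTC_integrable[where F=q])
       (use lim q q' in \<open>auto simp: set_integrable_def continuous_on_eq_continuous_at\<close>)
  then show ?thesis
    by (simp add: interval_lebesgue_integral_def set_lebesgue_integral_def)
qed

text \<open>This is integration by parts in the direction \<open>b\<close>: on each line parallel to
  \<open>b\<close> the function \<open>q'\<close> below is the derivative of \<open>u * e\<close>,
  which tends to 0 at both ends, and Fubini collects the lines.\<close>

lemma fourier_partial:
  fixes u :: "'a::euclidean_space \<Rightarrow> complex"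
  assumes b: "norm b = 1" and diff: "\<And>x. u differentiable (at x)"
    and D: "D = (\<lambda>x. frechet_derivative u (at x) b)" and contD: "continuous_on UNIV D"
    and uC: "\<And>x. norm (u x) \<le> C * decay_weight x" and DC: "\<And>x. norm (D x) \<le> C' * decay_weight x"
  shows "fourier D \<xi> = \<i> * of_real (\<xi> \<bullet> b) * fourier u \<xi>"
proof -
  define e where "e x = exp (- \<i> * complex_of_real (x \<bullet> \<xi>))" for x
  have contu: "continuous_on UNIV u"
    using diff by (intro continuous_at_imp_continuous_on ballI differentiable_imp_continuous_within)
  have [measurable]: "u \<in> borel_measurable borel" "D \<in> borel_measurable borel" "e \<in> borel_measurable borel"
    using contu contD unfolding e_def by (auto intro: borel_measurable_continuous_onI)
  have norm_e[simp]: "norm (e x) = 1" for x by (simp add: e_def)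
  define q' where "q' x = D x * e x - \<i> * of_real (\<xi> \<bullet> b) * (u x * e x)" for x
  have [measurable]: "q' \<in> borel_measurable borel" unfolding q'_def by measurable
  have int: "integrable lborel (\<lambda>x. D x * e x)" "integrable lborel (\<lambda>x. u x * e x)"
    by (rule integrable_decay_bound[of _ C'] integrable_decay_bound[of _ C]; use uC DC in \<open>auto simp: norm_mult\<close>)+
  have intq': "integrable lborel q'" unfolding q'_def using int by auto
  interpret X: sigma_finite_measure "hyp_lborel b" by (rule sigma_finite_hyp_lborel)
  interpret X: pair_sigma_finite "hyp_lborel b" "lborel :: real measure" ..
  have intp: "integrable (hyp_lborel b \<Otimes>\<^sub>M lborel) (\<lambda>p. q' (fst p + snd p *\<^sub>R b))"
    using intq' by (subst integrable_lborel_slices[OF b, symmetric]) auto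
  have "(\<integral>x. q' x \<partial>lborel) = (\<integral>y. (\<integral>t. q' (y + t *\<^sub>R b) \<partial>lborel) \<partial>hyp_lborel b)"
    using X.integral_fst'[OF intp] by (subst integral_lborel_slices[OF b]) auto
  also have "\<dots> = (\<integral>y. 0 \<partial>hyp_lborel b)"
  proof (rule integral_cong_AE)
    show "AE y in hyp_lborel b. (\<integral>t. q' (y + t *\<^sub>R b) \<partial>lborel) = 0"
      using AE_hyp_lborel[of b] X.AE_integrable_fst'[OF intp]
    proof eventually_elim
      case (elim y)
      show ?case
      proof (rule integral_deriv_eq_0[where q="\<lambda>t. u (y + t *\<^sub>R b) * e (y + t *\<^sub>R b)" and C="\<bar>C\<bar>"])
        show "integrable lborel (\<lambda>t. q' (y + t *\<^sub>R b))" using elim by simp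
        show "continuous_on UNIV (\<lambda>t. q' (y + t *\<^sub>R b))"
          unfolding q'_def e_def
          by (intro continuous_intros continuous_on_compose2[OF contu] continuous_on_compose2[OF contD]) auto
        fix t :: real
        have du: "(u has_derivative frechet_derivative u (at (y + t *\<^sub>R b))) (at (y + t *\<^sub>R b))"
          using diff by (simp add: frechet_derivative_works)
        have line: "((\<lambda>t. y + t *\<^sub>R b) has_derivative (\<lambda>h. h *\<^sub>R b)) (at t)"
          by (auto intro!: derivative_eq_intros)
        have lin: "linear (frechet_derivative u (at (y + t *\<^sub>R b)))"
          using du by (rule has_derivative_linear)
        have "((\<lambda>t. u (y + t *\<^sub>R b)) has_derivative (\<lambda>h. frechet_derivative u (at (y + t *\<^sub>R b)) (h *\<^sub>R b))) (at t)"
          by (rule has_derivative_compose[OF line, of u]) (rule du)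
        then have 1: "((\<lambda>t. u (y + t *\<^sub>R b)) has_vector_derivative D (y + t *\<^sub>R b)) (at t)"
          by (simp add: has_vector_derivative_def D linear_cmul[OF lin])
        have 2: "((\<lambda>t. e (y + t *\<^sub>R b)) has_vector_derivative (- \<i> * of_real (\<xi> \<bullet> b)) * e (y + t *\<^sub>R b)) (at t)"
        proof -
          have "((\<lambda>z. exp (- \<i> * (complex_of_real (y \<bullet> \<xi>) + z * complex_of_real (b \<bullet> \<xi>)))) has_field_derivative
              (- \<i> * of_real (\<xi> \<bullet> b)) * e (y + t *\<^sub>R b)) (at (of_real t))"
            by (auto intro!: derivative_eq_intros simp: e_def inner_add_left inner_commute algebra_simps)
          from has_vector_derivative_real_field[OF this] show ?thesis
            by (simp add: e_def inner_add_left)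
        qed
        show "((\<lambda>t. u (y + t *\<^sub>R b) * e (y + t *\<^sub>R b)) has_vector_derivative q' (y + t *\<^sub>R b)) (at t)"
          using has_vector_derivative_mult[OF 1 2] by (simp add: q'_def algebra_simps)
        \<comment> \<open>As \<open>y\<close> is orthogonal to \<open>b\<close>, moving by
          \<open>t *\<^sub>R b\<close> puts the point at norm at least \<open>\<bar>t\<bar>\<close>;
          decay in space thus becomes decay along the line.\<close>
        have "(norm (y + t *\<^sub>R b))\<^sup>2 = (norm y)\<^sup>2 + t\<^sup>2"
          using elim(1) b unfolding power2_norm_eq_inner
          by (simp add: inner_add_left inner_add_right norm_eq_1 inner_commute power2_eq_square)
        then have "inverse (1 + (norm (y + t *\<^sub>R b))\<^sup>2) \<le> inverse (1 + t\<^sup>2)"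
          by (intro le_imp_inverse_le) (auto simp: add_pos_nonneg)
        then have w: "decay_weight (y + t *\<^sub>R b) \<le> inverse (1 + t\<^sup>2)"
          using decay_weight_le_inverse[of "y + t *\<^sub>R b"] by simp
        have "norm (u (y + t *\<^sub>R b)) \<le> C * decay_weight (y + t *\<^sub>R b)" by (rule uC)
        also have "\<dots> \<le> \<bar>C\<bar> * inverse (1 + t\<^sup>2)" using w by (intro mult_mono) auto
        finally show "norm (u (y + t *\<^sub>R b) * e (y + t *\<^sub>R b)) \<le> \<bar>C\<bar> * inverse (1 + t\<^sup>2)"
          by (simp add: norm_mult)
      qed
    qed
  qed (auto intro: borel_measurable_integrable[OF X.integrable_fst'[OF intp], simplified])
  finally have "(\<integral>x. q' x \<partial>lborel) = 0" by simp
  then have "(\<integral>x. D x * e x \<partial>lborel) = \<i> * of_real (\<xi> \<bullet> b) * (\<integral>x. u x * e x \<partial>lborel)"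
    unfolding q'_def using int by (simp add: Bochner_Integration.integral_diff)
  then show ?thesis by (simp add: fourier_def e_def)
qed

text \<open>A second partial multiplies the transform by
  \<open>- (\<xi> \<bullet> b)\<^sup>2\<close>, and the norms summed over the basis produce
  \<open>(norm \<xi>)\<^sup>2\<close>. Quadratic decay makes the transform integrable along every
  line through the origin, as inversion requires.\<close>

lemma schwartz_fourier_decay:
  fixes \<phi> :: "'a::euclidean_space \<Rightarrow> complex"
  assumes \<phi>: "schwartz \<phi>"
  obtains C where "0 \<le> C" "\<And>\<xi>. norm (fourier \<phi> \<xi>) \<le> C * inverse (1 + (norm \<xi>)\<^sup>2)"
proof -
  have second: "fourier (iterated_partial [b, b] \<phi>) \<xi> = - of_real ((\<xi> \<bullet> b)\<^sup>2) * fourier \<phi> \<xi>"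
    if b: "b \<in> Basis" for b \<xi>
  proof -
    have step: "fourier (iterated_partial (b # bs) \<phi>) \<xi> = \<i> * of_real (\<xi> \<bullet> b) * fourier (iterated_partial bs \<phi>) \<xi>"
      if bs: "bs \<in> lists Basis" for bs
    proof -
      have bbs: "b # bs \<in> lists Basis" using b bs by simp
      obtain C C' where "\<And>x. norm (iterated_partial bs \<phi> x) \<le> C * decay_weight x"
        "\<And>x. norm (iterated_partial (b # bs) \<phi> x) \<le> C' * decay_weight x"
        using schwartz_decay[OF \<phi> bs] schwartz_decay[OF \<phi> bbs] by metis
      then show ?thesis
        using b schwartz_differentiable[OF \<phi> bs] schwartz_continuous[OF \<phi> bbs]
        by (intro fourier_partial) auto
    qed
    have alg: "\<i> * r * (\<i> * r * z) = - (r * r) * z" for r z :: complex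
      by (simp add: algebra_simps)
    show ?thesis
      using step[of "[b]"] step[of "[]"] b alg[of "of_real (\<xi> \<bullet> b)"] by (simp add: power2_eq_square)
  qed
  define C where "C = (\<integral>x. norm (\<phi> x) \<partial>lborel) + (\<Sum>b\<in>Basis. \<integral>x. norm (iterated_partial [b, b] \<phi> x) \<partial>lborel)"
  have "norm (fourier \<phi> \<xi>) \<le> C * inverse (1 + (norm \<xi>)\<^sup>2)" for \<xi>
  proof -
    have "(\<Sum>b\<in>Basis. (\<xi> \<bullet> b)\<^sup>2 * norm (fourier \<phi> \<xi>)) = (\<Sum>b\<in>Basis. norm (fourier (iterated_partial [b, b] \<phi>) \<xi>))"
      by (intro sum.cong refl) (simp only: second norm_mult norm_minus_cancel norm_of_real abs_power2)
    also have "\<dots> \<le> (\<Sum>b\<in>Basis. \<integral>x. norm (iterated_partial [b, b] \<phi> x) \<partial>lborel)"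
      by (intro sum_mono norm_fourier_le)
    finally have "(norm \<xi>)\<^sup>2 * norm (fourier \<phi> \<xi>) \<le> (\<Sum>b\<in>Basis. \<integral>x. norm (iterated_partial [b, b] \<phi> x) \<partial>lborel)"
      by (simp only: sum_distrib_right[symmetric] power2_norm_eq_inner euclidean_inner[of \<xi> \<xi>] power2_eq_square[symmetric])
    then have "(1 + (norm \<xi>)\<^sup>2) * norm (fourier \<phi> \<xi>) \<le> C"
      using norm_fourier_le[of \<phi> \<xi>] unfolding C_def distrib_right by linarith
    then show ?thesis by (simp add: field_simps add_pos_nonneg)
  qed
  moreover have "0 \<le> C" unfolding C_def by (intro add_nonneg_nonneg sum_nonneg integral_nonneg_AE) auto
  ultimately show ?thesis using that by blast
qed

text \<open>Inversion by Gaussian summation: insert the normal density at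
  \<open>\<epsilon> * s\<close>, move the transform onto it by Fubini, and let
  \<open>\<epsilon>\<close> tend to 0 on both sides. One factor sqrt(2 pi) comes from the transform
  of the density, the other from its value at 0.\<close>

lemma fourier_inversion_at_0:
  fixes F :: "real \<Rightarrow> complex"
  assumes F: "integrable lborel F" and B: "\<And>t. norm (F t) \<le> B" and cont: "isCont F 0"
    and Fhat: "integrable lborel (\<lambda>s. \<integral>t. F t * exp (- \<i> * of_real (s * t)) \<partial>lborel)"
  shows "(\<integral>s. (\<integral>t. F t * exp (- \<i> * of_real (s * t)) \<partial>lborel) \<partial>lborel) = 2 * pi * F 0"
proof -
  define Fh where "Fh s = (\<integral>t. F t * exp (- \<i> * of_real (s * t)) \<partial>lborel)" for s
  let ?N = "std_normal_density"
  have [measurable]: "F \<in> borel_measurable borel" using F by auto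
  have [measurable]: "Fh \<in> borel_measurable borel" unfolding Fh_def by measurable
  have char: "(\<integral>s. exp (- \<i> * of_real (s * t)) * of_real (?N s) \<partial>lborel) = of_real (exp (- t\<^sup>2 / 2))" for t
    using char_std_normal_distribution[THEN fun_cong, of "- t"]
    by (simp add: char_def integral_density scaleR_conv_of_real mult_ac)
  have approx: "(\<integral>s. Fh s * of_real (?N (\<epsilon> * s)) \<partial>lborel) = sqrt (2 * pi) * (\<integral>u. F (\<epsilon> * u) * of_real (?N u) \<partial>lborel)"
    if \<epsilon>: "\<epsilon> > 0" for \<epsilon>
  proof -
    have intN: "integrable lborel (\<lambda>s. ?N (\<epsilon> * s))"
      using lborel_integrable_real_affine[of ?N \<epsilon> 0] \<epsilon> by simp
    have "integrable (lborel \<Otimes>\<^sub>M lborel) (\<lambda>p. norm (F (fst p)) * ?N (\<epsilon> * snd p))"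
      by (rule lborel_pair.integrable_fst_mult_snd[of "\<lambda>t. norm (F t)"]) (use F intN in auto)
    then have int: "integrable (lborel \<Otimes>\<^sub>M lborel) (\<lambda>(t, s). F t * exp (- \<i> * of_real (s * t)) * of_real (?N (\<epsilon> * s)))"
      by (rule Bochner_Integration.integrable_bound) (auto simp: norm_mult)
    have "(\<integral>s. Fh s * of_real (?N (\<epsilon> * s)) \<partial>lborel) =
        (\<integral>s. (\<integral>t. F t * exp (- \<i> * of_real (s * t)) * of_real (?N (\<epsilon> * s)) \<partial>lborel) \<partial>lborel)"
      unfolding Fh_def by simp
    also have "\<dots> = (\<integral>t. (\<integral>s. F t * exp (- \<i> * of_real (s * t)) * of_real (?N (\<epsilon> * s)) \<partial>lborel) \<partial>lborel)"
      by (rule lborel_pair.Fubini_integral[OF int])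
    also have "\<dots> = (\<integral>t. F t * (\<integral>s. exp (- \<i> * of_real (s * t)) * of_real (?N (\<epsilon> * s)) \<partial>lborel) \<partial>lborel)"
      by (simp add: mult.assoc)
    also have "\<dots> = (\<integral>t. F t * of_real ((1 / \<epsilon>) * exp (- (t / \<epsilon>)\<^sup>2 / 2)) \<partial>lborel)"
    proof -
      have "(\<integral>s. exp (- \<i> * of_real (s * t)) * of_real (?N (\<epsilon> * s)) \<partial>lborel) = of_real ((1 / \<epsilon>) * exp (- (t / \<epsilon>)\<^sup>2 / 2))" for t
        using lborel_integral_real_affine[of "1 / \<epsilon>" "\<lambda>s. exp (- \<i> * of_real (s * t)) * complex_of_real (?N (\<epsilon> * s))" 0]
          char[of "t / \<epsilon>"] \<epsilon>
        by (simp add: scaleR_conv_of_real)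
      then show ?thesis by simp
    qed
    also have "\<dots> = (\<integral>u. F (\<epsilon> * u) * of_real (exp (- u\<^sup>2 / 2)) \<partial>lborel)"
      using lborel_integral_real_affine[of \<epsilon> "\<lambda>t. F t * of_real ((1 / \<epsilon>) * exp (- (t / \<epsilon>)\<^sup>2 / 2))" 0] \<epsilon>
      by (simp add: scaleR_conv_of_real)
    also have "\<dots> = sqrt (2 * pi) * (\<integral>u. F (\<epsilon> * u) * of_real (?N u) \<partial>lborel)"
    proof -
      have "exp (- u\<^sup>2 / 2) = sqrt (2 * pi) * ?N u" for u :: real
        by (simp add: std_normal_density_def)
      then show ?thesis
        by (simp add: mult.left_commute flip: integral_mult_right_zero)
    qed
    finally show ?thesis .
  qed
  define \<epsilon> where "\<epsilon> k = inverse (real (Suc k))" for k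
  have \<epsilon>: "\<epsilon> k > 0" for k by (simp add: \<epsilon>_def)
  have \<epsilon>0: "\<epsilon> \<longlonglongrightarrow> 0" unfolding \<epsilon>_def by (rule LIMSEQ_inverse_real_of_nat)
  have "(\<lambda>k. \<integral>s. Fh s * of_real (?N (\<epsilon> k * s)) \<partial>lborel) \<longlonglongrightarrow> (\<integral>s. Fh s * of_real (?N 0) \<partial>lborel)"
  proof (rule integral_dominated_convergence[where w="\<lambda>s. norm (Fh s) * 1"])
    show "integrable lborel (\<lambda>s. norm (Fh s) * 1)" using Fhat by (simp add: Fh_def)
    have le: "?N x \<le> 1" for x
    proof -
      have "?N x \<le> 1 / sqrt (2 * pi) * 1"
        unfolding std_normal_density_def by (intro mult_left_mono) auto
      also have "\<dots> \<le> 1" using pi_gt3 by simp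
      finally show ?thesis .
    qed
    show "AE s in lborel. norm (Fh s * of_real (?N (\<epsilon> k * s))) \<le> norm (Fh s) * 1" for k
      by (intro AE_I2) (simp only: norm_mult norm_of_real abs_of_nonneg[OF normal_density_nonneg] mult_left_mono[OF le norm_ge_zero])
    have "(\<lambda>k. ?N (\<epsilon> k * s)) \<longlonglongrightarrow> ?N (0 * s)" for s
      unfolding std_normal_density_def by (intro tendsto_intros \<epsilon>0) auto
    then show "AE s in lborel. (\<lambda>k. Fh s * of_real (?N (\<epsilon> k * s))) \<longlonglongrightarrow> Fh s * of_real (?N 0)"
      by (intro AE_I2 tendsto_intros) simp
  qed auto
  moreover have "(\<lambda>k. \<integral>u. F (\<epsilon> k * u) * of_real (?N u) \<partial>lborel) \<longlonglongrightarrow> (\<integral>u. F 0 * of_real (?N u) \<partial>lborel)"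
  proof (rule integral_dominated_convergence[where w="\<lambda>u. B * ?N u"])
    show "AE u in lborel. norm (F (\<epsilon> k * u) * of_real (?N u)) \<le> B * ?N u" for k
      by (intro AE_I2) (auto simp: norm_mult intro!: mult_right_mono B)
    have "(\<lambda>k. F (\<epsilon> k * u)) \<longlonglongrightarrow> F 0" for u
      by (rule isCont_tendsto_compose[OF cont]) (use tendsto_mult[OF \<epsilon>0 tendsto_const, of u] in simp)
    then show "AE u in lborel. (\<lambda>k. F (\<epsilon> k * u) * of_real (?N u)) \<longlonglongrightarrow> F 0 * of_real (?N u)"
      by (intro AE_I2 tendsto_intros) simp
  qed auto
  then have "(\<lambda>k. sqrt (2 * pi) * (\<integral>u. F (\<epsilon> k * u) * of_real (?N u) \<partial>lborel)) \<longlonglongrightarrow>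
      sqrt (2 * pi) * (\<integral>u. F 0 * of_real (?N u) \<partial>lborel)"
    by (intro tendsto_intros)
  ultimately have "(\<integral>s. Fh s * of_real (?N 0) \<partial>lborel) = sqrt (2 * pi) * (\<integral>u. F 0 * of_real (?N u) \<partial>lborel)"
    unfolding approx[OF \<epsilon>] by (rule LIMSEQ_unique)
  moreover have N0: "?N 0 = 1 / sqrt (2 * pi)" by (simp add: std_normal_density_def)
  ultimately have "(\<integral>s. Fh s \<partial>lborel) * of_real (1 / sqrt (2 * pi)) = sqrt (2 * pi) * F 0"
    by (simp add: N0)
  then have "(\<integral>s. Fh s \<partial>lborel) = of_real (sqrt (2 * pi) * sqrt (2 * pi)) * F 0"
    by (simp add: field_simps del: real_sqrt_mult_self)
  then show ?thesis unfolding real_sqrt_mult_self Fh_def by simp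
qed

text \<open>The Fourier slice theorem: along the line through \<open>\<xi>\<close> the transform is
  the one-dimensional transform of \<open>F\<close>, where \<open>F t\<close> integrates
  \<open>\<phi>\<close> over the parallel hyperplane at height \<open>t\<close>. Inversion at 0
  returns the central hyperplane.\<close>

lemma integral_fourier_line:
  fixes \<phi> :: "'a::euclidean_space \<Rightarrow> complex"
  assumes \<phi>: "schwartz \<phi>" and \<xi>: "norm \<xi> = 1"
  shows "(\<integral>s. fourier \<phi> (s *\<^sub>R \<xi>) \<partial>lborel) = 2 * pi * (\<integral>x. \<phi> x \<partial>hyp_lborel \<xi>)"
proof -
  have cont: "continuous_on UNIV \<phi>" using schwartz_continuous[OF \<phi>, of "[]"] by simp
  then have [measurable]: "\<phi> \<in> borel_measurable borel" by (rule borel_measurable_continuous_onI)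
  obtain C where C0: "0 \<le> C" and C: "\<And>x. norm (\<phi> x) \<le> C * decay_weight x"
    using schwartz_decay[OF \<phi>, of "[]"] by auto
  have int\<phi>: "integrable lborel \<phi>" by (rule integrable_decay_bound[OF _ C]) measurable
  interpret X: sigma_finite_measure "hyp_lborel \<xi>" by (rule sigma_finite_hyp_lborel)
  interpret X: pair_sigma_finite "hyp_lborel \<xi>" "lborel :: real measure" ..
  define F where "F t = (\<integral>y. \<phi> (y + t *\<^sub>R \<xi>) \<partial>hyp_lborel \<xi>)" for t
  obtain B where B0: "0 \<le> B" and B: "(\<integral>\<^sup>+x. ennreal (decay_weight x) \<partial>hyp_lborel \<xi>) \<le> ennreal B"
    using nn_integral_hyp_decay_weight_bounded[where 'a='a] \<xi> by metis
  have intW: "integrable (hyp_lborel \<xi>) decay_weight"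
    using B by (intro integrableI_bounded) (auto simp: le_less_trans[OF B])
  \<comment> \<open>The majorant does not depend on \<open>t\<close>, because adding a multiple of
    \<open>\<xi>\<close> to a point of the hyperplane cannot decrease its norm. It yields both the
    bound on \<open>F\<close> and, by dominated convergence, its continuity at 0.\<close>
  have dom: "AE y in hyp_lborel \<xi>. norm (\<phi> (y + t *\<^sub>R \<xi>)) \<le> C * decay_weight y" for t
    using AE_hyp_lborel[of \<xi>]
  proof eventually_elim
    case (elim y)
    have "(norm (y + t *\<^sub>R \<xi>))\<^sup>2 = (norm y)\<^sup>2 + t\<^sup>2"
      using elim(1) \<xi> unfolding power2_norm_eq_inner
      by (simp add: inner_add_left inner_add_right norm_eq_1 inner_commute power2_eq_square)
    then have "decay_weight (y + t *\<^sub>R \<xi>) \<le> decay_weight y"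
      unfolding decay_weight_def by (intro le_imp_inverse_le power_mono) (auto simp: add_pos_nonneg)
    then show ?case
      by (intro order_trans[OF C]) (rule mult_left_mono[OF _ C0])
  qed
  have Fbound: "norm (F t) \<le> (\<integral>y. C * decay_weight y \<partial>hyp_lborel \<xi>)" for t
  proof -
    have "norm (F t) \<le> (\<integral>y. norm (\<phi> (y + t *\<^sub>R \<xi>)) \<partial>hyp_lborel \<xi>)"
      unfolding F_def by (rule integral_norm_bound)
    also have "\<dots> \<le> (\<integral>y. C * decay_weight y \<partial>hyp_lborel \<xi>)"
      using dom[of t] intW C0 by (intro integral_mono_AE') auto
    finally show ?thesis .
  qed
  have contF: "isCont F 0"
    unfolding continuous_at_sequentially
  proof (intro allI impI)
    fix X :: "nat \<Rightarrow> real" assume X: "X \<longlonglongrightarrow> 0"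
    show "(F \<circ> X) \<longlonglongrightarrow> F 0"
      unfolding F_def o_def
    proof (rule integral_dominated_convergence[where w="\<lambda>y. C * decay_weight y"])
      show "integrable (hyp_lborel \<xi>) (\<lambda>y. C * decay_weight y)" using intW by simp
      show "AE y in hyp_lborel \<xi>. norm (\<phi> (y + X k *\<^sub>R \<xi>)) \<le> C * decay_weight y" for k
        by (rule dom)
      show "AE y in hyp_lborel \<xi>. (\<lambda>k. \<phi> (y + X k *\<^sub>R \<xi>)) \<longlonglongrightarrow> \<phi> (y + 0 *\<^sub>R \<xi>)"
        using X by (intro AE_I2 continuous_on_tendsto_compose[OF cont] tendsto_intros) auto
    qed auto
  qed
  have "integrable (hyp_lborel \<xi> \<Otimes>\<^sub>M lborel) (\<lambda>p. \<phi> (fst p + snd p *\<^sub>R \<xi>))"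
    using int\<phi> by (subst integrable_lborel_slices[OF \<xi>, symmetric]) auto
  then have intF: "integrable lborel F"
    unfolding F_def by (intro X.integrable_snd) (simp add: split_beta')
  have slice: "fourier \<phi> (s *\<^sub>R \<xi>) = (\<integral>t. F t * exp (- \<i> * of_real (s * t)) \<partial>lborel)" for s
  proof -
    define k where "k x = \<phi> x * exp (- \<i> * of_real (x \<bullet> (s *\<^sub>R \<xi>)))" for x
    have [measurable]: "k \<in> borel_measurable borel" unfolding k_def by measurable
    have "integrable lborel k"
      by (rule integrable_decay_bound[of _ C]) (use C in \<open>auto simp: k_def norm_mult\<close>)
    then have "integrable (hyp_lborel \<xi> \<Otimes>\<^sub>M lborel) (\<lambda>p. k (fst p + snd p *\<^sub>R \<xi>))"
      by (subst integrable_lborel_slices[OF \<xi>, symmetric]) auto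
    then have kp: "integrable (hyp_lborel \<xi> \<Otimes>\<^sub>M lborel) (\<lambda>(y, t). k (y + t *\<^sub>R \<xi>))"
      by (simp add: split_beta')
    have "fourier \<phi> (s *\<^sub>R \<xi>) = (\<integral>x. k x \<partial>lborel)" by (simp add: fourier_def k_def)
    also have "\<dots> = (\<integral>t. (\<integral>y. k (y + t *\<^sub>R \<xi>) \<partial>hyp_lborel \<xi>) \<partial>lborel)"
      unfolding X.integral_snd[OF kp] by (subst integral_lborel_slices[OF \<xi>]) (auto simp: split_beta')
    also have "(\<lambda>t. \<integral>y. k (y + t *\<^sub>R \<xi>) \<partial>hyp_lborel \<xi>) = (\<lambda>t. F t * exp (- \<i> * of_real (s * t)))"
    proof
      fix t
      have "(\<integral>y. k (y + t *\<^sub>R \<xi>) \<partial>hyp_lborel \<xi>) = (\<integral>y. \<phi> (y + t *\<^sub>R \<xi>) * exp (- \<i> * of_real (s * t)) \<partial>hyp_lborel \<xi>)"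
      proof (rule integral_cong_AE)
        show "AE y in hyp_lborel \<xi>. k (y + t *\<^sub>R \<xi>) = \<phi> (y + t *\<^sub>R \<xi>) * exp (- \<i> * of_real (s * t))"
          using AE_hyp_lborel[of \<xi>]
          by eventually_elim (use \<xi> in \<open>simp add: k_def inner_add_left norm_eq_1\<close>)
      qed auto
      then show "(\<integral>y. k (y + t *\<^sub>R \<xi>) \<partial>hyp_lborel \<xi>) = F t * exp (- \<i> * of_real (s * t))"
        by (simp add: F_def)
    qed
    finally show ?thesis .
  qed
  obtain C' where C': "\<And>x. norm (fourier \<phi> x) \<le> C' * inverse (1 + (norm x)\<^sup>2)"
    using schwartz_fourier_decay[OF \<phi>] by metis
  have [measurable]: "fourier \<phi> \<in> borel_measurable borel" by (rule borel_measurable_fourier) measurable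
  have "integrable lborel (\<lambda>s. fourier \<phi> (s *\<^sub>R \<xi>))"
    by (rule Bochner_Integration.integrable_bound[of _ "\<lambda>s. C' * inverse (1 + s\<^sup>2)"])
       (auto intro!: AE_I2 order_trans[OF C'] simp: \<xi> integrable_inverse_1_plus_square_lborel)
  then have "(\<integral>s. fourier \<phi> (s *\<^sub>R \<xi>) \<partial>lborel) = 2 * pi * F 0"
    unfolding slice by (rule fourier_inversion_at_0[OF intF Fbound contF])
  then show ?thesis by (simp add: F_def)
qed

section \<open>Radial integrals of star-shaped bodies\<close>

lemma star_body_zero_mem: "star_body K \<Longrightarrow> 0 \<in> K"
proof -
  assume K: "star_body K"
  then obtain x where "x \<in> K" using interior_subset[of K] by (auto simp: star_body_def)
  then show "0 \<in> K" using K ends_in_segment(1)[of 0 x] by (auto simp: star_body_def)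
qed

text \<open>The upper limit of the radial integral is the radial function of \<open>K\<close>, which
  lets \<open>indicator K\<close> replace the cut-off on each ray. If no dilate of \<open>K\<close>
  contains \<open>x\<close>, the functional is infinite and the limit is 0, in agreement with a ray
  that meets \<open>K\<close> only at the origin.\<close>

lemma le_radial_function_iff:
  fixes K :: "'a::euclidean_space set"
  assumes K: "star_body K" and x: "x \<noteq> 0" and t: "0 \<le> t"
  shows "t \<le> enn2real (ennreal (norm x) / minkowski_functional K x) \<longleftrightarrow> (t / norm x) *\<^sub>R x \<in> K"
proof (cases "t = 0")
  case True
  then show ?thesis using star_body_zero_mem[OF K] by simp
next
  case False
  with t have t: "t > 0" by simp
  define A where "A = {a. 0 < a \<and> x \<in> (*\<^sub>R) a ` K}"
  have A_iff: "a \<in> A \<longleftrightarrow> 0 < a \<and> (1 / a) *\<^sub>R x \<in> K" for a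
  proof -
    have "x \<in> (*\<^sub>R) a ` K \<longleftrightarrow> (1 / a) *\<^sub>R x \<in> K" if "0 < a"
      using that by (auto simp: image_iff intro!: bexI[of _ "(1 / a) *\<^sub>R x"])
    then show ?thesis by (auto simp: A_def)
  qed
  have mink: "minkowski_functional K x = (INF a\<in>A. ennreal a)"
    by (simp add: minkowski_functional_def A_def)
  have tA: "(t / norm x) *\<^sub>R x \<in> K \<longleftrightarrow> norm x / t \<in> A"
    using t x by (simp add: A_iff)
  show ?thesis
  proof (cases "A = {}")
    case True
    then show ?thesis using tA t by (simp add: mink ennreal_divide_top)
  next
    case False
    have "bounded K" "closed K" using K by (auto simp: star_body_def compact_imp_bounded compact_imp_closed)
    then obtain R where R: "R > 0" "\<And>y. y \<in> K \<Longrightarrow> norm y \<le> R" by (auto simp: bounded_pos)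
    define r where "r = norm x / R"
    have r: "r > 0" using x R by (simp add: r_def)
    have Ar: "r \<le> a" if "a \<in> A" for a
      using R(2)[of "(1 / a) *\<^sub>R x"] that R(1) by (auto simp: A_iff r_def field_simps)
    \<comment> \<open>Boundedness of \<open>K\<close> keeps \<open>A\<close> away from 0, and on
      \<open>{r..}\<close> the map \<open>\<lambda>a. (1 / a) *\<^sub>R x\<close> is continuous. So
      \<open>A\<close> is closed and the infimum is attained.\<close>
    have "A = {r..} \<inter> (\<lambda>a. (1 / a) *\<^sub>R x) -` K"
      using Ar r by (force simp: A_iff)
    moreover have "closed ({r..} \<inter> (\<lambda>a. (1 / a) *\<^sub>R x) -` K)"
      using r \<open>closed K\<close> by (intro continuous_closed_preimage continuous_intros) auto
    ultimately have "closed A" by simp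
    define m where "m = Inf A"
    have bdd: "bdd_below A" using Ar by (rule bdd_belowI)
    have mA: "m \<in> A" unfolding m_def by (rule closed_contains_Inf[OF False bdd \<open>closed A\<close>])
    have m_le: "m \<le> a" if "a \<in> A" for a unfolding m_def by (rule cInf_lower[OF that bdd])
    have m0: "m > 0" using mA by (simp add: A_iff)
    have "minkowski_functional K x = ennreal m"
      unfolding mink using mA m_le by (intro antisym INF_lower INF_greatest ennreal_leI)
    then have rho: "enn2real (ennreal (norm x) / minkowski_functional K x) = norm x / m"
      using m0 by (simp add: divide_ennreal)
    \<comment> \<open>Star-shapedness makes \<open>A\<close> upward closed: a larger factor
      corresponds to a point on the segment from the origin to one that is already in
      \<open>K\<close>.\<close>
    have "norm x / t \<in> A" if "m \<le> norm x / t"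
    proof -
      have "(1 / m) *\<^sub>R x \<in> K" using mA by (simp add: A_iff)
      then have sub: "closed_segment 0 ((1 / m) *\<^sub>R x) \<subseteq> K" using K by (auto simp: star_body_def)
      have "(t / norm x) *\<^sub>R x = (t * m / norm x) *\<^sub>R ((1 / m) *\<^sub>R x)" using m0 by simp
      moreover have "0 \<le> t * m / norm x" "t * m / norm x \<le> 1"
        using that t m0 x by (auto simp: field_simps)
      ultimately have "(t / norm x) *\<^sub>R x \<in> closed_segment 0 ((1 / m) *\<^sub>R x)"
        unfolding closed_segment_def by (auto intro!: exI[of _ "t * m / norm x"])
      then show ?thesis using sub tA by auto
    qed
    then have "norm x / t \<in> A \<longleftrightarrow> m \<le> norm x / t" using m_le by auto
    also have "\<dots> \<longleftrightarrow> t \<le> norm x / m" using t m0 by (simp add: field_simps)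
    finally show ?thesis using tA rho by simp
  qed
qed

text \<open>The measure is \<open>lebesgue\<close> because the functions \<open>k\<close> of
  interest agree with Borel functions only almost everywhere, on almost every ray.\<close>

definition ray_integral :: "nat \<Rightarrow> ('a::euclidean_space \<Rightarrow> real) \<Rightarrow> 'a \<Rightarrow> real" where
  "ray_integral d k \<theta> = (\<integral>t. indicator {0..} t * t ^ d * k (t *\<^sub>R \<theta>) \<partial>lebesgue)"

lemma radial_integral_eq_ray_integral:
  fixes f :: "real^'n \<Rightarrow> real"
  assumes K: "star_body K" and x: "x \<noteq> 0"
  shows "radial_integral f K x =
    norm x powi (1 - int CARD('n)) * ray_integral (CARD('n) - 2) (\<lambda>y. indicator K y * f y) (sgn x)"
proof -
  let ?\<rho> = "enn2real (ennreal (norm x) / minkowski_functional K x)"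
  have eq: "indicat_real {0..?\<rho>} t *\<^sub>R (t ^ (CARD('n) - 2) * f ((t / norm x) *\<^sub>R x)) =
    indicator {0..} t * t ^ (CARD('n) - 2) * (indicator K (t *\<^sub>R sgn x) * f (t *\<^sub>R sgn x))" for t
  proof -
    have xs: "t *\<^sub>R sgn x = (t / norm x) *\<^sub>R x" by (simp add: sgn_div_norm divide_inverse)
    have "indicat_real {0..?\<rho>} t = indicator {0..} t * indicator K ((t / norm x) *\<^sub>R x)"
      using le_radial_function_iff[OF K x, of t] by (cases "0 \<le> t") (simp_all add: indicator_def)
    then show ?thesis unfolding xs by (simp only: real_scaleR_def mult_ac)
  qed
  show ?thesis
    unfolding radial_integral_def ray_integral_def set_lebesgue_integral_def eq ..
qed

section \<open>Passing between a measure and its completion\<close>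

lemma borel_measurable_completion_cong_AE:
  fixes f g :: "'a \<Rightarrow> 'b::topological_space"
  assumes f: "f \<in> borel_measurable M" and AE: "AE x in M. f x = g x"
  shows "g \<in> borel_measurable (completion M)"
proof (rule measurableI)
  fix A :: "'b set" assume "A \<in> sets borel"
  then have S: "f -` A \<inter> space M \<in> sets (completion M)"
    using measurable_sets[OF f] by (intro sets_completionI_sets)
  have ae: "AE x in completion M. x \<in> f -` A \<inter> space M \<longleftrightarrow> x \<in> g -` A \<inter> space M"
    using AE_completion[OF AE] by eventually_elim simp
  show "g -` A \<inter> space (completion M) \<in> sets (completion M)"
    unfolding space_completion by (rule completion.in_sets_AE[OF ae S]) simp
qed simp

lemma integral_completion_cong_AE:
  fixes f g :: "'a \<Rightarrow> 'b::{banach, second_countable_topology}"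
  assumes f: "f \<in> borel_measurable M" and AE: "AE x in M. f x = g x"
  shows "integral\<^sup>L (completion M) g = integral\<^sup>L M f"
    and "integrable (completion M) g \<longleftrightarrow> integrable M f"
proof -
  have g: "g \<in> borel_measurable (completion M)" by (rule borel_measurable_completion_cong_AE[OF assms])
  have f': "f \<in> borel_measurable (completion M)" using f by (rule measurable_completion)
  have AE': "AE x in completion M. g x = f x" using AE_completion[OF AE] by eventually_elim (rule sym)
  show "integral\<^sup>L (completion M) g = integral\<^sup>L M f"
    using integral_cong_AE[OF g f' AE'] integral_completion[OF f] by (rule trans)
  show "integrable (completion M) g \<longleftrightarrow> integrable M f"
    using integrable_cong_AE[OF g f' AE'] integrable_completion[OF f] by (rule trans)
qed

context homogeneous_measure
begin

text \<open>By homogeneity a null set stays null under every dilation, so by Fubini it meets almost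
  every ray in a null set of parameters. These are enclosed in a Borel set, which makes a later
  affine change of the parameter possible.\<close>

lemma AE_ray:
  assumes "AE x in \<tau>. P x"
  shows "AE x in \<tau>. \<exists>N\<in>sets borel. (AE s in lborel. s \<notin> N) \<and> (\<forall>s>0. s \<notin> N \<longrightarrow> P (s *\<^sub>R x))"
proof -
  obtain N where N: "N \<in> null_sets \<tau>" and sub: "{x \<in> space \<tau>. \<not> P x} \<subseteq> N"
    using assms by (auto elim: AE_E3 simp: eventually_ae_filter)
  then have [measurable]: "N \<in> sets borel" by (auto simp: null_sets_def)
  have P: "P x" if "x \<notin> N" for x
    using sub that sets_eq_imp_space_eq[OF sets_eq_borel] by auto
  have "(\<integral>\<^sup>+x. \<integral>\<^sup>+s. indicator {0<..} s * indicator N (s *\<^sub>R x) \<partial>lborel \<partial>\<tau>) =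
      (\<integral>\<^sup>+s. \<integral>\<^sup>+x. indicator {0<..} s * indicator N (s *\<^sub>R x) \<partial>\<tau> \<partial>lborel)"
    by (rule Fubini'[symmetric]) measurable
  also have "\<dots> = (\<integral>\<^sup>+s. 0 \<partial>(lborel :: real measure))"
  proof (rule nn_integral_cong)
    fix s :: real
    show "(\<integral>\<^sup>+x. indicator {0<..} s * indicator N (s *\<^sub>R x) \<partial>\<tau>) = 0"
    proof (cases "s > 0")
      case True
      have "ennreal (s ^ m) * (\<integral>\<^sup>+x. indicator N (s *\<^sub>R x) \<partial>\<tau>) = (\<integral>\<^sup>+x. indicator N x \<partial>\<tau>)"
        by (rule nn_integral_scale[OF True]) measurable
      also have "\<dots> = 0" using N by (auto simp: null_sets_def)
      finally show ?thesis using True by simp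
    qed simp
  qed
  finally have "(\<integral>\<^sup>+x. \<integral>\<^sup>+s. indicator {0<..} s * indicator N (s *\<^sub>R x) \<partial>lborel \<partial>\<tau>) = 0"
    by simp
  then have "AE x in \<tau>. (\<integral>\<^sup>+s. indicator {0<..} s * indicator N (s *\<^sub>R x) \<partial>lborel) = 0"
    by (subst (asm) nn_integral_0_iff_AE) auto
  then show ?thesis
  proof eventually_elim
    case (elim x)
    then have "AE s in lborel. indicator {0<..} s * (indicator N (s *\<^sub>R x) :: ennreal) = 0"
      by (subst (asm) nn_integral_0_iff_AE) auto
    then have "AE s in lborel. s \<notin> {s. 0 < s \<and> s *\<^sub>R x \<in> N}"
      by eventually_elim (auto simp: indicator_def split: if_splits)
    moreover have "{s. 0 < s \<and> s *\<^sub>R x \<in> N} \<in> sets borel" by measurable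
    ultimately show ?case using P by (intro bexI[of _ "{s. 0 < s \<and> s *\<^sub>R x \<in> N}"]) auto
  qed
qed

text \<open>The substitution \<open>t = norm x * s\<close> passes from the unit vector to
  \<open>x\<close>; its Jacobian and the power of \<open>t\<close> together produce
  \<open>norm x ^ m\<close>. The right side contains only the Borel version \<open>k'\<close>, to
  which Fubini applies.\<close>

lemma ray_integral_polar:
  fixes k :: "'a \<Rightarrow> real"
  assumes k'[measurable]: "k' \<in> borel_measurable borel" and AE: "AE x in \<tau>. k x = k' x"
  shows "AE x in \<tau>. shell (norm x) * (ray_integral (m - 1) k (sgn x) / norm x ^ m) =
    (\<integral>s. polar_weight (x, s) * k' (s *\<^sub>R x) \<partial>lborel)"
  using AE_ray[OF AE] AE_neq_0
proof eventually_elim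
  case (elim x)
  then obtain N where [measurable]: "N \<in> sets borel" and N: "AE s in lborel. s \<notin> N"
    and kk': "\<And>s. s > 0 \<Longrightarrow> s \<notin> N \<Longrightarrow> k (s *\<^sub>R x) = k' (s *\<^sub>R x)" by auto
  have x: "norm x > 0" using elim by simp
  have xs: "t *\<^sub>R sgn x = (t / norm x) *\<^sub>R x" for t by (simp add: sgn_div_norm divide_inverse)
  have "AE t in lborel. t / norm x \<notin> N"
    using AE_borel_affine[of "1 / norm x" "\<lambda>s. s \<notin> N" 0] x N by simp
  then have "AE t in lborel. indicator {0..} t * t ^ (m - 1) * k' (t *\<^sub>R sgn x) = indicator {0..} t * t ^ (m - 1) * k (t *\<^sub>R sgn x)"
    using AE_lborel_singleton[of "0::real"]
  proof eventually_elim
    case (elim t)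
    show ?case
    proof (cases "t > 0")
      case True
      then show ?thesis using elim kk'[of "t / norm x"] x by (simp add: xs)
    qed (use elim in \<open>auto simp: indicator_def\<close>)
  qed
  then have "ray_integral (m - 1) k (sgn x) = (\<integral>t. indicator {0..} t * t ^ (m - 1) * k' (t *\<^sub>R sgn x) \<partial>lborel)"
    unfolding ray_integral_def by (intro integral_completion_cong_AE) measurable
  also have "\<dots> = norm x * (\<integral>s. indicator {0..} (norm x * s) * (norm x * s) ^ (m - 1) * k' ((norm x * s) *\<^sub>R sgn x) \<partial>lborel)"
    using lborel_integral_real_affine[of "norm x" "\<lambda>t. indicator {0..} t * t ^ (m - 1) * k' (t *\<^sub>R sgn x)" 0] x by simp
  also have "\<dots> = norm x * (\<integral>s. norm x ^ (m - 1) * (indicator {0<..} s * s ^ (m - 1) * k' (s *\<^sub>R x)) \<partial>lborel)"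
  proof (intro arg_cong2[where f="(*)"] refl integral_cong_AE)
    show "AE s in lborel. indicator {0..} (norm x * s) * (norm x * s) ^ (m - 1) * k' ((norm x * s) *\<^sub>R sgn x) =
      norm x ^ (m - 1) * (indicator {0<..} s * s ^ (m - 1) * k' (s *\<^sub>R x))"
      using AE_lborel_singleton[of "0::real"]
    proof eventually_elim
      case (elim s)
      have "(norm x * s) *\<^sub>R sgn x = s *\<^sub>R x" using x by (simp add: xs)
      then show ?case using x elim by (auto simp: indicator_def power_mult_distrib zero_le_mult_iff)
    qed
  qed measurable
  also have "\<dots> = norm x ^ m * (\<integral>s. indicator {0<..} s * s ^ (m - 1) * k' (s *\<^sub>R x) \<partial>lborel)"
  proof -
    have "norm x * norm x ^ (m - 1) = norm x ^ m" using m by (simp flip: power_Suc)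
    then show ?thesis unfolding integral_mult_right_zero by (simp only: mult.assoc[symmetric])
  qed
  finally have "ray_integral (m - 1) k (sgn x) / norm x ^ m = (\<integral>s. indicator {0<..} s * s ^ (m - 1) * k' (s *\<^sub>R x) \<partial>lborel)"
    using x by simp
  then show ?case by (simp add: polar_weight_def mult_ac flip: integral_mult_right_zero)
qed

lemma integral_ray_integral:
  fixes k :: "'a \<Rightarrow> real"
  assumes k: "integrable (completion \<tau>) k"
  shows "(\<integral>x. shell (norm x) * (ray_integral (m - 1) k (sgn x) / norm x ^ m) \<partial>completion \<tau>) = (\<integral>x. k x \<partial>completion \<tau>)"
proof -
  obtain k' where k'm: "k' \<in> borel_measurable \<tau>" and ae: "AE x in \<tau>. k x = k' x"
    using completion_ex_borel_measurable_real[OF borel_measurable_integrable[OF k]] by auto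
  have [measurable]: "k' \<in> borel_measurable borel" using k'm by simp
  have ae': "AE x in \<tau>. k' x = k x" using ae by eventually_elim simp
  have k': "(\<integral>x. k x \<partial>completion \<tau>) = (\<integral>x. k' x \<partial>\<tau>)" "integrable \<tau> k'"
    using integral_completion_cong_AE[OF k'm ae'] k by auto
  have int: "integrable (\<tau> \<Otimes>\<^sub>M lborel) (\<lambda>p. polar_weight p *\<^sub>R k' (snd p *\<^sub>R fst p))"
    using k'(2) by (subst integrable_polar[symmetric]) auto
  have "(\<integral>x. k' x \<partial>\<tau>) = (\<integral>x. (\<integral>s. polar_weight (x, s) * k' (s *\<^sub>R x) \<partial>lborel) \<partial>\<tau>)"
    using integral_fst'[OF int] by (subst integral_polar) auto
  also have "\<dots> = (\<integral>x. shell (norm x) * (ray_integral (m - 1) k (sgn x) / norm x ^ m) \<partial>completion \<tau>)"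
  proof (rule integral_completion_cong_AE(1)[symmetric])
    show "(\<lambda>x. \<integral>s. polar_weight (x, s) * k' (s *\<^sub>R x) \<partial>lborel) \<in> borel_measurable \<tau>"
      using borel_measurable_integrable[OF integrable_fst'[OF int]] by simp
    show "AE x in \<tau>. (\<integral>s. polar_weight (x, s) * k' (s *\<^sub>R x) \<partial>lborel) = shell (norm x) * (ray_integral (m - 1) k (sgn x) / norm x ^ m)"
      using ray_integral_polar[OF \<open>k' \<in> borel_measurable borel\<close> ae] by eventually_elim simp
  qed
  finally show ?thesis using k'(1) by simp
qed

end

lemma power_int_one_minus: "n \<ge> 1 \<Longrightarrow> x powi (1 - int n) = inverse ((x::real) ^ (n - 1))"
proof -
  assume "n \<ge> 1"
  then have "1 - int n = - int (n - 1)" by simp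
  then show ?thesis by (simp only: power_int_minus power_int_of_nat)
qed

lemma radial_integral_shell:
  fixes f :: "real^'n \<Rightarrow> real"
  assumes n: "CARD('n) \<ge> 2" and K: "star_body K"
  shows "radial_integral f K x * shell (norm x) =
    shell (norm x) * (ray_integral (CARD('n) - 1 - 1) (\<lambda>y. indicator K y * f y) (sgn x) / norm x ^ (CARD('n) - 1))"
proof (cases "x = 0")
  case False
  have "CARD('n) - 1 - 1 = CARD('n) - 2" by simp
  then show ?thesis using n
    by (simp only: radial_integral_eq_ray_integral[OF K False] power_int_one_minus)
       (simp add: power_int_one_minus divide_inverse mult_ac)
qed (simp add: shell_eq_0)

text \<open>The polar formula on a hyperplane has \<open>m = n - 1\<close>, so its radial power is
  \<open>n - 2\<close>, the one in the radial integral. It is applied to \<open>f\<close> cut off by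
  \<open>K\<close>, which is integrable there because \<open>K\<close> is compact.\<close>

lemma hyperplane_measure_eq:
  fixes f :: "real^'n \<Rightarrow> real"
  assumes n: "CARD('n) \<ge> 2" and K: "star_body K" and \<xi>: "norm \<xi> = 1"
    and f: "locally_integrable (subspace_lebesgue ({\<xi>}\<^sup>\<bottom>)) f"
  shows "hyperplane_measure f \<xi> (K \<inter> {\<xi>}\<^sup>\<bottom>) =
    (\<integral>x. radial_integral f K x * shell (norm x) \<partial>completion (hyp_lborel \<xi>))"
proof -
  interpret homogeneous_measure "hyp_lborel \<xi>" "DIM(real^'n) - 1"
    using n \<xi> by (intro homogeneous_measure_hyp_lborel) auto
  have k: "integrable (completion (hyp_lborel \<xi>)) (\<lambda>x. indicator K x * f x)"
    using f K by (auto simp: locally_integrable_def star_body_def set_integrable_def subspace_lebesgue_def)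
  have km: "(\<lambda>x. indicator K x * f x) \<in> borel_measurable (completion (hyp_lborel \<xi>))"
    using k by auto
  have "{x. x \<bullet> \<xi> = 0} \<in> sets borel" by measurable
  then have perp: "{\<xi>}\<^sup>\<bottom> \<in> sets (completion (hyp_lborel \<xi>))"
    by (auto simp: mem_orthogonal_comp_singleton[symmetric] intro!: sets_completionI_sets)
  have "hyperplane_measure f \<xi> (K \<inter> {\<xi>}\<^sup>\<bottom>) =
      (\<integral>x. indicator ({\<xi>}\<^sup>\<bottom>) x * (indicator K x * f x) \<partial>completion (hyp_lborel \<xi>))"
    unfolding hyperplane_measure_def set_lebesgue_integral_def subspace_lebesgue_def
    by (simp add: indicator_inter_arith mult_ac)
  also have "\<dots> = (\<integral>x. indicator K x * f x \<partial>completion (hyp_lborel \<xi>))"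
  proof (rule integral_cong_AE)
    show "AE x in completion (hyp_lborel \<xi>). indicator ({\<xi>}\<^sup>\<bottom>) x * (indicator K x * f x) = indicator K x * f x"
      using AE_completion[OF AE_hyp_lborel[of \<xi>]]
      by eventually_elim (simp add: mem_orthogonal_comp_singleton)
  qed (use km perp in auto)
  also have "\<dots> = (\<integral>x. radial_integral f K x * shell (norm x) \<partial>completion (hyp_lborel \<xi>))"
    using integral_ray_integral[OF k] by (simp add: radial_integral_shell[OF n K])
  finally show ?thesis .
qed

section \<open>Fourier transforms of homogeneous functions\<close>

lemma AE_lborel_scaleR:
  fixes P :: "'a::euclidean_space \<Rightarrow> bool"
  assumes c: "c \<noteq> 0" and P: "AE x in lborel. P x"
  shows "AE x in lborel. P (c *\<^sub>R x)"
proof -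
  obtain N where N: "N \<in> null_sets lborel" and sub: "{x \<in> space lborel. \<not> P x} \<subseteq> N"
    using P by (auto simp: eventually_ae_filter)
  then have [measurable]: "N \<in> sets borel" by (auto simp: null_sets_def)
  have [measurable]: "Measurable.pred borel (\<lambda>x. x \<notin> N)" by measurable
  have "AE x in lborel. x \<notin> N" using N by (rule AE_not_in)
  then have "AE x in density (distr lborel borel (\<lambda>x::'a. 0 + c *\<^sub>R x)) (\<lambda>_. \<bar>c\<bar> ^ DIM('a)). x \<notin> N"
    by (subst lborel_affine[OF c, of "0::'a", symmetric])
  then have "AE x in distr lborel borel (\<lambda>x::'a. 0 + c *\<^sub>R x). x \<notin> N"
    using c by (simp add: AE_density)
  then have "AE x in lborel. c *\<^sub>R x \<notin> N"
    by (subst (asm) AE_distr_iff) auto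
  then show ?thesis
    by eventually_elim (use sub in auto)
qed

lemma integral_lborel_uminus:
  fixes f :: "'a::euclidean_space \<Rightarrow> 'c::{banach, second_countable_topology}"
  assumes [measurable]: "f \<in> borel_measurable borel"
  shows "(\<integral>x. f (- x) \<partial>lborel) = (\<integral>x. f x \<partial>lborel)"
proof -
  have "orthogonal_transformation (uminus :: 'a \<Rightarrow> 'a)"
    by (simp add: orthogonal_transformation_def linear_iff)
  then have "(\<integral>x. f x \<partial>lborel) = (\<integral>x. f x \<partial>distr lborel borel uminus)"
    by (simp add: distr_lborel_orthogonal_transformation)
  also have "\<dots> = (\<integral>x. f (- x) \<partial>lborel)"
    by (rule integral_distr) auto
  finally show ?thesis by simp
qed

lemma integral_lborel_split_sign:
  fixes q :: "real \<Rightarrow> 'c::{banach, second_countable_topology}"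
  assumes q: "integrable lborel q"
  shows "(\<integral>s. q s \<partial>lborel) = (\<integral>s. indicator {0<..} s *\<^sub>R q s \<partial>lborel) + (\<integral>s. indicator {0<..} s *\<^sub>R q (- s) \<partial>lborel)"
proof -
  have [measurable]: "q \<in> borel_measurable borel" using q by auto
  have int: "integrable lborel (\<lambda>s. indicator {0<..} s *\<^sub>R q s)" "integrable lborel (\<lambda>s. indicator {..<0} s *\<^sub>R q s)"
    using q by (auto intro: integrable_mult_indicator)
  have "(\<integral>s. q s \<partial>lborel) = (\<integral>s. indicator {0<..} s *\<^sub>R q s + indicator {..<0} s *\<^sub>R q s \<partial>lborel)"
    using AE_lborel_singleton[of "0::real"]
    by (intro integral_cong_AE) (auto simp: indicator_def elim!: eventually_mono)
  also have "\<dots> = (\<integral>s. indicator {0<..} s *\<^sub>R q s \<partial>lborel) + (\<integral>s. indicator {..<0} s *\<^sub>R q s \<partial>lborel)"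
    by (rule Bochner_Integration.integral_add[OF int])
  also have "(\<integral>s. indicator {..<0} s *\<^sub>R q s \<partial>lborel) = (\<integral>s. indicator {..<0} (- s) *\<^sub>R q (- s) \<partial>lborel)"
    by (rule integral_lborel_uminus[symmetric]) measurable
  finally show ?thesis by (simp add: indicator_def)
qed

lemma radon_mult_right: "radon (\<lambda>y. c * f y) x = c * radon f x" for f :: "_ \<Rightarrow> complex"
  by (simp add: radon_def)

lemma radon_mult_left: "radon (\<lambda>y. f y * c) x = radon f x * c" for f :: "_ \<Rightarrow> complex"
  by (simp add: radon_def)

lemma radon_of_real: "radon (\<lambda>y. complex_of_real (f y)) x = of_real (radon f x)"
  by (simp add: radon_def scaleR_conv_of_real)

text \<open>Rescaling the unit direction to \<open>y\<close> divides the line integral by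
  \<open>norm y\<close>, which is where the factor in \<open>radon\<close> enters.\<close>

lemma integral_fourier_ray:
  fixes \<phi> :: "'a::euclidean_space \<Rightarrow> complex"
  assumes \<phi>: "schwartz \<phi>" and y: "y \<noteq> 0"
  shows "(\<integral>s. fourier \<phi> (s *\<^sub>R y) \<partial>lborel) = 2 * pi * radon \<phi> y"
proof -
  have ys: "(norm y * s) *\<^sub>R sgn y = s *\<^sub>R y" for s using y by (simp add: sgn_div_norm)
  have "(\<integral>s. fourier \<phi> (s *\<^sub>R sgn y) \<partial>lborel) = norm y *\<^sub>R (\<integral>s. fourier \<phi> (s *\<^sub>R y) \<partial>lborel)"
    using lborel_integral_real_affine[of "norm y" "\<lambda>s. fourier \<phi> (s *\<^sub>R sgn y)" 0] y
    by (simp add: ys)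
  then have "norm y *\<^sub>R (\<integral>s. fourier \<phi> (s *\<^sub>R y) \<partial>lborel) = 2 * pi * (\<integral>x. \<phi> x \<partial>hyp_lborel y)"
    using integral_fourier_line[OF \<phi>, of "sgn y"] y by (simp add: norm_sgn hyp_lborel_sgn)
  then have "(1 / norm y) *\<^sub>R (norm y *\<^sub>R (\<integral>s. fourier \<phi> (s *\<^sub>R y) \<partial>lborel)) = 2 * pi * radon \<phi> y"
    by (simp add: radon_def)
  then show ?thesis using y by simp
qed

lemma integrable_fourier_ray:
  fixes \<phi> :: "'a::euclidean_space \<Rightarrow> complex"
  assumes \<phi>: "schwartz \<phi>" and y: "norm y \<ge> 1"
  shows "integrable lborel (\<lambda>s. fourier \<phi> (s *\<^sub>R y))"
proof -
  have [measurable]: "\<phi> \<in> borel_measurable borel"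
    using schwartz_continuous[OF \<phi>, of "[]"] by (simp add: borel_measurable_continuous_onI)
  have [measurable]: "fourier \<phi> \<in> borel_measurable borel" by (rule borel_measurable_fourier) measurable
  obtain C where C0: "C \<ge> 0" and C: "\<And>x. norm (fourier \<phi> x) \<le> C * inverse (1 + (norm x)\<^sup>2)"
    using schwartz_fourier_decay[OF \<phi>] by metis
  have le: "norm (fourier \<phi> (s *\<^sub>R y)) \<le> C * inverse (1 + s\<^sup>2)" for s
  proof -
    have "s\<^sup>2 * 1 \<le> s\<^sup>2 * (norm y)\<^sup>2" using y by (intro mult_left_mono) (auto simp: one_le_power)
    then have "inverse (1 + (norm (s *\<^sub>R y))\<^sup>2) \<le> inverse (1 + s\<^sup>2)"
      by (intro le_imp_inverse_le) (auto simp: power_mult_distrib add_pos_nonneg)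
    then show ?thesis using C[of "s *\<^sub>R y"] C0 by (meson mult_left_mono order_trans)
  qed
  show ?thesis
  proof (rule Bochner_Integration.integrable_bound)
    show "integrable lborel (\<lambda>s. C * inverse (1 + s\<^sup>2) :: real)"
      by (intro integrable_mult_right integrable_inverse_1_plus_square_lborel)
    show "AE s in lborel. norm (fourier \<phi> (s *\<^sub>R y)) \<le> norm (C * inverse (1 + s\<^sup>2))"
      using le C0 by (intro AE_I2) simp
  qed measurable
qed

text \<open>Symmetry of the incidence measure makes \<open>radon\<close> self-adjoint. As
  \<open>G\<close> lives on \<open>norm y \<ge> 1\<close>, the factor \<open>1 / norm y\<close> is
  at most 1, and the uniform bound for \<open>decay_weight\<close> on hyperplanes reduces absolute
  convergence to integrability of \<open>G\<close>.\<close>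

lemma
  fixes G :: "'a::euclidean_space \<Rightarrow> real" and \<phi> :: "'a \<Rightarrow> complex"
  assumes dim: "DIM('a) \<ge> 2" and G: "integrable lborel G" and G1: "\<And>y. norm y < 1 \<Longrightarrow> G y = 0"
    and \<phi>[measurable]: "\<phi> \<in> borel_measurable borel" and C: "\<And>x. norm (\<phi> x) \<le> C * decay_weight x"
  shows integrable_radon_mult: "integrable lborel (\<lambda>x. of_real (radon G x) * \<phi> x)"
    and integral_radon_mult: "(\<integral>x. of_real (radon G x) * \<phi> x \<partial>lborel) = (\<integral>y. of_real (G y) * radon \<phi> y \<partial>lborel)"
proof -
  have [measurable]: "G \<in> borel_measurable borel" using G by auto
  define F where "F p = \<phi> (fst p) * complex_of_real (G (snd p))" for p
  have F: "F \<in> borel_measurable (borel \<Otimes>\<^sub>M borel)" unfolding F_def by measurable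
  obtain B where B0: "0 \<le> B" and B: "\<And>\<xi>::'a. norm \<xi> = 1 \<Longrightarrow> (\<integral>\<^sup>+x. ennreal (decay_weight x) \<partial>hyp_lborel \<xi>) \<le> ennreal B"
    using nn_integral_hyp_decay_weight_bounded[where 'a='a] by metis
  have C0: "0 \<le> C"
    using order_trans[OF norm_ge_zero C[of 0]] by (metis decay_weight_pos mult_neg_pos not_less)
  have bound: "ennreal (1 / norm y) * (\<integral>\<^sup>+x. ennreal (norm (F (x, y))) \<partial>hyp_lborel y) \<le> ennreal (C * B * \<bar>G y\<bar>)" for y
  proof (cases "norm y < 1")
    case True
    then show ?thesis by (simp add: F_def G1)
  next
    case False
    then have y: "norm (sgn y) = 1" by (auto simp: norm_sgn)
    have "(\<integral>\<^sup>+x. ennreal (norm (F (x, y))) \<partial>hyp_lborel y) \<le> (\<integral>\<^sup>+x. ennreal (C * \<bar>G y\<bar>) * ennreal (decay_weight x) \<partial>hyp_lborel (sgn y))"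
      unfolding hyp_lborel_sgn
    proof (rule nn_integral_mono)
      fix x
      have "norm (F (x, y)) \<le> (C * decay_weight x) * \<bar>G y\<bar>"
        unfolding F_def norm_mult using C[of x] by (simp add: mult_right_mono)
      then show "ennreal (norm (F (x, y))) \<le> ennreal (C * \<bar>G y\<bar>) * ennreal (decay_weight x)"
        using C0 by (simp add: ennreal_mult[symmetric] ennreal_leI mult_ac)
    qed
    also have "\<dots> \<le> ennreal (C * \<bar>G y\<bar>) * ennreal B"
      using B[OF y] by (subst nn_integral_cmult) (auto intro: mult_left_mono)
    also have "\<dots> = ennreal (C * B * \<bar>G y\<bar>)"
      using C0 B0 by (simp add: ennreal_mult[symmetric] mult_ac)
    finally have *: "(\<integral>\<^sup>+x. ennreal (norm (F (x, y))) \<partial>hyp_lborel y) \<le> ennreal (C * B * \<bar>G y\<bar>)" .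
    have "ennreal (1 / norm y) \<le> 1" using False by (simp add: divide_le_eq_1)
    then show ?thesis using mult_mono[OF _ *, of "ennreal (1 / norm y)" 1] by simp
  qed
  have "(\<integral>\<^sup>+y. ennreal (1 / norm y) * (\<integral>\<^sup>+x. ennreal (norm (F (x, y))) \<partial>hyp_lborel y) \<partial>lborel) \<le>
      (\<integral>\<^sup>+y. ennreal (C * B * \<bar>G y\<bar>) \<partial>lborel)"
    by (intro nn_integral_mono bound)
  also have "\<dots> < \<infinity>"
  proof -
    have "integrable lborel (\<lambda>y. C * B * \<bar>G y\<bar>)" using G by simp
    from nn_integral_eq_integral[OF this] show ?thesis using C0 B0 by simp
  qed
  finally have fin: "(\<integral>\<^sup>+y. ennreal (1 / norm y) * (\<integral>\<^sup>+x. ennreal (norm (F (x, y))) \<partial>hyp_lborel y) \<partial>lborel) < \<infinity>" .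
  have r1: "radon (\<lambda>x. F (x, y)) y = of_real (G y) * radon \<phi> y" for y
    by (simp add: F_def radon_mult_left mult.commute)
  have r2: "radon (\<lambda>y. F (x, y)) x = of_real (radon G x) * \<phi> x" for x
    by (simp add: F_def radon_mult_right radon_of_real mult.commute)
  show "integrable lborel (\<lambda>x. of_real (radon G x) * \<phi> x)"
    using integral_incidence_swap(2)[OF dim F fin] by (simp only: r2)
  show "(\<integral>x. of_real (radon G x) * \<phi> x \<partial>lborel) = (\<integral>y. of_real (G y) * radon \<phi> y \<partial>lborel)"
    using integral_incidence_swap(3)[OF dim F fin] by (simp only: r1 r2)
qed

text \<open>Homogeneity for each dilation and evenness are asked for only almost everywhere, because
  the lemma is applied to a Borel version of the radial integral.\<close>

lemma homogeneous_even_fourier: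
  fixes g :: "'a::euclidean_space \<Rightarrow> real" and \<phi> :: "'a \<Rightarrow> complex"
  assumes g[measurable]: "g \<in> borel_measurable borel"
    and hom: "\<And>c. c > 0 \<Longrightarrow> AE x in lborel. g (c *\<^sub>R x) = g x / c ^ (DIM('a) - 1)"
    and even: "AE x in lborel. g (- x) = g x"
    and G: "integrable lborel (\<lambda>x. g x * shell (norm x))"
    and \<phi>: "schwartz \<phi>"
  shows "integrable lborel (\<lambda>x. of_real (g x) * fourier \<phi> x)"
    and "(\<integral>x. of_real (g x) * fourier \<phi> x \<partial>lborel) = pi * (\<integral>y. of_real (g y * shell (norm y)) * radon \<phi> y \<partial>lborel)"
proof -
  interpret homogeneous_measure "lborel :: 'a measure" "DIM('a)"
    by (rule homogeneous_measure_lborel)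
  define G where "G x = g x * shell (norm x)" for x
  have [measurable]: "G \<in> borel_measurable borel" unfolding G_def by measurable
  have intG: "integrable lborel G" unfolding G_def by (rule G)
  have G0: "G y = 0" if "norm y < 1" for y using that by (simp add: G_def shell_eq_0)
  have [measurable]: "\<phi> \<in> borel_measurable borel"
    using schwartz_continuous[OF \<phi>, of "[]"] by (simp add: borel_measurable_continuous_onI)
  have [measurable]: "fourier \<phi> \<in> borel_measurable borel" by (rule borel_measurable_fourier) measurable
  obtain C where C0: "C \<ge> 0" and C: "\<And>x. norm (fourier \<phi> x) \<le> C * inverse (1 + (norm x)\<^sup>2)"
    using schwartz_fourier_decay[OF \<phi>] by metis
  let ?k = "\<lambda>p. indicator {0<..} (snd p) *\<^sub>R (of_real (G (fst p)) * fourier \<phi> (snd p *\<^sub>R fst p))"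
  let ?P = "\<lambda>p. polar_weight p *\<^sub>R (of_real (g (snd p *\<^sub>R fst p)) * fourier \<phi> (snd p *\<^sub>R fst p))"
  \<comment> \<open>Homogeneity cancels the radial power of \<open>polar_weight\<close>. The
    exceptional set of \<open>y\<close> depends on \<open>s\<close>, but Fubini for null sets makes
    it null in the product.\<close>
  have AE: "AE p in lborel \<Otimes>\<^sub>M lborel. ?P p = ?k p"
  proof (rule lborel_pair.AE_pair_measure)
    show meas: "{p \<in> space (lborel \<Otimes>\<^sub>M lborel). ?P p = ?k p} \<in> sets (lborel \<Otimes>\<^sub>M lborel)" by measurable
    have "AE s in lborel. AE y in lborel. ?P (y, s) = ?k (y, s)"
    proof (rule AE_I2)
      fix s :: real
      show "AE y in lborel. ?P (y, s) = ?k (y, s)"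
      proof (cases "s > 0")
        case True
        show ?thesis using hom[OF True]
        proof eventually_elim
          case (elim y)
          have "polar_weight (y, s) * g (s *\<^sub>R y) = G y"
            using True elim by (simp add: polar_weight_def G_def)
          then show ?case using True
            by (simp add: scaleR_conv_of_real mult.assoc[symmetric] flip: of_real_mult)
        qed
      qed (simp add: polar_weight_def)
    qed
    then show "AE y in lborel. AE s in lborel. ?P (y, s) = ?k (y, s)"
      by (subst lborel_pair.AE_commute[where P="\<lambda>y s. ?P (y, s) = ?k (y, s)"]) (use meas in simp_all)
  qed
  have "integrable (lborel \<Otimes>\<^sub>M lborel) (\<lambda>p. (C * \<bar>G (fst p)\<bar>) * inverse (1 + (snd p)\<^sup>2))"
    by (rule lborel_pair.integrable_fst_mult_snd[of "\<lambda>y. C * \<bar>G y\<bar>"])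
       (use intG integrable_inverse_1_plus_square_lborel in auto)
  then have intk: "integrable (lborel \<Otimes>\<^sub>M lborel) ?k"
  proof (rule Bochner_Integration.integrable_bound)
    have "norm (?k (y, s)) \<le> norm ((C * \<bar>G y\<bar>) * inverse (1 + s\<^sup>2))" for y :: 'a and s :: real
    proof (cases "norm y < 1")
      case False
      have "s\<^sup>2 * 1 \<le> s\<^sup>2 * (norm y)\<^sup>2" using False by (intro mult_left_mono) (auto simp: one_le_power)
      then have "inverse (1 + (norm (s *\<^sub>R y))\<^sup>2) \<le> inverse (1 + s\<^sup>2)"
        by (intro le_imp_inverse_le) (auto simp: power_mult_distrib add_pos_nonneg)
      then have "norm (fourier \<phi> (s *\<^sub>R y)) \<le> C * inverse (1 + s\<^sup>2)"
        using C[of "s *\<^sub>R y"] C0 by (meson mult_left_mono order_trans)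
      then have "\<bar>G y\<bar> * norm (fourier \<phi> (s *\<^sub>R y)) \<le> \<bar>G y\<bar> * (C * inverse (1 + s\<^sup>2))"
        by (rule mult_left_mono) simp
      moreover have "norm (?k (y, s)) \<le> \<bar>G y\<bar> * norm (fourier \<phi> (s *\<^sub>R y))"
        by (simp add: norm_mult indicator_def)
      moreover have "norm ((C * \<bar>G y\<bar>) * inverse (1 + s\<^sup>2)) = \<bar>G y\<bar> * (C * inverse (1 + s\<^sup>2))"
        using C0 by (simp add: abs_mult mult_ac)
      ultimately show ?thesis by simp
    qed (simp add: G0)
    then show "AE p in lborel \<Otimes>\<^sub>M lborel. norm (?k p) \<le> norm ((C * \<bar>G (fst p)\<bar>) * inverse (1 + (snd p)\<^sup>2))"
      by (intro AE_I2) (metis prod.collapse)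
  qed measurable
  have gm: "(\<lambda>x. of_real (g x) * fourier \<phi> x) \<in> borel_measurable borel" by measurable
  have "integrable (lborel \<Otimes>\<^sub>M lborel) ?P"
    by (subst integrable_cong_AE[OF _ _ AE]) (use intk in auto)
  then show "integrable lborel (\<lambda>x. of_real (g x) * fourier \<phi> x)"
    by (subst integrable_polar[OF gm])
  \<comment> \<open>Inversion evaluates only full-line integrals, whereas \<open>A\<close> covers
    the half-line. Evenness of \<open>G\<close> almost everywhere allows \<open>A y\<close> to be
    replaced by the mean of \<open>A y\<close> and \<open>A (- y)\<close>, which is half of a
    full-line integral.\<close>
  define A where "A y = (\<integral>s. indicator {0<..} s *\<^sub>R fourier \<phi> (s *\<^sub>R y) \<partial>lborel)" for y
  have [measurable]: "A \<in> borel_measurable borel" unfolding A_def by measurable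
  have kA: "(\<integral>s. ?k (y, s) \<partial>lborel) = of_real (G y) * A y" for y
    unfolding A_def integral_mult_right_zero[symmetric] by (simp add: mult_scaleR_right)
  have intGA: "integrable lborel (\<lambda>y. of_real (G y) * A y)"
    using lborel_pair.integrable_fst'[OF intk] by (simp only: kA)
  have "(\<integral>x. of_real (g x) * fourier \<phi> x \<partial>lborel) = (\<integral>p. ?P p \<partial>(lborel \<Otimes>\<^sub>M lborel))"
    by (rule integral_polar[OF gm])
  also have "\<dots> = (\<integral>p. ?k p \<partial>(lborel \<Otimes>\<^sub>M lborel))"
    by (rule integral_cong_AE[OF _ _ AE]) measurable
  also have "\<dots> = (\<integral>y. of_real (G y) * A y \<partial>lborel)"
    using lborel_pair.integral_fst'[OF intk] by (simp only: kA)
  finally have 1: "(\<integral>x. of_real (g x) * fourier \<phi> x \<partial>lborel) = (\<integral>y. of_real (G y) * A y \<partial>lborel)" .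
  have AEG: "AE y in lborel. of_real (G (- y)) * A (- y) = of_real (G y) * A (- y)"
    using even by eventually_elim (simp add: G_def)
  have intGA': "integrable lborel (\<lambda>y. of_real (G y) * A (- y))"
  proof -
    have "integrable lborel (\<lambda>y. of_real (G (- y)) * A (- y))"
    proof -
      have "orthogonal_transformation (uminus :: 'a \<Rightarrow> 'a)" by (simp add: orthogonal_transformation_def linear_iff)
      from distr_lborel_orthogonal_transformation[OF this]
      have "integrable (distr lborel borel uminus) (\<lambda>y::'a. of_real (G y) * A y)" using intGA by simp
      then show ?thesis by (subst (asm) integrable_distr_eq) auto
    qed
    then show ?thesis by (subst (asm) integrable_cong_AE[OF _ _ AEG]) auto
  qed
  have 2: "(\<integral>y. of_real (G y) * A y \<partial>lborel) = (\<integral>y. of_real (G y) * A (- y) \<partial>lborel)"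
  proof -
    have "(\<integral>y. of_real (G y) * A y \<partial>lborel) = (\<integral>y. of_real (G (- y)) * A (- y) \<partial>lborel)"
      by (rule integral_lborel_uminus[symmetric]) measurable
    also have "\<dots> = (\<integral>y. of_real (G y) * A (- y) \<partial>lborel)"
      by (rule integral_cong_AE[OF _ _ AEG]) measurable
    finally show ?thesis .
  qed
  have AA: "of_real (G y) * A y + of_real (G y) * A (- y) = (2 * pi) * (of_real (G y) * radon \<phi> y)" for y
  proof (cases "norm y < 1")
    case False
    then have "norm y \<ge> 1" "y \<noteq> 0" by auto
    then have "A y + A (- y) = 2 * pi * radon \<phi> y"
      using integral_lborel_split_sign[OF integrable_fourier_ray[OF \<phi>, of y]] integral_fourier_ray[OF \<phi>, of y]
      by (auto simp: A_def)
    then show ?thesis by (simp add: distrib_left[symmetric])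
  qed (simp add: G0)
  have "2 * (\<integral>x. of_real (g x) * fourier \<phi> x \<partial>lborel) = (\<integral>y. of_real (G y) * A y \<partial>lborel) + (\<integral>y. of_real (G y) * A (- y) \<partial>lborel)"
    using 1 2 by simp
  also have "\<dots> = (2 * pi) * (\<integral>y. of_real (G y) * radon \<phi> y \<partial>lborel)"
    by (simp only: Bochner_Integration.integral_add[OF intGA intGA', symmetric] AA integral_mult_right_zero)
  finally show "(\<integral>x. of_real (g x) * fourier \<phi> x \<partial>lborel) = pi * (\<integral>y. of_real (g y * shell (norm y)) * radon \<phi> y \<partial>lborel)"
    by (simp add: G_def)
qed

text \<open>The truncations to balls are integrable and converge pointwise.\<close>

lemma locally_integrable_imp_measurable:
  fixes g :: "'a::euclidean_space \<Rightarrow> real"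
  assumes g: "locally_integrable lebesgue g"
  shows "g \<in> borel_measurable lebesgue"
proof (rule borel_measurable_LIMSEQ_real)
  show "(\<lambda>x. indicator (cball 0 (real k)) x * g x) \<in> borel_measurable lebesgue" for k
    using g by (auto simp: locally_integrable_def set_integrable_def dest!: spec[of _ "cball 0 (real k)"])
  fix x :: 'a
  obtain N where N: "norm x \<le> real N" using real_arch_simple by blast
  have "eventually (\<lambda>k. indicator (cball 0 (real k)) x * g x = g x) sequentially"
    using eventually_ge_at_top[of N] by eventually_elim (use N in \<open>auto simp: indicator_def\<close>)
  then show "(\<lambda>k. indicator (cball 0 (real k)) x * g x) \<longlonglongrightarrow> g x"
    by (rule tendsto_eventually)
qed

text \<open>Each value of \<open>h\<close> integrates \<open>g\<close> over a set that is null in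
  the space, so exchanging \<open>g\<close> for a Borel version might change it. The main extra work
  is to show that for almost every hyperplane it does not.\<close>

lemma distributional_fourier_homogeneous:
  fixes g :: "'a::euclidean_space \<Rightarrow> real" and h :: "'a \<Rightarrow> complex"
  assumes dim: "DIM('a) \<ge> 2" and loc: "locally_integrable lebesgue g"
    and hom: "\<And>c x. c > 0 \<Longrightarrow> g (c *\<^sub>R x) = g x / c ^ (DIM('a) - 1)" and even: "\<And>x. g (- x) = g x"
    and h: "\<And>x. x \<noteq> 0 \<Longrightarrow> h x = of_real (pi * ((1 / norm x) * (\<integral>y. g y * shell (norm y) \<partial>completion (hyp_lborel x))))"
  shows "has_distributional_fourier (\<lambda>x. of_real (g x)) h"
proof -
  have gm: "g \<in> borel_measurable lebesgue" by (rule locally_integrable_imp_measurable[OF loc])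
  obtain g' where g'm: "g' \<in> borel_measurable lborel" and gg': "AE x in lborel. g x = g' x"
    using completion_ex_borel_measurable_real[OF gm] by auto
  have [measurable]: "g' \<in> borel_measurable borel" using g'm by simp
  have hom': "AE x in lborel. g' (c *\<^sub>R x) = g' x / c ^ (DIM('a) - 1)" if "c > 0" for c
  proof -
    have "AE x in lborel. g (c *\<^sub>R x) = g' (c *\<^sub>R x)"
      using that gg' by (intro AE_lborel_scaleR) auto
    with gg' show ?thesis by eventually_elim (use hom[OF that] in simp)
  qed
  have even': "AE x in lborel. g' (- x) = g' x"
  proof -
    have "AE x in lborel. g ((-1) *\<^sub>R x) = g' ((-1) *\<^sub>R x)"
      using gg' by (intro AE_lborel_scaleR) auto
    with gg' show ?thesis by eventually_elim (use even in simp)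
  qed
  define G where "G x = g' x * shell (norm x)" for x
  have [measurable]: "G \<in> borel_measurable borel" unfolding G_def by measurable
  have G0: "G y = 0" if "norm y < 1" for y using that by (simp add: G_def shell_eq_0)
  have intG: "integrable lborel G"
  proof -
    have "integrable lebesgue (\<lambda>x. indicator (cball 0 2) x * g x)"
      using loc by (auto simp: locally_integrable_def set_integrable_def)
    moreover have ae: "AE x in lborel. indicator (cball 0 2) x * g' x = indicator (cball 0 2) x * g x"
      using gg' by eventually_elim simp
    moreover have "(\<lambda>x. indicator (cball 0 2) x * g' x) \<in> borel_measurable lborel"
      by (intro borel_measurable_times borel_measurable_indicator) auto
    ultimately have "integrable lborel (\<lambda>x. indicator (cball 0 2) x * g' x)"
      using integral_completion_cong_AE(2)[OF _ ae] by blast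
    then have "integrable lborel (\<lambda>x. 4 * (indicator (cball 0 2) x * g' x))" by simp
    then show ?thesis
    proof (rule Bochner_Integration.integrable_bound)
      have "\<bar>G x\<bar> \<le> \<bar>4 * (indicator (cball 0 2) x * g' x)\<bar>" for x
      proof (cases "norm x \<le> 2")
        case True
        have "\<bar>g' x\<bar> * shell (norm x) \<le> \<bar>g' x\<bar> * 4" by (intro mult_left_mono shell_le) simp
        then show ?thesis using True by (simp add: G_def abs_mult)
      qed (simp add: G_def shell_eq_0)
      then show "AE x in lborel. norm (G x) \<le> norm (4 * (indicator (cball 0 2) x * g' x))" by simp
    qed measurable
  qed
  have AEh: "AE x in lborel. of_real (pi * radon G x) = h x"
  proof -
    obtain N where N: "N \<in> null_sets lborel" and sub: "{x \<in> space lborel. \<not> g x = g' x} \<subseteq> N"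
      using gg' by (auto simp: eventually_ae_filter)
    then have [measurable]: "N \<in> sets borel" by (auto simp: null_sets_def)
    have gN: "g x = g' x" if "x \<notin> N" for x using sub that by auto
    \<comment> \<open>Pairs whose second component lies in \<open>N\<close> have incidence measure
      0, as integrating over that component last shows. Integrating over it first, \<open>N\<close>
      is null on the hyperplane orthogonal to almost every \<open>x\<close>.\<close>
    have "(\<integral>\<^sup>+x. ennreal (1 / norm x) * (\<integral>\<^sup>+y. indicator N y \<partial>hyp_lborel x) \<partial>lborel) =
        (\<integral>\<^sup>+y. ennreal (1 / norm y) * (\<integral>\<^sup>+x. indicator N y \<partial>hyp_lborel y) \<partial>lborel)"
      using nn_integral_incidence_swap[OF dim, of "\<lambda>p. indicator N (snd p)"] by simp
    also have "\<dots> = (\<integral>\<^sup>+y. 0 \<partial>(lborel :: 'a measure))"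
      using AE_not_in[OF N] by (intro nn_integral_cong_AE) (auto elim!: eventually_mono)
    finally have zero: "(\<integral>\<^sup>+x. ennreal (1 / norm x) * (\<integral>\<^sup>+y. indicator N y \<partial>hyp_lborel x) \<partial>lborel) = 0"
      by simp
    \<comment> \<open>The same quantity written over a fixed measure, from which its Borel
      measurability in \<open>x\<close> can be read off.\<close>
    define r where "r x = (\<integral>\<^sup>+z. ennreal (bump (z \<bullet> sgn x) / norm x) * indicator N (z - (z \<bullet> sgn x) *\<^sub>R sgn x) \<partial>lborel)" for x :: 'a
    have [measurable]: "r \<in> borel_measurable borel" unfolding r_def by measurable
    have r: "ennreal (1 / norm x) * (\<integral>\<^sup>+y. indicator N y \<partial>hyp_lborel x) = r x" for x
    proof (cases "x = 0")
      case False
      have "(\<integral>\<^sup>+y. indicator N y \<partial>hyp_lborel x) =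
          (\<integral>\<^sup>+z. indicator N (z - (z \<bullet> sgn x) *\<^sub>R sgn x) * ennreal (bump (z \<bullet> sgn x)) \<partial>lborel)"
        using nn_integral_hyp_bump[of "sgn x" "indicator N"] False by (simp add: norm_sgn hyp_lborel_sgn)
      moreover have "ennreal (1 / norm x) * (a * ennreal (bump t)) = ennreal (bump t / norm x) * a" for a t
      proof -
        have "ennreal (bump t / norm x) = ennreal (1 / norm x) * ennreal (bump t)"
          by (simp flip: ennreal_mult)
        then show ?thesis by (simp add: mult_ac)
      qed
      ultimately show ?thesis unfolding r_def by (simp flip: nn_integral_cmult)
    qed (simp add: r_def)
    have "AE x in lborel. r x = 0"
      using zero unfolding r by (subst (asm) nn_integral_0_iff_AE) auto
    then show ?thesis
      using AE_lborel_singleton[of "0::'a"]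
    proof eventually_elim
      case (elim x)
      then have "(\<integral>\<^sup>+y. indicator N y \<partial>hyp_lborel x) = 0"
        using r[of x] by simp
      then have "N \<in> null_sets (hyp_lborel x)" by (auto simp: null_sets_def)
      then have "AE y in hyp_lborel x. y \<notin> N" by (rule AE_not_in)
      then have "AE y in hyp_lborel x. G y = g y * shell (norm y)"
        by eventually_elim (simp add: G_def gN)
      then have "(\<integral>y. g y * shell (norm y) \<partial>completion (hyp_lborel x)) = (\<integral>y. G y \<partial>hyp_lborel x)"
        by (intro integral_completion_cong_AE) simp
      then show ?case using elim by (simp add: h radon_def)
    qed
  qed
  \<comment> \<open>Stated for all measurable functions dominated by \<open>decay_weight\<close>:
    besides Schwartz functions it is applied to indicators of compact sets, which gives the local
    integrability of \<open>h\<close>.\<close>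
  have test: "integrable lborel (\<lambda>x. of_real (pi * radon G x) * \<phi> x)" "integrable lebesgue (\<lambda>x. h x * \<phi> x)"
    "(\<integral>x. h x * \<phi> x \<partial>lebesgue) = pi * (\<integral>y. of_real (G y) * radon \<phi> y \<partial>lborel)"
    if [measurable]: "\<phi> \<in> borel_measurable borel" and C: "\<And>x. norm (\<phi> x) \<le> C * decay_weight x" for \<phi> :: "'a \<Rightarrow> complex" and C
  proof -
    note R = integrable_radon_mult[OF dim intG G0 _ C] integral_radon_mult[OF dim intG G0 _ C]
    have *: "of_real (pi * radon G x) * \<phi> x = pi * (of_real (radon G x) * \<phi> x)" for x by simp
    show int: "integrable lborel (\<lambda>x. of_real (pi * radon G x) * \<phi> x)"
      unfolding * by (intro integrable_mult_right R) measurable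
    have ae: "AE x in lborel. of_real (pi * radon G x) * \<phi> x = h x * \<phi> x"
      using AEh by eventually_elim simp
    have m: "(\<lambda>x. of_real (pi * radon G x) * \<phi> x) \<in> borel_measurable lborel" by measurable
    show "integrable lebesgue (\<lambda>x. h x * \<phi> x)"
      using integral_completion_cong_AE(2)[OF m ae] int by simp
    have "(\<integral>x. h x * \<phi> x \<partial>lebesgue) = (\<integral>x. of_real (pi * radon G x) * \<phi> x \<partial>lborel)"
      by (rule integral_completion_cong_AE(1)[OF m ae])
    also have "\<dots> = pi * (\<integral>y. of_real (G y) * radon \<phi> y \<partial>lborel)"
      unfolding * integral_mult_right_zero by (subst R(2)) simp_all
    finally show "(\<integral>x. h x * \<phi> x \<partial>lebesgue) = pi * (\<integral>y. of_real (G y) * radon \<phi> y \<partial>lborel)" .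
  qed
  have "locally_integrable lebesgue h"
    unfolding locally_integrable_def
  proof (intro allI impI)
    fix A :: "'a set" assume A: "compact A"
    then have [measurable]: "A \<in> sets borel" by (simp add: compact_imp_closed borel_closed)
    \<comment> \<open>A positive lower bound of the continuous weight on the compact set lets a
      multiple of the weight dominate the indicator.\<close>
    obtain w where w: "w > 0" "\<And>x. x \<in> A \<Longrightarrow> w \<le> decay_weight x"
    proof (cases "A = {}")
      case True
      then show ?thesis using that[of 1] by auto
    next
      case False
      then obtain a where "a \<in> A" "\<And>x. x \<in> A \<Longrightarrow> decay_weight a \<le> decay_weight x"
        using continuous_attains_inf[OF A False continuous_on_decay_weight] by blast
      then show ?thesis using that[of "decay_weight a"] by simp
    qed
    have "norm (complex_of_real (indicator A x)) \<le> (1 / w) * decay_weight x" for x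
      using w(1) w(2)[of x] by (cases "x \<in> A") (auto simp: field_simps)
    then have "integrable lebesgue (\<lambda>x. h x * complex_of_real (indicator A x))"
      by (intro test(2)) measurable
    then show "set_integrable lebesgue A h"
      by (simp add: set_integrable_def scaleR_conv_of_real mult.commute)
  qed
  moreover have "locally_integrable lebesgue (\<lambda>x. complex_of_real (g x))"
    unfolding locally_integrable_def set_integrable_def
  proof (intro allI impI)
    fix A :: "'a set" assume "compact A"
    then have "integrable lebesgue (\<lambda>x. complex_of_real (indicator A x * g x))"
      using loc by (intro integrable_of_real) (simp add: locally_integrable_def set_integrable_def)
    then show "integrable lebesgue (\<lambda>x. indicator A x *\<^sub>R complex_of_real (g x))"
      by (simp add: scaleR_conv_of_real)
  qed
  moreover have "integrable lebesgue (\<lambda>x. of_real (g x) * fourier \<phi> x) \<and> integrable lebesgue (\<lambda>x. h x * \<phi> x) \<and>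
      (\<integral>x. h x * \<phi> x \<partial>lebesgue) = (\<integral>x. of_real (g x) * fourier \<phi> x \<partial>lebesgue)"
    if \<phi>: "schwartz \<phi>" for \<phi>
  proof -
    have [measurable]: "\<phi> \<in> borel_measurable borel"
      using schwartz_continuous[OF \<phi>, of "[]"] by (simp add: borel_measurable_continuous_onI)
    have [measurable]: "fourier \<phi> \<in> borel_measurable borel" by (rule borel_measurable_fourier) measurable
    obtain C where C: "\<And>x. norm (\<phi> x) \<le> C * decay_weight x"
      using schwartz_decay[OF \<phi>, of "[]"] by auto
    note four = homogeneous_even_fourier[OF _ hom' even' intG[unfolded G_def] \<phi>]
    have ae: "AE x in lborel. of_real (g' x) * fourier \<phi> x = of_real (g x) * fourier \<phi> x"
      using gg' by eventually_elim simp
    have m: "(\<lambda>x. of_real (g' x) * fourier \<phi> x) \<in> borel_measurable lborel" by measurable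
    have "integrable lebesgue (\<lambda>x. of_real (g x) * fourier \<phi> x)"
      using integral_completion_cong_AE(2)[OF m ae] four(1) by simp
    moreover have "(\<integral>x. of_real (g x) * fourier \<phi> x \<partial>lebesgue) = pi * (\<integral>y. of_real (G y) * radon \<phi> y \<partial>lborel)"
      using integral_completion_cong_AE(1)[OF m ae] four(2) by (simp add: G_def)
    ultimately show ?thesis using test(2,3)[OF _ C] by simp
  qed
  ultimately show ?thesis by (simp add: has_distributional_fourier_def)
qed

text \<open>In the slab form the normal enters only through the integrand, which is continuous in it
  off the origin, so dominated convergence applies. In the majorant, 2 bounds \<open>bump\<close>,
  and the radius \<open>R + 1\<close> allows for the projection, which moves a point by at most 1
  where the bump is nonzero.\<close>

lemma continuous_on_radon:
  fixes G :: "'a::euclidean_space \<Rightarrow> real"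
  assumes cont: "continuous_on UNIV G" and supp: "\<And>x. norm x \<ge> R \<Longrightarrow> G x = 0"
  shows "continuous_on (- {0}) (radon G)"
proof -
  have [measurable]: "G \<in> borel_measurable borel" using cont by (rule borel_measurable_continuous_onI)
  have "compact (G ` cball 0 R)" by (intro compact_continuous_image continuous_on_subset[OF cont]) auto
  then obtain M where M: "M > 0" "\<And>x. x \<in> cball 0 R \<Longrightarrow> norm (G x) \<le> M"
    using compact_imp_bounded bounded_pos by (metis imageI)
  have GM: "\<bar>G x\<bar> \<le> M" for x
    using M(2)[of x] M(1) supp[of x] by (cases "norm x \<le> R") auto
  let ?k = "\<lambda>y z. bump (z \<bullet> sgn y) *\<^sub>R G (z - (z \<bullet> sgn y) *\<^sub>R sgn y)"
  have k: "norm (?k y z) \<le> 2 * M * indicator (cball 0 (R + 1)) z" if "y \<noteq> 0" for y z :: 'a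
  proof (cases "0 < z \<bullet> sgn y \<and> z \<bullet> sgn y < 1 \<and> norm z > R + 1")
    case True
    let ?p = "z - (z \<bullet> sgn y) *\<^sub>R sgn y"
    have "norm z \<le> norm ?p + norm ((z \<bullet> sgn y) *\<^sub>R sgn y)"
      using norm_triangle_ineq[of ?p "(z \<bullet> sgn y) *\<^sub>R sgn y"] by simp
    also have "norm ((z \<bullet> sgn y) *\<^sub>R sgn y) \<le> 1" using True that by (simp add: norm_sgn)
    finally have "norm ?p \<ge> R" using True by simp
    then show ?thesis using True by (simp add: supp)
  next
    case False
    show ?thesis
    proof (cases "norm z \<le> R + 1")
      case True
      have "bump (z \<bullet> sgn y) * \<bar>G (z - (z \<bullet> sgn y) *\<^sub>R sgn y)\<bar> \<le> 2 * M"
        using bump_le GM by (intro mult_mono) auto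
      then show ?thesis using True by (simp add: abs_mult)
    next
      case out: False
      then have "bump (z \<bullet> sgn y) = 0" using False by (intro bump_eq_0) auto
      then show ?thesis using M(1) by simp
    qed
  qed
  have eq: "(\<integral>x. G x \<partial>hyp_lborel y) = (\<integral>z. ?k y z \<partial>lborel)" if "y \<noteq> 0" for y
    using integral_hyp_bump[of "sgn y" G] that by (simp add: norm_sgn hyp_lborel_sgn)
  have "continuous_on (- {0}) (\<lambda>y. \<integral>z. ?k y z \<partial>lborel)"
    unfolding continuous_on_sequentially
  proof (intro ballI allI impI)
    fix a and X :: "nat \<Rightarrow> 'a" assume a: "a \<in> - {0}" and X: "(\<forall>i. X i \<in> - {0}) \<and> X \<longlonglongrightarrow> a"
    have sgnX: "(\<lambda>i. sgn (X i)) \<longlonglongrightarrow> sgn a" using X a by (intro tendsto_sgn) auto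
    show "((\<lambda>y. \<integral>z. ?k y z \<partial>lborel) \<circ> X) \<longlonglongrightarrow> (\<integral>z. ?k a z \<partial>lborel)"
      unfolding o_def
    proof (rule integral_dominated_convergence[where w="\<lambda>z. 2 * M * indicator (cball 0 (R + 1)) z"])
      show "integrable lborel (\<lambda>z::'a. 2 * M * indicator (cball 0 (R + 1)) z :: real)"
        by (intro integrable_mult_right integrable_indicator_cball)
      show "AE z in lborel. norm (?k (X i) z) \<le> 2 * M * indicator (cball 0 (R + 1)) z" for i
        using k[of "X i"] X by (intro AE_I2) auto
      have contb: "continuous_on UNIV bump" using continuous_on_bump[OF continuous_on_id, of UNIV] by (simp add: id_def)
      have "(\<lambda>i. ?k (X i) z) \<longlonglongrightarrow> ?k a z" for z
        by (intro tendsto_scaleR continuous_on_tendsto_compose[OF cont] continuous_on_tendsto_compose[OF contb]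
            tendsto_diff tendsto_inner tendsto_const sgnX) auto
      then show "AE z in lborel. (\<lambda>i. ?k (X i) z) \<longlonglongrightarrow> ?k a z" by simp
    qed measurable
  qed
  then have "continuous_on (- {0}) (\<lambda>y. \<integral>x. G x \<partial>hyp_lborel y)"
    by (rule continuous_on_cong[THEN iffD1, rotated 2]) (auto simp: eq)
  then show ?thesis unfolding radon_def by (intro continuous_intros) auto
qed

lemma radial_integral_scaleR:
  fixes f :: "real^'n \<Rightarrow> real"
  assumes n: "CARD('n) \<ge> 2" and K: "star_body K" and c: "c > 0"
  shows "radial_integral f K (c *\<^sub>R x) = radial_integral f K x / c ^ (CARD('n) - 1)"
proof (cases "x = 0")
  case True
  \<comment> \<open>As \<open>n \<ge> 2\<close>, the exponent \<open>1 - n\<close> is nonzero, so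
    the prefactor at the origin is 0 by convention and both sides vanish.\<close>
  then show ?thesis using n by (simp add: radial_integral_def)
next
  case False
  have "sgn (c *\<^sub>R x) = sgn x" using c by (simp add: sgn_scaleR)
  then show ?thesis
    using n c False
    by (simp add: radial_integral_eq_ray_integral[OF K] power_int_one_minus power_mult_distrib divide_inverse mult_ac)
qed

lemma radial_integral_minus:
  fixes f :: "real^'n \<Rightarrow> real"
  assumes K: "star_body K" "uminus ` K = K" and f: "\<And>x. f (- x) = f x"
  shows "radial_integral f K (- x) = radial_integral f K x"
proof (cases "x = 0")
  case False
  have "- y \<in> K \<longleftrightarrow> y \<in> K" for y
    using K(2) by (metis image_eqI minus_minus)
  then have "indicator K (- y) * f (- y) = indicator K y * f y" for y
    by (simp add: f indicator_def)
  then show ?thesis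
    using False by (simp add: radial_integral_eq_ray_integral[OF K(1)] ray_integral_def sgn_minus)
qed simp

text \<open>A distribution has no value at a single point of the sphere, so its transform is
  represented by a function \<open>h\<close> for which the identity holds at every unit vector.
  Homogeneity fixes \<open>h\<close> along rays, and for a radial integral continuous off the
  origin, continuity singles out \<open>h\<close> there among the functions equal to it almost
  everywhere. Local integrability of the radial integral lets it act as a distribution.\<close>

theorem theorem3:
  fixes f :: "real^'n \<Rightarrow> real" and K :: "(real^'n) set"
  assumes "CARD('n) \<ge> 2"
    and "\<And>x. f (- x) = f x"
    and "\<And>\<xi>. \<xi> \<in> sphere 0 1 \<Longrightarrow> locally_integrable (subspace_lebesgue ({\<xi>}\<^sup>\<bottom>)) f"
    and "star_body K"
    and "uminus ` K = K"
    and "locally_integrable lebesgue (radial_integral f K)"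
  shows "\<exists>h :: real^'n \<Rightarrow> complex.
    has_distributional_fourier (\<lambda>x. complex_of_real (radial_integral f K x)) h \<and>
    homogeneous (- 1) h \<and>
    (continuous_on (- {0}) (radial_integral f K) \<longrightarrow> continuous_on (- {0}) h) \<and>
    (\<forall>\<xi>\<in>sphere 0 1.
       complex_of_real (hyperplane_measure f \<xi> (K \<inter> {\<xi>}\<^sup>\<bottom>)) = 1 / complex_of_real pi * h \<xi>)"
proof -
  let ?g = "radial_integral f K"
  \<comment> \<open>The section function extended with degree -1 and multiplied by pi: homogeneity
    and the values on the sphere hold by construction, so the substance lies in the distributional
    identity.\<close>
  define h where "h x = complex_of_real (pi * hyperplane_measure f (sgn x) (K \<inter> {sgn x}\<^sup>\<bottom>) / norm x)" for x
  have h: "h x = of_real (pi * ((1 / norm x) * (\<integral>y. ?g y * shell (norm y) \<partial>completion (hyp_lborel x))))" if "x \<noteq> 0" for x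
  proof -
    have x: "norm (sgn x) = 1" using that by (simp add: norm_sgn)
    then have "locally_integrable (subspace_lebesgue ({sgn x}\<^sup>\<bottom>)) f" by (intro assms(3)) simp
    from hyperplane_measure_eq[OF assms(1,4) x this] show ?thesis
      by (simp add: h_def hyp_lborel_sgn)
  qed
  have "has_distributional_fourier (\<lambda>x. complex_of_real (?g x)) h"
  proof (rule distributional_fourier_homogeneous[OF _ assms(6) _ _ h])
    show "DIM(real^'n) \<ge> 2" using assms(1) by simp
    show "?g (c *\<^sub>R x) = ?g x / c ^ (DIM(real^'n) - 1)" if "c > 0" for c x
      using radial_integral_scaleR[OF assms(1,4) that] by simp
    show "?g (- x) = ?g x" for x using assms(4,5) by (rule radial_integral_minus) (rule assms(2))
  qed
  moreover have "homogeneous (- 1) h"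
    unfolding homogeneous_def
  proof (intro allI impI)
    fix c :: real and x :: "real^'n" assume "0 < c"
    then have "sgn (c *\<^sub>R x) = sgn x" by (simp add: sgn_scaleR)
    then show "h (c *\<^sub>R x) = of_real (c powi - 1) * h x"
      using \<open>0 < c\<close> by (simp add: h_def power_int_minus field_simps)
  qed
  moreover have "continuous_on (- {0}) h" if cont: "continuous_on (- {0}) ?g"
  proof -
    \<comment> \<open>The factor \<open>shell (norm x)\<close> vanishes near the origin, so the
      product is continuous on the whole space. It is then Borel, and its integral for the completed
      measure is the one in \<open>radon\<close>.\<close>
    define G where "G x = ?g x * shell (norm x)" for x
    have "continuous_on (- {0}) G"
      unfolding G_def by (intro continuous_intros cont)
    moreover have "continuous_on (ball 0 1) G"
      by (rule continuous_on_cong[THEN iffD2, OF refl _ continuous_on_const[of _ 0]])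
         (auto simp: G_def shell_eq_0)
    ultimately have "continuous_on (- {0} \<union> ball 0 1) G"
      by (intro continuous_on_open_Un) auto
    moreover have "- {0} \<union> ball 0 1 = (UNIV :: (real^'n) set)" by auto
    ultimately have contG: "continuous_on UNIV G" by simp
    then have "G \<in> borel_measurable borel" by (rule borel_measurable_continuous_onI)
    then have hG: "h x = of_real (pi * radon G x)" if "x \<noteq> 0" for x
      using h[OF that] integral_completion[of G "hyp_lborel x"] by (simp add: radon_def G_def[abs_def])
    have "continuous_on (- {0}) (radon G)"
      by (rule continuous_on_radon[OF contG, of 2]) (simp add: G_def shell_eq_0)
    then have "continuous_on (- {0}) (\<lambda>x. complex_of_real (pi * radon G x))"
      by (intro continuous_intros)
    then show ?thesis
      by (rule continuous_on_cong[THEN iffD1, rotated 2]) (auto simp: hG)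
  qed
  moreover have "complex_of_real (hyperplane_measure f \<xi> (K \<inter> {\<xi>}\<^sup>\<bottom>)) = 1 / complex_of_real pi * h \<xi>"
    if "\<xi> \<in> sphere 0 1" for \<xi>
    using that by (simp add: h_def sgn_div_norm)
  ultimately show ?thesis by blast
qed

end
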